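(* Let $G$ be a group, $M$ a right $\mathbb Z[G]$-module, $\varphi:G\to Z(G)$ a group homomorphism into the center of $G$, $X=\bigsqcup_{m\in M}(\{m\}\times G)=M\times G$ the $G$-Alexander multiple conjugation biquandle of $(M,\varphi)$, $A$ an abelian group and $\lambda:G\to A$ a group homomorphism. Let $n\ge2$. For any normalized group $n$-cocycle $f:C_n^{\rm norgp}(M;\mathbb Z)_G\to A$, the map $$\Phi_{f,\lambda}:=(f\otimes{\rm id}_A)\circ\psi_{n,\lambda}\circ\gamma_n\circ{\rm proj}_n:\ C_n(X;\mathbb Z)\to A\otimes_{\mathbb Z}A$$ is (well defined on $C_n(X;\mathbb Z)=P_n(X;\mathbb Z)/D_n(X;\mathbb Z)$ and is) an $n$-cocycle of the multiple conjugation biquandle $X$ (with trivial $X$-set).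
   Context: **$G$-Alexander multiple conjugation biquandle (MCB).** $X=M\times G$ with $(m,g)\,\underline{*}\,(n,h)=(mh+n(\varphi(h)-h),\,h^{-1}gh)$, $(m,g)\,\overline{*}\,(n,h)=(m\varphi(h),\,g)$, decomposed as the disjoint union of the groups $G_m:=\{m\}\times G$ ($m\in M$) with product $(m,g)(m,h)=(m,gh)$. **MCB complex (trivial $X$-set).** For $n\ge0$, $P_n(X;\mathbb Z)$ is the free abelian group on symbols $\langle\bm x_1\rangle\cdots\langle\bm x_k\rangle$, where $\langle\bm x_i\rangle=\langle x_{i1},\dots,x_{in_i}\rangle$ with $n_i\ge1$, all entries of a given $\bm x_i$ lie in one and the same group $G_m$ ($m$ may depend on $i$), and $n_1+\cdots+n_k=n$; $P_n=0$ for $n<0$. Operations with an element apply entrywise: $\langle\bm x_i\underline{*}x\rangle=\langle x_{i1}\underline{*}x,\dots,x_{in_i}\underline{*}x\rangle$, similarly for $\overline{*}$. For $n\ge1$, $$\partial_n(\langle\bm x_1\rangle\cdots\langle\bm x_k\rangle)=\sum_{i=1}^k(-1)^{n_1+\cdots+n_{i-1}}\Bigl\{\langle\bm x_1\underline{*}x_{i1}\rangle\cdots\langle\bm x_{i-1}\underline{*}x_{i1}\rangle\langle\widetilde{\bm x}_i\overline{*}x_{i1}\rangle\langle\bm x_{i+1}\overline{*}x_{i1}\rangle\cdots\langle\bm x_k\overline{*}x_{i1}\rangle+\sum_{j=1}^{n_i}(-1)^j\langle\bm x_1\rangle\cdots\langle x_{i1},\dots,x_{i(j-1)},x_{i(j+1)},\dots,x_{in_i}\rangle\cdots\langle\bm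 x_k\rangle\Bigr\},$$ with $\langle\widetilde{\bm x}_i\overline{*}x_{i1}\rangle=\langle(x_{i1}^{-1}x_{i2})\overline{*}x_{i1},\dots,(x_{i1}^{-1}x_{in_i})\overline{*}x_{i1}\rangle$; factors that become empty are omitted. For $\langle\bm a\rangle=\langle a_1,\dots,a_s\rangle$, $\langle\bm b\rangle=\langle b_1,\dots,b_t\rangle$ with all entries in one group $G_m$, put $$\langle\langle\bm a\rangle\langle\bm b\rangle\rangle=\sum_\mu(-1)^{\sum_{l=1}^s(\mu(l)-l)}\langle c_1,\dots,c_{s+t}\rangle,\qquad c_j=a_{\lfloor j;\mu\rfloor}\,b_{j-\lfloor j;\mu\rfloor},$$ over strictly increasing $\mu:\{1,\dots,s\}\to\{1,\dots,s+t\}$, where $\lfloor j;\mu\rfloor$ is the number of $l$ with $\mu(l)\le j$ and $a_0=b_0$ is the identity of $G_m$. $D_n(X;\mathbb Z)\subset P_n(X;\mathbb Z)$ is generated by all $\langle\bm a_1\rangle\cdots\langle\bm a\rangle\langle\bm b\rangle\cdots\langle\bm a_k\rangle-\langle\bm a_1\rangle\cdots\langle\langle\bm a\rangle\langle\bm b\rangle\rangle\cdots\langle\bm a_k\rangle$ (with $\bm a,\bm b$ having all entries in one $G_m$) for $n\ge 2$, and $D_n=0$ for $n\le1$. It is known that $(P_*,\partial)$ is a chain complex with subcomplex $D_*$; $C_*(X;\mathbb Z)=P_*/D_*$. An $n$-cocycle of the MCB $X$ with values in an abelian group $B$ is a homomorphism $\Phi:C_n(X;\mathbb Z)\to B$ with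 $\Phi\circ\partial_{n+1}=0$. **Group complex.** $C_n^{\rm gp}(M;\mathbb Z)_G$ is the free abelian group on $M^n$ ($n\ge1$) modulo all $(m_1g,\dots,m_ng)-(m_1,\dots,m_n)$, $g\in G$, with boundary ($n\ge2$) $$\partial_n^{\rm gp}(m_1,\dots,m_n)=(m_2,\dots,m_n)+\sum_{i=1}^{n-1}(-1)^i(m_1,\dots,m_i+m_{i+1},\dots,m_n)+(-1)^n(m_1,\dots,m_{n-1}).$$ $D_n^{\rm gp}(M;\mathbb Z)_G$ ($n\ge2$) is the subgroup generated by the tuples $(m_1,\dots,m_n)$ with $m_i=0$ for some $1\le i\le n-1$, and $C_n^{\rm norgp}(M;\mathbb Z)_G=C_n^{\rm gp}(M;\mathbb Z)_G/D_n^{\rm gp}(M;\mathbb Z)_G$. A normalized group $n$-cocycle is a homomorphism $f:C_n^{\rm gp}(M;\mathbb Z)_G\to A$ vanishing on $D_n^{\rm gp}(M;\mathbb Z)_G$ (equivalently, defined on $C_n^{\rm norgp}(M;\mathbb Z)_G$) with $f\circ\partial_{n+1}^{\rm gp}=0$. **The maps ($n\ge2$).** $C_n^{\rm BR}(X;\mathbb Z)$ is the free abelian group on $X^n$, and $C_n^{\rm BR_U}(X;\mathbb Z)$ is the free abelian group on $G^n\times M^n$. - ${\rm proj}_n:P_n(X;\mathbb Z)\to C_n^{\rm BR}(X;\mathbb Z)$ sends $\langle\bm x_1\rangle\cdots\langle\bm x_k\rangle$ to $(x_{11},x_{21},\dots,x_{k1})$ if $k=n$ and to $0$ otherwise. -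 $\gamma_n((m_1,g_1),\dots,(m_n,g_n))=(g_1,\dots,g_n;\,m_1-m_2,\dots,m_{n-1}-m_n,\,m_n)$. - $\psi_n(g_1,\dots,g_n;m_1,\dots,m_n)=\sum_k(-1)^{k_1+\cdots+k_n}(m_1\bm g_{k,1},\dots,m_n\bm g_{k,n})\in C_n^{\rm gp}(M;\mathbb Z)_G$, where $k$ runs over $\{0,1\}^n$ with $k_1=0$ and $\bm g_{k,i}=\varphi(g_1^{k_1}\cdots g_i^{k_i})g_{i+1}^{k_{i+1}}\cdots g_n^{k_n}$. - $\psi_{n,\lambda}:C_n^{\rm BR_U}(X;\mathbb Z)\to C_n^{\rm gp}(M;\mathbb Z)_G\otimes_{\mathbb Z}A$ is $\psi_{n,\lambda}(g_1,\dots,g_n;\bm m)=\psi_n(g_1,\dots,g_n;\bm m)\otimes\lambda(g_1)$. The composite $(f\otimes{\rm id}_A)\circ\psi_{n,\lambda}\circ\gamma_n\circ{\rm proj}_n$ is formed on $P_n(X;\mathbb Z)$ and then regarded on the quotient $C_n(X;\mathbb Z)$. *)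

theory Defs
  imports "HOL-Algebra.Algebra"
begin

section \<open>Right modules over an integral group ring\<close>

definition center :: "('g, 'x) monoid_scheme \<Rightarrow> 'g set" where
  "center G = {z \<in> carrier G. \<forall>g \<in> carrier G. z \<otimes>\<^bsub>G\<^esub> g = g \<otimes>\<^bsub>G\<^esub> z}"

text \<open>The ring $\mathbb{Z}[G]$: finitely supported integer combinations of elements of $G$
  with the convolution product.\<close>

definition group_ring :: "('g, 'x) monoid_scheme \<Rightarrow> ('g \<Rightarrow>\<^sub>0 int) ring" where
  "group_ring G =
    \<lparr>carrier = carrier (free_Abelian_group (carrier G)),
     monoid.mult = (\<lambda>a b. frag_extend (\<lambda>g. frag_extend (\<lambda>h. frag_of (g \<otimes>\<^bsub>G\<^esub> h)) b) a),
     monoid.one = frag_of \<one>\<^bsub>G\<^esub>,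
     ring.zero = 0,
     ring.add = (+)\<rparr>"

text \<open>The library locale \<open>module\<close> is restricted to commutative rings. The multiplicative
  fields of the record \<open>M\<close> are not used.\<close>

locale right_module = R: ring R + M: abelian_group M
  for R :: "('r, 'x) ring_scheme" and M :: "('m, 'y) ring_scheme" +
  fixes act :: "'m \<Rightarrow> 'r \<Rightarrow> 'm"
  assumes act_closed: "\<lbrakk>m \<in> carrier M; r \<in> carrier R\<rbrakk> \<Longrightarrow> act m r \<in> carrier M"
    and act_add_left: "\<lbrakk>m \<in> carrier M; m' \<in> carrier M; r \<in> carrier R\<rbrakk>
      \<Longrightarrow> act (m \<oplus>\<^bsub>M\<^esub> m') r = act m r \<oplus>\<^bsub>M\<^esub> act m' r"
    and act_add_right: "\<lbrakk>m \<in> carrier M; r \<in> carrier R; s \<in> carrier R\<rbrakk>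
      \<Longrightarrow> act m (r \<oplus>\<^bsub>R\<^esub> s) = act m r \<oplus>\<^bsub>M\<^esub> act m s"
    and act_mult: "\<lbrakk>m \<in> carrier M; r \<in> carrier R; s \<in> carrier R\<rbrakk>
      \<Longrightarrow> act m (r \<otimes>\<^bsub>R\<^esub> s) = act (act m r) s"
    and act_one: "m \<in> carrier M \<Longrightarrow> act m \<one>\<^bsub>R\<^esub> = m"

lemma group_ring_mult_closed:
  assumes "group G" "Poly_Mapping.keys a \<subseteq> carrier G" "Poly_Mapping.keys b \<subseteq> carrier G"
  shows "Poly_Mapping.keys (frag_extend (\<lambda>g. frag_extend (\<lambda>h. frag_of (g \<otimes>\<^bsub>G\<^esub> h)) b) a)
    \<subseteq> carrier G"
proof -
  interpret group G by fact
  have "Poly_Mapping.keys (frag_extend (\<lambda>h. frag_of (g \<otimes>\<^bsub>G\<^esub> h)) b) \<subseteq> carrier G"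
    if "g \<in> carrier G" for g
  proof -
    have "(\<Union>h\<in>Poly_Mapping.keys b. Poly_Mapping.keys (frag_of (g \<otimes>\<^bsub>G\<^esub> h))) \<subseteq> carrier G"
      using that assms(3) by auto
    then show ?thesis
      using keys_frag_extend[of "\<lambda>h. frag_of (g \<otimes>\<^bsub>G\<^esub> h)" b] by (rule subset_trans[rotated])
  qed
  then have "(\<Union>g\<in>Poly_Mapping.keys a. Poly_Mapping.keys
      (frag_extend (\<lambda>h. frag_of (g \<otimes>\<^bsub>G\<^esub> h)) b)) \<subseteq> carrier G"
    using assms(2) by blast
  then show ?thesis
    using keys_frag_extend[of "\<lambda>g. frag_extend (\<lambda>h. frag_of (g \<otimes>\<^bsub>G\<^esub> h)) b" a]
    by (rule subset_trans[rotated])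
qed

lemma frag_extend_add_fun:
  "frag_extend (\<lambda>x. f x + g x) c = frag_extend f c + frag_extend g c"
  by (simp add: frag_extend_def frag_cmul_distrib2 sum.distrib)

lemma frag_extend_zero_fun: "frag_extend (\<lambda>x. 0) c = 0"
  by (simp add: frag_extend_def)

lemma frag_extend_minus_fun:
  fixes f :: "'a \<Rightarrow> 'b \<Rightarrow>\<^sub>0 int"
  shows "frag_extend (\<lambda>x. - f x) c = - frag_extend f c"
proof -
  have "frag_cmul k (- y) = - frag_cmul k y" for k and y :: "'b \<Rightarrow>\<^sub>0 int"
    by (rule poly_mapping_eqI) simp
  then show ?thesis
    by (simp only: frag_extend_def sum_negf)
qed

lemma ring_group_ring:
  assumes "group G"
  shows "ring (group_ring G)"
proof -
  interpret group G by fact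
  let ?m = "\<lambda>a b. frag_extend (\<lambda>g. frag_extend (\<lambda>h. frag_of (g \<otimes>\<^bsub>G\<^esub> h)) b) a"
  have add_l: "?m (a + b) c = ?m a c + ?m b c" for a b c
    by (simp add: frag_extend_add)
  have add_r: "?m a (b + c) = ?m a b + ?m a c" for a b c
    by (simp add: frag_extend_add frag_extend_add_fun)
  have diff_l: "?m (a - b) c = ?m a c - ?m b c" for a b c
    by (simp add: frag_extend_diff)
  have diff_r: "?m a (b - c) = ?m a b - ?m a c" for a b c
    using frag_extend_add_fun[of "\<lambda>g. frag_extend (\<lambda>h. frag_of (g \<otimes>\<^bsub>G\<^esub> h)) b"
      "\<lambda>g. - frag_extend (\<lambda>h. frag_of (g \<otimes>\<^bsub>G\<^esub> h)) c" a]
    by (simp add: frag_extend_diff frag_extend_minus_fun)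
  have zero: "?m 0 c = 0" "?m c 0 = 0" for c
    by (simp_all add: frag_extend_zero_fun)
  have assoc: "?m (?m a b) c = ?m a (?m b c)"
    if "Poly_Mapping.keys a \<subseteq> carrier G" "Poly_Mapping.keys b \<subseteq> carrier G"
      "Poly_Mapping.keys c \<subseteq> carrier G" for a b c
    using that(1)
  proof (induction rule: frag_induction)
    case (one x)
    show ?case using that(2)
    proof (induction rule: frag_induction)
      case (one y)
      show ?case using that(3)
      proof (induction rule: frag_induction)
        case (one z)
        then show ?case using \<open>x \<in> carrier G\<close> \<open>y \<in> carrier G\<close> by (simp add: m_assoc)
      qed (simp_all only: diff_r zero)
    qed (simp_all only: diff_r diff_l zero)
  qed (simp_all only: diff_l zero)
  have id_l: "?m (frag_of \<one>\<^bsub>G\<^esub>) a = a" if "Poly_Mapping.keys a \<subseteq> carrier G" for a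
    using that
  proof (induction rule: frag_induction)
    case (diff a b)
    then show ?case by (simp only: diff_r)
  qed simp_all
  have id_r: "?m a (frag_of \<one>\<^bsub>G\<^esub>) = a" if "Poly_Mapping.keys a \<subseteq> carrier G" for a
    using that
  proof (induction rule: frag_induction)
    case (diff a b)
    then show ?case by (simp only: diff_l)
  qed simp_all
  have keys_add: "Poly_Mapping.keys (a + b) \<subseteq> carrier G"
    if "Poly_Mapping.keys a \<subseteq> carrier G" "Poly_Mapping.keys b \<subseteq> carrier G"
    for a b :: "'a \<Rightarrow>\<^sub>0 int"
    using that keys_add[of a b] by blast
  show ?thesis
  proof (rule ringI)
    show "abelian_group (group_ring G)"
    proof (rule abelian_groupI)
      fix x assume "x \<in> carrier (group_ring G)"
      then show "\<exists>y\<in>carrier (group_ring G). y \<oplus>\<^bsub>group_ring G\<^esub> x = \<zero>\<^bsub>group_ring G\<^esub>"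
        by (intro bexI[of _ "- x"]) (auto simp: group_ring_def)
    qed (auto simp: group_ring_def keys_add add.assoc add.commute dest!: subsetD[OF keys_add])
    show "monoid (group_ring G)"
      by (rule monoidI)
        (simp_all add: group_ring_def group_ring_mult_closed[OF assms] assoc id_l[simplified] id_r[simplified])
  qed (simp_all add: group_ring_def add_l add_r)
qed


section \<open>Free abelian groups, tensor products, induced maps\<close>

text \<open>The extension of a map on a basis to a homomorphism from the free abelian group into
  the abelian group \<open>H\<close>; \<open>frag_extend\<close> is the case of a free target.\<close>

definition free_lift ::
  "('h, 'z) monoid_scheme \<Rightarrow> ('b \<Rightarrow> 'h) \<Rightarrow> ('b \<Rightarrow>\<^sub>0 int) \<Rightarrow> 'h" where
  "free_lift H u c =
    (\<Otimes>\<^bsub>H\<^esub>b \<in> Poly_Mapping.keys c. u b [^]\<^bsub>H\<^esub> Poly_Mapping.lookup c b)"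

text \<open>The map on a quotient induced by \<open>F\<close>; as in \<open>FactGroup_hom\<close>, meaningful
  only if \<open>F\<close> is constant on cosets.\<close>

definition induced :: "('c \<Rightarrow> 'd) \<Rightarrow> 'c set \<Rightarrow> 'd" where
  "induced F K = the_elem (F ` K)"

definition tensor_rel ::
  "('a, 'x) monoid_scheme \<Rightarrow> ('b, 'y) monoid_scheme \<Rightarrow> ('a \<times> 'b \<Rightarrow>\<^sub>0 int) set" where
  "tensor_rel H K = generate (free_Abelian_group (carrier H \<times> carrier K))
    ({frag_of (x \<otimes>\<^bsub>H\<^esub> x', y) - frag_of (x, y) - frag_of (x', y) | x x' y.
        x \<in> carrier H \<and> x' \<in> carrier H \<and> y \<in> carrier K} \<union>
     {frag_of (x, y \<otimes>\<^bsub>K\<^esub> y') - frag_of (x, y) - frag_of (x, y') | x y y'.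
        x \<in> carrier H \<and> y \<in> carrier K \<and> y' \<in> carrier K})"

definition tensor ::
  "('a, 'x) monoid_scheme \<Rightarrow> ('b, 'y) monoid_scheme \<Rightarrow> ('a \<times> 'b \<Rightarrow>\<^sub>0 int) set monoid" where
  "tensor H K = free_Abelian_group (carrier H \<times> carrier K) Mod tensor_rel H K"

definition tensor_class ::
  "('a, 'x) monoid_scheme \<Rightarrow> ('b, 'y) monoid_scheme \<Rightarrow> ('a \<times> 'b \<Rightarrow>\<^sub>0 int)
    \<Rightarrow> ('a \<times> 'b \<Rightarrow>\<^sub>0 int) set" where
  "tensor_class H K c =
    tensor_rel H K #>\<^bsub>free_Abelian_group (carrier H \<times> carrier K)\<^esub> c"

definition pure_tensor ::
  "('a, 'x) monoid_scheme \<Rightarrow> ('b, 'y) monoid_scheme \<Rightarrow> 'a \<Rightarrow> 'b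
    \<Rightarrow> ('a \<times> 'b \<Rightarrow>\<^sub>0 int) set" where
  "pure_tensor H K x y = tensor_class H K (frag_of (x, y))"

text \<open>\<open>u \<otimes> v\<close>, a map into the tensor product of \<open>H\<close> and \<open>K\<close>.\<close>

definition tensor_map ::
  "('c, 'x) monoid_scheme \<Rightarrow> ('d, 'y) monoid_scheme \<Rightarrow> ('a \<Rightarrow> 'c) \<Rightarrow> ('b \<Rightarrow> 'd)
    \<Rightarrow> ('a \<times> 'b \<Rightarrow>\<^sub>0 int) set \<Rightarrow> ('c \<times> 'd \<Rightarrow>\<^sub>0 int) set" where
  "tensor_map H K u v =
    induced (\<lambda>c. tensor_class H K (frag_extend (\<lambda>(x, y). frag_of (u x, v y)) c))"


section \<open>The G-Alexander multiple conjugation biquandle\<close>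

definition mcb_carrier ::
  "('g, 'x) monoid_scheme \<Rightarrow> ('m, 'y) ring_scheme \<Rightarrow> ('m \<times> 'g) set" where
  "mcb_carrier G M = carrier M \<times> carrier G"

definition mcb_under ::
  "('g, 'x) monoid_scheme \<Rightarrow> ('m, 'y) ring_scheme \<Rightarrow> ('m \<Rightarrow> ('g \<Rightarrow>\<^sub>0 int) \<Rightarrow> 'm) \<Rightarrow> ('g \<Rightarrow> 'g)
    \<Rightarrow> 'm \<times> 'g \<Rightarrow> 'm \<times> 'g \<Rightarrow> 'm \<times> 'g" where
  "mcb_under G M act \<phi> = (\<lambda>(m, g) (n, h).
    (act m (frag_of h) \<oplus>\<^bsub>M\<^esub> act n (frag_of (\<phi> h) - frag_of h),
     inv\<^bsub>G\<^esub> h \<otimes>\<^bsub>G\<^esub> g \<otimes>\<^bsub>G\<^esub> h))"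

definition mcb_over ::
  "('m \<Rightarrow> ('g \<Rightarrow>\<^sub>0 int) \<Rightarrow> 'm) \<Rightarrow> ('g \<Rightarrow> 'g)
    \<Rightarrow> 'm \<times> 'g \<Rightarrow> 'm \<times> 'g \<Rightarrow> 'm \<times> 'g" where
  "mcb_over act \<phi> = (\<lambda>(m, g) (n, h). (act m (frag_of (\<phi> h)), g))"

text \<open>Product, identity and inverse of the groups $G_m = \{m\} \times G$; the product is only
  applied to two elements of the same $G_m$.\<close>

definition mcb_mult ::
  "('g, 'x) monoid_scheme \<Rightarrow> 'm \<times> 'g \<Rightarrow> 'm \<times> 'g \<Rightarrow> 'm \<times> 'g" where
  "mcb_mult G = (\<lambda>(m, g) (_, h). (m, g \<otimes>\<^bsub>G\<^esub> h))"

definition mcb_one :: "('g, 'x) monoid_scheme \<Rightarrow> 'm \<Rightarrow> 'm \<times> 'g" where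
  "mcb_one G m = (m, \<one>\<^bsub>G\<^esub>)"

definition mcb_inv :: "('g, 'x) monoid_scheme \<Rightarrow> 'm \<times> 'g \<Rightarrow> 'm \<times> 'g" where
  "mcb_inv G = (\<lambda>(m, g). (m, inv\<^bsub>G\<^esub> g))"


section \<open>The chain complex of the multiple conjugation biquandle\<close>

text \<open>The symbol $\langle x_1\rangle\cdots\langle x_k\rangle$ is the list of the lists $x_i$.\<close>

definition in_one_group ::
  "('g, 'x) monoid_scheme \<Rightarrow> ('m, 'y) ring_scheme \<Rightarrow> ('m \<times> 'g) list \<Rightarrow> bool" where
  "in_one_group G M xs \<longleftrightarrow> (\<exists>m \<in> carrier M. set xs \<subseteq> {m} \<times> carrier G)"

definition mcb_symbols ::
  "('g, 'x) monoid_scheme \<Rightarrow> ('m, 'y) ring_scheme \<Rightarrow> nat \<Rightarrow> ('m \<times> 'g) list list set" where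
  "mcb_symbols G M n =
    {w. (\<forall>xs \<in> set w. xs \<noteq> [] \<and> in_one_group G M xs) \<and> (\<Sum>xs\<leftarrow>w. length xs) = n}"

definition mcb_P ::
  "('g, 'x) monoid_scheme \<Rightarrow> ('m, 'y) ring_scheme \<Rightarrow> nat
    \<Rightarrow> (('m \<times> 'g) list list \<Rightarrow>\<^sub>0 int) monoid" where
  "mcb_P G M n = free_Abelian_group (mcb_symbols G M n)"

definition drop_empty :: "'a list list \<Rightarrow> 'a list list" where
  "drop_empty w = filter (\<lambda>xs. xs \<noteq> []) w"

definition mcb_boundary_symbol ::
  "('g, 'x) monoid_scheme \<Rightarrow> ('m, 'y) ring_scheme \<Rightarrow> ('m \<Rightarrow> ('g \<Rightarrow>\<^sub>0 int) \<Rightarrow> 'm) \<Rightarrow> ('g \<Rightarrow> 'g)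
    \<Rightarrow> ('m \<times> 'g) list list \<Rightarrow> (('m \<times> 'g) list list \<Rightarrow>\<^sub>0 int)" where
  "mcb_boundary_symbol G M act \<phi> w =
    (\<Sum>i < length w.
      let x = hd (w ! i);
          un = (\<lambda>y. mcb_under G M act \<phi> y x);
          ov = (\<lambda>y. mcb_over act \<phi> y x)
      in frag_cmul ((-1) ^ (\<Sum>xs\<leftarrow>take i w. length xs))
          (frag_of (drop_empty
              (map (map un) (take i w)
                @ [map (\<lambda>y. ov (mcb_mult G (mcb_inv G x) y)) (tl (w ! i))]
                @ map (map ov) (drop (Suc i) w)))
           + (\<Sum>j = 1..length (w ! i).
                frag_cmul ((-1) ^ j)
                  (frag_of (drop_empty (w[i := take (j - 1) (w ! i) @ drop j (w ! i)]))))))"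

definition mcb_boundary ::
  "('g, 'x) monoid_scheme \<Rightarrow> ('m, 'y) ring_scheme \<Rightarrow> ('m \<Rightarrow> ('g \<Rightarrow>\<^sub>0 int) \<Rightarrow> 'm) \<Rightarrow> ('g \<Rightarrow> 'g)
    \<Rightarrow> (('m \<times> 'g) list list \<Rightarrow>\<^sub>0 int) \<Rightarrow> (('m \<times> 'g) list list \<Rightarrow>\<^sub>0 int)" where
  "mcb_boundary G M act \<phi> = frag_extend (mcb_boundary_symbol G M act \<phi>)"

text \<open>$\langle\langle a\rangle\langle b\rangle\rangle$ for lists \<open>as\<close>, \<open>bs\<close> with entries in one
  $G_m$. The natural number subtraction \<open>\<mu> l - l\<close> is exact, since \<open>\<mu>\<close> is strictly
  increasing with positive values.\<close>

definition mcb_shuffle ::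
  "('g, 'x) monoid_scheme \<Rightarrow> ('m \<times> 'g) list \<Rightarrow> ('m \<times> 'g) list
    \<Rightarrow> (('m \<times> 'g) list \<Rightarrow>\<^sub>0 int)" where
  "mcb_shuffle G as bs =
    (let s = length as; t = length bs; e = mcb_one G (fst (hd as));
         a = (\<lambda>i. (e # as) ! i); b = (\<lambda>i. (e # bs) ! i)
     in \<Sum>\<mu> \<in> {\<mu> \<in> {1..s} \<rightarrow>\<^sub>E {1..s + t}. strict_mono_on {1..s} \<mu>}.
          frag_cmul ((-1) ^ (\<Sum>l = 1..s. \<mu> l - l))
            (frag_of (map (\<lambda>j. let r = card {l \<in> {1..s}. \<mu> l \<le> j}
                               in mcb_mult G (a r) (b (j - r)))
                          [1..<Suc (s + t)])))"

text \<open>In degrees 0 and 1 there are no generators, since \<open>as\<close> and \<open>bs\<close> are nonempty.\<close>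

definition mcb_D ::
  "('g, 'x) monoid_scheme \<Rightarrow> ('m, 'y) ring_scheme \<Rightarrow> nat
    \<Rightarrow> (('m \<times> 'g) list list \<Rightarrow>\<^sub>0 int) set" where
  "mcb_D G M n = generate (mcb_P G M n)
    {frag_of (u @ [as, bs] @ v)
       - frag_extend (\<lambda>cs. frag_of (u @ [cs] @ v)) (mcb_shuffle G as bs) | u as bs v.
     u @ [as, bs] @ v \<in> mcb_symbols G M n \<and> in_one_group G M (as @ bs)}"

definition mcb_C ::
  "('g, 'x) monoid_scheme \<Rightarrow> ('m, 'y) ring_scheme \<Rightarrow> nat
    \<Rightarrow> (('m \<times> 'g) list list \<Rightarrow>\<^sub>0 int) set monoid" where
  "mcb_C G M n = mcb_P G M n Mod mcb_D G M n"

text \<open>The boundary of $C_*$ sends the class of \<open>c\<close> to the class of \<open>\<partial> c\<close>, so that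
  $\Phi \circ \partial_{n+1} = 0$ is expressed on representatives.\<close>

definition mcb_cocycle ::
  "('g, 'x) monoid_scheme \<Rightarrow> ('m, 'y) ring_scheme \<Rightarrow> ('m \<Rightarrow> ('g \<Rightarrow>\<^sub>0 int) \<Rightarrow> 'm) \<Rightarrow> ('g \<Rightarrow> 'g)
    \<Rightarrow> nat \<Rightarrow> ('b, 'z) monoid_scheme \<Rightarrow> ((('m \<times> 'g) list list \<Rightarrow>\<^sub>0 int) set \<Rightarrow> 'b) \<Rightarrow> bool"
  where
  "mcb_cocycle G M act \<phi> n B \<Phi> \<longleftrightarrow>
    \<Phi> \<in> hom (mcb_C G M n) B \<and>
    (\<forall>c \<in> carrier (mcb_P G M (n + 1)).
      \<Phi> (mcb_D G M n #>\<^bsub>mcb_P G M n\<^esub> mcb_boundary G M act \<phi> c) = \<one>\<^bsub>B\<^esub>)"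


section \<open>The group complex\<close>

definition tuples :: "'a set \<Rightarrow> nat \<Rightarrow> 'a list set" where
  "tuples S n = {xs. length xs = n \<and> set xs \<subseteq> S}"

definition gp_rel ::
  "('g, 'x) monoid_scheme \<Rightarrow> ('m, 'y) ring_scheme \<Rightarrow> ('m \<Rightarrow> ('g \<Rightarrow>\<^sub>0 int) \<Rightarrow> 'm) \<Rightarrow> nat
    \<Rightarrow> ('m list \<Rightarrow>\<^sub>0 int) set" where
  "gp_rel G M act n = generate (free_Abelian_group (tuples (carrier M) n))
    {frag_of (map (\<lambda>m. act m (frag_of g)) ms) - frag_of ms | ms g.
      ms \<in> tuples (carrier M) n \<and> g \<in> carrier G}"

definition gp_C ::
  "('g, 'x) monoid_scheme \<Rightarrow> ('m, 'y) ring_scheme \<Rightarrow> ('m \<Rightarrow> ('g \<Rightarrow>\<^sub>0 int) \<Rightarrow> 'm) \<Rightarrow> nat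
    \<Rightarrow> ('m list \<Rightarrow>\<^sub>0 int) set monoid" where
  "gp_C G M act n = free_Abelian_group (tuples (carrier M) n) Mod gp_rel G M act n"

definition gp_class ::
  "('g, 'x) monoid_scheme \<Rightarrow> ('m, 'y) ring_scheme \<Rightarrow> ('m \<Rightarrow> ('g \<Rightarrow>\<^sub>0 int) \<Rightarrow> 'm) \<Rightarrow> nat
    \<Rightarrow> ('m list \<Rightarrow>\<^sub>0 int) \<Rightarrow> ('m list \<Rightarrow>\<^sub>0 int) set" where
  "gp_class G M act n c = gp_rel G M act n #>\<^bsub>free_Abelian_group (tuples (carrier M) n)\<^esub> c"

text \<open>The entries are $m_1 = $ \<open>ms ! 0\<close>, ..., $m_n = $ \<open>ms ! (n - 1)\<close>.\<close>

definition gp_boundary_tuple ::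
  "('m, 'y) ring_scheme \<Rightarrow> 'm list \<Rightarrow> ('m list \<Rightarrow>\<^sub>0 int)" where
  "gp_boundary_tuple M ms =
    (let n = length ms
     in frag_of (tl ms)
        + (\<Sum>i = 1..n - 1. frag_cmul ((-1) ^ i)
            (frag_of (take (i - 1) ms @ [ms ! (i - 1) \<oplus>\<^bsub>M\<^esub> ms ! i] @ drop (i + 1) ms)))
        + frag_cmul ((-1) ^ n) (frag_of (butlast ms)))"

definition gp_boundary ::
  "('m, 'y) ring_scheme \<Rightarrow> ('m list \<Rightarrow>\<^sub>0 int) \<Rightarrow> ('m list \<Rightarrow>\<^sub>0 int)" where
  "gp_boundary M = frag_extend (gp_boundary_tuple M)"

definition gp_D ::
  "('g, 'x) monoid_scheme \<Rightarrow> ('m, 'y) ring_scheme \<Rightarrow> ('m \<Rightarrow> ('g \<Rightarrow>\<^sub>0 int) \<Rightarrow> 'm) \<Rightarrow> nat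
    \<Rightarrow> ('m list \<Rightarrow>\<^sub>0 int) set set" where
  "gp_D G M act n = generate (gp_C G M act n)
    {gp_class G M act n (frag_of ms) | ms.
      ms \<in> tuples (carrier M) n \<and> (\<exists>i \<in> {1..n - 1}. ms ! (i - 1) = \<zero>\<^bsub>M\<^esub>)}"

text \<open>As for \<open>mcb_cocycle\<close>, the boundary of a class is the class of the boundary of a
  representative.\<close>

definition normalized_group_cocycle ::
  "('g, 'x) monoid_scheme \<Rightarrow> ('m, 'y) ring_scheme \<Rightarrow> ('m \<Rightarrow> ('g \<Rightarrow>\<^sub>0 int) \<Rightarrow> 'm) \<Rightarrow> nat
    \<Rightarrow> ('a, 'z) monoid_scheme \<Rightarrow> (('m list \<Rightarrow>\<^sub>0 int) set \<Rightarrow> 'a) \<Rightarrow> bool" where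
  "normalized_group_cocycle G M act n A f \<longleftrightarrow>
    f \<in> hom (gp_C G M act n) A \<and>
    (\<forall>c \<in> gp_D G M act n. f c = \<one>\<^bsub>A\<^esub>) \<and>
    (\<forall>c \<in> carrier (free_Abelian_group (tuples (carrier M) (n + 1))).
      f (gp_class G M act n (gp_boundary M c)) = \<one>\<^bsub>A\<^esub>)"


section \<open>The maps\<close>

definition mcb_proj ::
  "nat \<Rightarrow> (('m \<times> 'g) list list \<Rightarrow>\<^sub>0 int) \<Rightarrow> (('m \<times> 'g) list \<Rightarrow>\<^sub>0 int)" where
  "mcb_proj n = frag_extend (\<lambda>w. if length w = n then frag_of (map hd w) else 0)"

definition differences :: "('m, 'y) ring_scheme \<Rightarrow> 'm list \<Rightarrow> 'm list" where
  "differences M ms =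
    map (\<lambda>i. if Suc i < length ms then ms ! i \<ominus>\<^bsub>M\<^esub> ms ! Suc i else ms ! i) [0..<length ms]"

definition gamma ::
  "('m, 'y) ring_scheme \<Rightarrow> (('m \<times> 'g) list \<Rightarrow>\<^sub>0 int) \<Rightarrow> ('g list \<times> 'm list \<Rightarrow>\<^sub>0 int)" where
  "gamma M = frag_extend (\<lambda>xs. frag_of (map snd xs, differences M (map fst xs)))"

definition list_prod :: "('g, 'x) monoid_scheme \<Rightarrow> 'g list \<Rightarrow> 'g" where
  "list_prod G gs = foldr (\<lambda>g h. g \<otimes>\<^bsub>G\<^esub> h) gs \<one>\<^bsub>G\<^esub>"

definition psi_elt ::
  "('g, 'x) monoid_scheme \<Rightarrow> ('g \<Rightarrow> 'g) \<Rightarrow> 'g list \<Rightarrow> nat list \<Rightarrow> nat \<Rightarrow> 'g" where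
  "psi_elt G \<phi> gs ks i =
    (let ps = map2 (\<lambda>g k. g [^]\<^bsub>G\<^esub> k) gs ks
     in \<phi> (list_prod G (take i ps)) \<otimes>\<^bsub>G\<^esub> list_prod G (drop i ps))"

definition psi ::
  "('g, 'x) monoid_scheme \<Rightarrow> ('m, 'y) ring_scheme \<Rightarrow> ('m \<Rightarrow> ('g \<Rightarrow>\<^sub>0 int) \<Rightarrow> 'm) \<Rightarrow> ('g \<Rightarrow> 'g)
    \<Rightarrow> nat \<Rightarrow> 'g list \<Rightarrow> 'm list \<Rightarrow> ('m list \<Rightarrow>\<^sub>0 int) set" where
  "psi G M act \<phi> n gs ms = gp_class G M act n
    (\<Sum>ks \<in> {ks \<in> tuples {0, 1} n. hd ks = 0}.
      frag_cmul ((-1) ^ sum_list ks)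
        (frag_of (map (\<lambda>i. act (ms ! (i - 1)) (frag_of (psi_elt G \<phi> gs ks i))) [1..<Suc n])))"

definition psi_lam ::
  "('g, 'x) monoid_scheme \<Rightarrow> ('m, 'y) ring_scheme \<Rightarrow> ('m \<Rightarrow> ('g \<Rightarrow>\<^sub>0 int) \<Rightarrow> 'm) \<Rightarrow> ('g \<Rightarrow> 'g)
    \<Rightarrow> ('a, 'z) monoid_scheme \<Rightarrow> ('g \<Rightarrow> 'a) \<Rightarrow> nat
    \<Rightarrow> ('g list \<times> 'm list \<Rightarrow>\<^sub>0 int) \<Rightarrow> (('m list \<Rightarrow>\<^sub>0 int) set \<times> 'a \<Rightarrow>\<^sub>0 int) set" where
  "psi_lam G M act \<phi> A lam n =
    free_lift (tensor (gp_C G M act n) A)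
      (\<lambda>(gs, ms). pure_tensor (gp_C G M act n) A (psi G M act \<phi> n gs ms) (lam (hd gs)))"

definition Phi_chain ::
  "('g, 'x) monoid_scheme \<Rightarrow> ('m, 'y) ring_scheme \<Rightarrow> ('m \<Rightarrow> ('g \<Rightarrow>\<^sub>0 int) \<Rightarrow> 'm) \<Rightarrow> ('g \<Rightarrow> 'g)
    \<Rightarrow> ('a, 'z) monoid_scheme \<Rightarrow> ('g \<Rightarrow> 'a) \<Rightarrow> nat \<Rightarrow> (('m list \<Rightarrow>\<^sub>0 int) set \<Rightarrow> 'a)
    \<Rightarrow> (('m \<times> 'g) list list \<Rightarrow>\<^sub>0 int) \<Rightarrow> ('a \<times> 'a \<Rightarrow>\<^sub>0 int) set" where
  "Phi_chain G M act \<phi> A lam n f =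
    tensor_map A A f id \<circ> psi_lam G M act \<phi> A lam n \<circ> gamma M \<circ> mcb_proj n"

definition Phi ::
  "('g, 'x) monoid_scheme \<Rightarrow> ('m, 'y) ring_scheme \<Rightarrow> ('m \<Rightarrow> ('g \<Rightarrow>\<^sub>0 int) \<Rightarrow> 'm) \<Rightarrow> ('g \<Rightarrow> 'g)
    \<Rightarrow> ('a, 'z) monoid_scheme \<Rightarrow> ('g \<Rightarrow> 'a) \<Rightarrow> nat \<Rightarrow> (('m list \<Rightarrow>\<^sub>0 int) set \<Rightarrow> 'a)
    \<Rightarrow> (('m \<times> 'g) list list \<Rightarrow>\<^sub>0 int) set \<Rightarrow> ('a \<times> 'a \<Rightarrow>\<^sub>0 int) set" where
  "Phi G M act \<phi> A lam n f = induced (Phi_chain G M act \<phi> A lam n f)"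

end

theory Submission
  imports Defs
begin

text \<open>The projection to \<open>n\<close>-tuples keeps only the symbols with \<open>n\<close> blocks of length one. On such a
symbol, with entries \<open>(m\<^sub>i, g\<^sub>i)\<close>, and in the coordinates \<open>u\<^sub>i = m\<^sub>i - m\<^sub>i\<^sub>+\<^sub>1\<close>, \<open>u\<^sub>n = m\<^sub>n\<close>, the
map \<open>Phi_chain\<close> takes the value \<open>f (\<Sum>\<^sub>k \<plusminus> T\<^sub>k) \<otimes> lam g\<^sub>1\<close>. Here \<open>k\<close> runs over the vertices of the cube with
\<open>k\<^sub>1 = 0\<close>, and \<open>T\<^sub>k\<close> is the tuple \<open>u\<close> twisted by \<open>(g\<^sub>1 ^ k\<^sub>1, \<dots>, g\<^sub>n ^ k\<^sub>n)\<close>. Since \<open>k\<^sub>1 = 0\<close>, the first factor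
does not involve \<open>g\<^sub>1\<close>.

\<^bold>\<open>Descent to the quotient.\<close> A shuffled symbol has a block of length at least two and projects to
zero. In \<open>\<langle>a\<rangle>\<langle>b\<rangle>\<close> with \<open>a\<close>, \<open>b\<close> in one group, some \<open>u\<^sub>i\<close> with \<open>i < n\<close> vanishes, so all
\<open>T\<^sub>k\<close> are degenerate and the normalized cocycle kills them (\<open>psi_chain_of_same_group\<close>).

\<^bold>\<open>Vanishing on boundaries.\<close> Only two kinds of symbols of degree \<open>n + 1\<close> have boundary terms
that survive the projection.

If all blocks have length one, the faces of position \<open>i \<ge> 2\<close> are matched with an inner face of the
group boundary of the twisted tuples: adding the neighbours \<open>i - 1\<close> and \<open>i\<close> of \<open>T\<^sub>k\<close> gives a twisted
tuple of the symbol with \<open>x\<^sub>i\<close> deleted if \<open>k\<^sub>i = 0\<close>, and one of the symbol acted on by \<open>x\<^sub>i\<close> if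
\<open>k\<^sub>i = 1\<close> (\<open>twist_merge\<close>, \<open>altsum_merge\<close>). The two outer faces of the group boundary cancel in
the alternating sum, because changing \<open>k\<^sub>2\<close>, respectively \<open>k\<^sub>n\<^sub>+\<^sub>1\<close>, moves the remaining tuple
only by an element of \<open>G\<close>. So the cocycle condition makes the faces \<open>i \<ge> 2\<close> cancel
(\<open>psi_chain_of_faces\<close>); they all carry the label \<open>lam g\<^sub>1\<close>, since \<open>lam\<close> is constant on conjugacy
classes. The two faces of the first position carry the label \<open>lam g\<^sub>2\<close> and differ by the action of
\<open>\<phi> g\<^sub>1\<close>, so they cancel as well (\<open>psi_chain_of_first_faces\<close>).

If one block is \<open>\<langle>(m, g), (m, h)\<rangle>\<close> and the others have length one, three terms survive. When the block
is not the first one, its entries twist in such a way that the terms cancel in the free abelian group on tuples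
(\<open>twist_absorb\<close>, \<open>psi_chain_of_block\<close>). When it is the first one, \<open>f\<close> has the same value
on all three, and \<open>lam (g\<^sup>-\<^sup>1 h) - lam h + lam g = 0\<close>.\<close>

section \<open>Homomorphisms out of groups given by generators and relations\<close>

text \<open>Enlarging the index set makes the products for two chains and for their sum comparable.\<close>

lemma free_lift_eq_finprod:
  assumes "comm_group H" "finite T" "Poly_Mapping.keys c \<subseteq> T" "u \<in> T \<rightarrow> carrier H"
  shows "free_lift H u c = (\<Otimes>\<^bsub>H\<^esub>b \<in> T. u b [^]\<^bsub>H\<^esub> Poly_Mapping.lookup c b)"
proof -
  interpret H: comm_group H by fact
  show ?thesis
    unfolding free_lift_def
    using assms
    by (intro H.finprod_mono_neutral_cong_left) (auto simp: in_keys_iff Pi_iff)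
qed

lemma free_lift_hom:
  fixes u :: "'b \<Rightarrow> 'h"
  assumes "comm_group H" "u \<in> S \<rightarrow> carrier H"
  shows "free_lift H u \<in> hom (free_Abelian_group S) H"
proof (rule homI)
  interpret H: comm_group H by fact
  fix c d :: "'b \<Rightarrow>\<^sub>0 int"
  assume cd: "c \<in> carrier (free_Abelian_group S)" "d \<in> carrier (free_Abelian_group S)"
  let ?T = "Poly_Mapping.keys c \<union> Poly_Mapping.keys d"
  have u: "u \<in> ?T \<rightarrow> carrier H"
    using assms(2) cd by auto
  have T: "free_lift H u e = (\<Otimes>\<^bsub>H\<^esub>b \<in> ?T. u b [^]\<^bsub>H\<^esub> Poly_Mapping.lookup e b)"
    if "Poly_Mapping.keys e \<subseteq> ?T" for e
    using that u by (intro free_lift_eq_finprod[OF assms(1)]) auto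
  show "free_lift H u c \<in> carrier H"
    using u by (subst T) (auto intro!: H.finprod_closed)
  have "free_lift H u (c + d)
      = (\<Otimes>\<^bsub>H\<^esub>b \<in> ?T. u b [^]\<^bsub>H\<^esub> Poly_Mapping.lookup c b
          \<otimes>\<^bsub>H\<^esub> u b [^]\<^bsub>H\<^esub> Poly_Mapping.lookup d b)"
    unfolding T[OF keys_add] using u
    by (intro H.finprod_cong') (auto simp: Poly_Mapping.lookup_add intro!: H.int_pow_mult)
  also have "\<dots> = free_lift H u c \<otimes>\<^bsub>H\<^esub> free_lift H u d"
    using u by (subst (1 2) T) (auto intro!: H.finprod_multf)
  finally show "free_lift H u (c \<otimes>\<^bsub>free_Abelian_group S\<^esub> d) = free_lift H u c \<otimes>\<^bsub>H\<^esub> free_lift H u d"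
    by simp
qed

lemma free_lift_frag_of:
  assumes "comm_group H" "u x \<in> carrier H"
  shows "free_lift H u (frag_of x) = u x"
proof -
  interpret H: comm_group H by fact
  show ?thesis
    using assms(2) by (subst free_lift_eq_finprod[of _ "{x}"]) (auto intro: assms(1))
qed

lemma keys_add_subset:
  "Poly_Mapping.keys a \<subseteq> S \<Longrightarrow> Poly_Mapping.keys b \<subseteq> S \<Longrightarrow> Poly_Mapping.keys (a + b) \<subseteq> S"
  using keys_add[of a b] by blast

lemma keys_sum_subset:
  "(\<And>i. i \<in> I \<Longrightarrow> Poly_Mapping.keys (c i) \<subseteq> S) \<Longrightarrow> Poly_Mapping.keys (\<Sum>i\<in>I. c i :: 'a \<Rightarrow>\<^sub>0 int) \<subseteq> S"
  using sum_closed_free_Abelian_group[of I c S] by simp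

lemma keys_cmul_subset: "Poly_Mapping.keys c \<subseteq> S \<Longrightarrow> Poly_Mapping.keys (frag_cmul k c) \<subseteq> S"
  by auto

lemma frag_extend_hom:
  assumes "\<And>x. x \<in> S \<Longrightarrow> Poly_Mapping.keys (g x) \<subseteq> T"
  shows "frag_extend g \<in> hom (free_Abelian_group S) (free_Abelian_group T)"
proof (rule homI)
  fix c assume "c \<in> carrier (free_Abelian_group S)"
  then show "frag_extend g c \<in> carrier (free_Abelian_group T)"
    using keys_frag_extend[of g c] assms by fastforce
qed (simp add: frag_extend_add)

lemma hom_free_diff:
  assumes "group H" "h \<in> hom (free_Abelian_group S) H"
    and "Poly_Mapping.keys a \<subseteq> S" "Poly_Mapping.keys b \<subseteq> S"
  shows "h (a - b) = h a \<otimes>\<^bsub>H\<^esub> inv\<^bsub>H\<^esub> h b"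
proof -
  interpret h: group_hom "free_Abelian_group S" H h
    using assms by (simp add: group_hom_def group_hom_axioms_def)
  show ?thesis
    using assms(3,4) h.hom_mult[of a "- b"] h.hom_inv[of b] by simp
qed

lemma hom_free_eqI:
  assumes "group H" "h \<in> hom (free_Abelian_group S) H" "h' \<in> hom (free_Abelian_group S) H"
    and "\<And>x. x \<in> S \<Longrightarrow> h (frag_of x) = h' (frag_of x)"
    and "Poly_Mapping.keys c \<subseteq> S"
  shows "h c = h' c"
  using assms(5)
proof (induction rule: free_Abelian_group_induct[consumes 1, case_names zero diff of])
  case zero
  then show ?case
    using hom_one[OF assms(2) _ assms(1)] hom_one[OF assms(3) _ assms(1)] by simp
next
  case (diff x y)
  then show ?case
    by (simp add: hom_free_diff[OF assms(1,2)] hom_free_diff[OF assms(1,3)])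
qed (fact assms(4))

lemma hom_free_mono:
  assumes "h \<in> hom (free_Abelian_group S) H" "T \<subseteq> S"
  shows "h \<in> hom (free_Abelian_group T) H"
proof (rule homI)
  fix c d assume c: "c \<in> carrier (free_Abelian_group T)" and d: "d \<in> carrier (free_Abelian_group T)"
  then have "c \<in> carrier (free_Abelian_group S)" "d \<in> carrier (free_Abelian_group S)"
    using assms(2) by auto
  then show "h c \<in> carrier H" "h (c \<otimes>\<^bsub>free_Abelian_group T\<^esub> d) = h c \<otimes>\<^bsub>H\<^esub> h d"
    using hom_in_carrier[OF assms(1)] hom_mult[OF assms(1)] by auto
qed

text \<open>All quotients in the construction (the tensor product, the coinvariants of the group
complex, the complex of the biquandle) are free abelian groups modulo the subgroup generated by a
set \<open>R\<close> of relators. A homomorphism that kills \<open>R\<close> is constant on the cosets, which is what gives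
\<open>induced\<close> its meaning.\<close>

locale presented_group =
  fixes S :: "'s set" and R :: "('s \<Rightarrow>\<^sub>0 int) set"
  assumes relators: "r \<in> R \<Longrightarrow> Poly_Mapping.keys r \<subseteq> S"
begin

abbreviation "F \<equiv> free_Abelian_group S"
abbreviation "N \<equiv> generate F R"

lemma relators_subset: "R \<subseteq> carrier F"
  using relators by auto

lemma subgroup_N: "subgroup N F"
  by (rule group.generate_is_subgroup[OF group_free_Abelian_group relators_subset])

sublocale normal N F
  using comm_group.normal_iff_subgroup[OF abelian_free_Abelian_group] subgroup_N by blast

lemma comm_group_quotient: "comm_group (F Mod N)"
  by (rule comm_group.abelian_FactGroup[OF abelian_free_Abelian_group subgroup_N])

lemma coset_hom: "(\<lambda>c. N #>\<^bsub>F\<^esub> c) \<in> hom F (F Mod N)"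
  by (rule r_coset_hom_Mod)

lemma coset_relator: "r \<in> R \<Longrightarrow> N #>\<^bsub>F\<^esub> r = \<one>\<^bsub>F Mod N\<^esub>"
  using generate.incl[of r R F] by (simp add: coset_join2[OF _ subgroup_N] relators)

context
  fixes H :: "('h, 'z) monoid_scheme" and h
  assumes H: "group H" and h: "h \<in> hom F H" and kills: "\<And>r. r \<in> R \<Longrightarrow> h r = \<one>\<^bsub>H\<^esub>"
begin

interpretation h: group_hom F H h
  using H h by (simp add: group_hom_def group_hom_axioms_def)

lemma kills_generated: "r \<in> N \<Longrightarrow> h r = \<one>\<^bsub>H\<^esub>"
  using group.generate_subgroup_incl[OF group_free_Abelian_group, of R "kernel F H h" S]
    h.subgroup_kernel kills relators by (auto simp: kernel_def)

lemma hom_constant_on_coset: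
  assumes "Poly_Mapping.keys c \<subseteq> S" "d \<in> N #>\<^bsub>F\<^esub> c"
  shows "h d = h c"
proof -
  obtain r where r: "r \<in> N" "d = r + c"
    using assms(2) by (auto simp: r_coset_def)
  then have "Poly_Mapping.keys r \<subseteq> S"
    using subset by (metis carrier_free_Abelian_group_iff subsetD)
  then show ?thesis
    using h.hom_mult[of r c] kills_generated[OF r(1)] assms(1) r(2) h.hom_closed[of c] by simp
qed

lemma induced_coset:
  assumes "Poly_Mapping.keys c \<subseteq> S"
  shows "induced h (N #>\<^bsub>F\<^esub> c) = h c"
proof -
  have "c \<in> N #>\<^bsub>F\<^esub> c"
    using assms rcos_self[OF _ subgroup_N] by simp
  then have "h ` (N #>\<^bsub>F\<^esub> c) = {h c}"
    using hom_constant_on_coset[OF assms] by blast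
  then show ?thesis
    by (simp add: induced_def)
qed

lemma induced_on_coset:
  assumes "K \<in> carrier (F Mod N)" "c \<in> K"
  shows "induced h K = h c"
proof -
  obtain d where d: "Poly_Mapping.keys d \<subseteq> S" "K = N #>\<^bsub>F\<^esub> d"
    using assms(1) by (auto simp: carrier_FactGroup)
  then show ?thesis
    using assms(2) induced_coset hom_constant_on_coset by metis
qed

lemma induced_hom: "induced h \<in> hom (F Mod N) H"
proof (rule homI)
  fix K L assume K: "K \<in> carrier (F Mod N)" and L: "L \<in> carrier (F Mod N)"
  obtain c where c: "Poly_Mapping.keys c \<subseteq> S" "K = N #>\<^bsub>F\<^esub> c"
    using K by (auto simp: carrier_FactGroup)
  obtain d where d: "Poly_Mapping.keys d \<subseteq> S" "L = N #>\<^bsub>F\<^esub> d"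
    using L by (auto simp: carrier_FactGroup)
  show "induced h K \<in> carrier H"
    using c induced_coset h.hom_closed by simp
  have "Poly_Mapping.keys (c + d) \<subseteq> S"
    using c d keys_add[of c d] by blast
  moreover have "K \<otimes>\<^bsub>F Mod N\<^esub> L = N #>\<^bsub>F\<^esub> (c + d)"
    using c d rcos_sum[of c d] by simp
  ultimately show "induced h (K \<otimes>\<^bsub>F Mod N\<^esub> L) = induced h K \<otimes>\<^bsub>H\<^esub> induced h L"
    using c d induced_coset h.hom_mult[of c d] by simp
qed

end

end

section \<open>Tensor products\<close>

locale tensor_product = H: comm_group H + K: comm_group K
  for H :: "('a, 'x) monoid_scheme" and K :: "('b, 'y) monoid_scheme"
begin

sublocale T: presented_group "carrier H \<times> carrier K"
  "{frag_of (x \<otimes>\<^bsub>H\<^esub> x', y) - frag_of (x, y) - frag_of (x', y) | x x' y.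
        x \<in> carrier H \<and> x' \<in> carrier H \<and> y \<in> carrier K} \<union>
     {frag_of (x, y \<otimes>\<^bsub>K\<^esub> y') - frag_of (x, y) - frag_of (x, y') | x y y'.
        x \<in> carrier H \<and> y \<in> carrier K \<and> y' \<in> carrier K}"
  by unfold_locales (auto dest!: subsetD[OF keys_diff])

lemma tensor_rel_eq: "tensor_rel H K = T.N"
  by (simp add: tensor_rel_def)

lemma tensor_eq: "tensor H K = T.F Mod T.N"
  by (simp add: tensor_def tensor_rel_eq)

lemma comm_group_tensor: "comm_group (tensor H K)"
  unfolding tensor_eq by (rule T.comm_group_quotient)

lemma tensor_class_eq: "tensor_class H K c = T.N #>\<^bsub>T.F\<^esub> c"
  by (simp add: tensor_class_def tensor_rel_eq)

lemma tensor_class_hom: "tensor_class H K \<in> hom T.F (tensor H K)"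
  using T.coset_hom unfolding tensor_eq tensor_class_eq[abs_def] .

sublocale tensor: comm_group "tensor H K"
  by (rule comm_group_tensor)

sublocale cls: group_hom T.F "tensor H K" "tensor_class H K"
  using tensor_class_hom by unfold_locales

lemma pure_tensor_closed:
  "x \<in> carrier H \<Longrightarrow> y \<in> carrier K \<Longrightarrow> pure_tensor H K x y \<in> carrier (tensor H K)"
  unfolding pure_tensor_def by (rule cls.hom_closed) simp

text \<open>Each defining relator of the tensor product has the form \<open>c - a - b\<close>; its vanishing is an
instance of biadditivity.\<close>

lemma tensor_class_eqI:
  assumes "Poly_Mapping.keys c \<subseteq> carrier H \<times> carrier K" "a \<in> carrier H \<times> carrier K"
    "b \<in> carrier H \<times> carrier K"
    and "tensor_class H K (c - frag_of a - frag_of b) = \<one>\<^bsub>tensor H K\<^esub>"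
  shows "tensor_class H K c = tensor_class H K (frag_of a) \<otimes>\<^bsub>tensor H K\<^esub> tensor_class H K (frag_of b)"
proof -
  let ?r = "c - frag_of a - frag_of b"
  have r: "Poly_Mapping.keys ?r \<subseteq> carrier H \<times> carrier K"
    using assms(1-3) keys_diff[of "c - frag_of a" "frag_of b"] keys_diff[of c "frag_of a"] by auto
  have ab: "Poly_Mapping.keys (frag_of a + frag_of b) \<subseteq> carrier H \<times> carrier K"
    using assms(2,3) keys_add[of "frag_of a" "frag_of b"] by auto
  have "tensor_class H K (?r + (frag_of a + frag_of b))
      = tensor_class H K ?r \<otimes>\<^bsub>tensor H K\<^esub> tensor_class H K (frag_of a + frag_of b)"
    using cls.hom_mult[of ?r "frag_of a + frag_of b"] r ab by simp
  also have "\<dots> = tensor_class H K (frag_of a) \<otimes>\<^bsub>tensor H K\<^esub> tensor_class H K (frag_of b)"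
    using cls.hom_mult[of "frag_of a" "frag_of b"] assms(2-4) cls.hom_closed[of "frag_of a + frag_of b"] ab
    by (simp del: cls.hom_closed)
  finally show ?thesis
    by (simp add: algebra_simps)
qed

lemma pure_tensor_mult_left:
  assumes "x \<in> carrier H" "x' \<in> carrier H" "y \<in> carrier K"
  shows "pure_tensor H K (x \<otimes>\<^bsub>H\<^esub> x') y
    = pure_tensor H K x y \<otimes>\<^bsub>tensor H K\<^esub> pure_tensor H K x' y"
  unfolding pure_tensor_def using assms
  by (intro tensor_class_eqI)
    (auto simp: tensor_class_eq tensor_eq simp del: one_FactGroup intro!: T.coset_relator)

lemma pure_tensor_mult_right:
  assumes "x \<in> carrier H" "y \<in> carrier K" "y' \<in> carrier K"
  shows "pure_tensor H K x (y \<otimes>\<^bsub>K\<^esub> y')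
    = pure_tensor H K x y \<otimes>\<^bsub>tensor H K\<^esub> pure_tensor H K x y'"
  unfolding pure_tensor_def using assms
  by (intro tensor_class_eqI)
    (auto simp: tensor_class_eq tensor_eq simp del: one_FactGroup intro!: T.coset_relator)

lemma pure_tensor_hom_left:
  "y \<in> carrier K \<Longrightarrow> (\<lambda>x. pure_tensor H K x y) \<in> hom H (tensor H K)"
  by (rule homI) (simp_all add: pure_tensor_closed pure_tensor_mult_left)

lemma pure_tensor_one_left:
  "y \<in> carrier K \<Longrightarrow> pure_tensor H K \<one>\<^bsub>H\<^esub> y = \<one>\<^bsub>tensor H K\<^esub>"
  using hom_one[OF pure_tensor_hom_left H.is_group tensor.is_group] by simp

end

text \<open>The functoriality of the tensor product: \<open>u \<otimes> v\<close> exists because the map on the free group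
sends the defining relators to zero.\<close>

locale tensor_of_homs =
  source: tensor_product H K + target: tensor_product H' K' + u: group_hom H H' u + v: group_hom K K' v
  for H :: "('a, 'x) monoid_scheme" and K :: "('b, 'y) monoid_scheme"
    and H' :: "('c, 'z) monoid_scheme" and K' :: "('d, 'w) monoid_scheme" and u v
begin

abbreviation "lifted \<equiv> \<lambda>c. tensor_class H' K' (frag_extend (\<lambda>(x, y). frag_of (u x, v y)) c)"

lemma lifted_hom: "lifted \<in> hom source.T.F (tensor H' K')"
proof -
  have "frag_extend (\<lambda>(x, y). frag_of (u x, v y)) \<in> hom source.T.F target.T.F"
    by (rule frag_extend_hom) auto
  from hom_compose[OF this target.tensor_class_hom] show ?thesis
    by (simp add: o_def)
qed

lemma lifted_frag_of: "lifted (frag_of (x, y)) = pure_tensor H' K' (u x) (v y)"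
  by (simp add: pure_tensor_def)

lemma lifted_three_term:
  assumes "p \<in> carrier H \<times> carrier K" "q \<in> carrier H \<times> carrier K" "r \<in> carrier H \<times> carrier K"
    and "lifted (frag_of p) = lifted (frag_of q) \<otimes>\<^bsub>tensor H' K'\<^esub> lifted (frag_of r)"
  shows "lifted (frag_of p - frag_of q - frag_of r) = \<one>\<^bsub>tensor H' K'\<^esub>"
proof -
  let ?T = "tensor H' K'"
  interpret l: group_hom source.T.F ?T lifted
    using lifted_hom by unfold_locales
  have closed: "lifted (frag_of x) \<in> carrier ?T" if "x \<in> carrier H \<times> carrier K" for x
    using that l.hom_closed[of "frag_of x"] by auto
  have "Poly_Mapping.keys (frag_of p - frag_of q) \<subseteq> carrier H \<times> carrier K"
    using assms(1,2) keys_diff[of "frag_of p" "frag_of q"] by auto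
  then have "lifted (frag_of p - frag_of q - frag_of r)
      = lifted (frag_of p) \<otimes>\<^bsub>?T\<^esub> inv\<^bsub>?T\<^esub> lifted (frag_of q) \<otimes>\<^bsub>?T\<^esub> inv\<^bsub>?T\<^esub> lifted (frag_of r)"
    using assms(1-3) by (simp add: hom_free_diff[OF target.tensor.is_group lifted_hom])
  also have "\<dots> = lifted (frag_of r) \<otimes>\<^bsub>?T\<^esub> lifted (frag_of q)
      \<otimes>\<^bsub>?T\<^esub> inv\<^bsub>?T\<^esub> lifted (frag_of q) \<otimes>\<^bsub>?T\<^esub> inv\<^bsub>?T\<^esub> lifted (frag_of r)"
    by (simp only: assms(4) target.tensor.m_comm[OF closed[OF assms(2)] closed[OF assms(3)]])
  also have "\<dots> = \<one>\<^bsub>?T\<^esub>"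
    using closed[OF assms(2)] closed[OF assms(3)]
    by (simp only: target.tensor.m_assoc target.tensor.r_inv target.tensor.inv_closed
        target.tensor.m_closed target.tensor.r_one)
  finally show ?thesis .
qed

lemma lifted_kills:
  assumes "r \<in> {frag_of (x \<otimes>\<^bsub>H\<^esub> x', y) - frag_of (x, y) - frag_of (x', y) | x x' y.
        x \<in> carrier H \<and> x' \<in> carrier H \<and> y \<in> carrier K} \<union>
     {frag_of (x, y \<otimes>\<^bsub>K\<^esub> y') - frag_of (x, y) - frag_of (x, y') | x y y'.
        x \<in> carrier H \<and> y \<in> carrier K \<and> y' \<in> carrier K}"
  shows "lifted r = \<one>\<^bsub>tensor H' K'\<^esub>"
proof -
  from assms consider
      (left) x x' y where "r = frag_of (x \<otimes>\<^bsub>H\<^esub> x', y) - frag_of (x, y) - frag_of (x', y)"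
        "x \<in> carrier H" "x' \<in> carrier H" "y \<in> carrier K"
    | (right) x y y' where "r = frag_of (x, y \<otimes>\<^bsub>K\<^esub> y') - frag_of (x, y) - frag_of (x, y')"
        "x \<in> carrier H" "y \<in> carrier K" "y' \<in> carrier K"
    by blast
  then show ?thesis
  proof cases
    case left
    then show ?thesis
      by (simp only: left(1), intro lifted_three_term)
        (simp_all add: lifted_frag_of target.pure_tensor_mult_left del: frag_extend_of)
  next
    case right
    then show ?thesis
      by (simp only: right(1), intro lifted_three_term)
        (simp_all add: lifted_frag_of target.pure_tensor_mult_right del: frag_extend_of)
  qed
qed

lemma tensor_map_hom: "tensor_map H' K' u v \<in> hom (tensor H K) (tensor H' K')"
  unfolding tensor_map_def source.tensor_eq
  by (rule source.T.induced_hom[OF target.tensor.is_group lifted_hom lifted_kills])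

lemma tensor_map_pure:
  "x \<in> carrier H \<Longrightarrow> y \<in> carrier K
    \<Longrightarrow> tensor_map H' K' u v (pure_tensor H K x y) = pure_tensor H' K' (u x) (v y)"
  unfolding tensor_map_def pure_tensor_def[of H] source.tensor_class_eq
  by (subst source.T.induced_coset[OF target.tensor.is_group lifted_hom lifted_kills])
    (auto simp: pure_tensor_def)

end

section \<open>Twisted tuples\<close>

text \<open>The values of \<open>\<phi>\<close> are central, so \<open>\<phi>\<close> does not distinguish conjugate elements
and the action of its values commutes with that of every group element.\<close>

locale G_Alexander = group G + right_module "group_ring G" M act
  for G :: "('g, 'x) monoid_scheme" (structure) and M :: "('m, 'y) ring_scheme"
    and act :: "'m \<Rightarrow> ('g \<Rightarrow>\<^sub>0 int) \<Rightarrow> 'm" +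
  fixes \<phi> :: "'g \<Rightarrow> 'g"
  assumes phi_hom: "\<phi> \<in> hom G (G\<lparr>carrier := center G\<rparr>)"
begin

abbreviation action :: "'m \<Rightarrow> 'g \<Rightarrow> 'm" (infixl "\<cdot>" 75)
  where "m \<cdot> g \<equiv> act m (frag_of g)"

abbreviation conj_by :: "'g \<Rightarrow> 'g \<Rightarrow> 'g"
  where "conj_by h g \<equiv> inv h \<otimes> g \<otimes> h"

lemma phi_center: "g \<in> carrier G \<Longrightarrow> \<phi> g \<in> center G"
  using phi_hom by (auto simp: hom_def)

lemma phi_closed [simp]: "g \<in> carrier G \<Longrightarrow> \<phi> g \<in> carrier G"
  using phi_center by (auto simp: center_def)

lemma center_closed: "z \<in> center G \<Longrightarrow> z \<in> carrier G"
  by (auto simp: center_def)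

lemma center_commutes: "z \<in> center G \<Longrightarrow> g \<in> carrier G \<Longrightarrow> z \<otimes> g = g \<otimes> z"
  by (auto simp: center_def)

lemma phi_mult [simp]: "g \<in> carrier G \<Longrightarrow> h \<in> carrier G \<Longrightarrow> \<phi> (g \<otimes> h) = \<phi> g \<otimes> \<phi> h"
  using phi_hom by (auto simp: hom_def)

lemma phi_hom_G: "\<phi> \<in> hom G G"
  by (rule homI) simp_all

lemma phi_one [simp]: "\<phi> \<one> = \<one>"
  using hom_one[OF phi_hom_G] is_group by simp

lemma phi_inv: "g \<in> carrier G \<Longrightarrow> \<phi> (inv g) = inv (\<phi> g)"
  using group_hom.hom_inv[of G G \<phi>] phi_hom_G is_group
  by (simp add: group_hom_def group_hom_axioms_def)

lemma phi_conj [simp]: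
  assumes "g \<in> carrier G" "h \<in> carrier G"
  shows "\<phi> (conj_by h g) = \<phi> g"
proof -
  have "\<phi> (conj_by h g) = inv (\<phi> h) \<otimes> (\<phi> g \<otimes> \<phi> h)"
    using assms by (simp add: phi_inv m_assoc)
  also have "\<dots> = inv (\<phi> h) \<otimes> (\<phi> h \<otimes> \<phi> g)"
    using assms by (simp only: center_commutes[OF phi_center phi_closed])
  finally show ?thesis
    using assms by (simp flip: m_assoc)
qed

lemma frag_of_group_ring: "g \<in> carrier G \<Longrightarrow> frag_of g \<in> carrier (group_ring G)"
  by (simp add: group_ring_def)

lemma action_closed [simp]: "m \<in> carrier M \<Longrightarrow> g \<in> carrier G \<Longrightarrow> m \<cdot> g \<in> carrier M"
  by (simp add: act_closed frag_of_group_ring)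

lemma action_mult: "m \<in> carrier M \<Longrightarrow> g \<in> carrier G \<Longrightarrow> h \<in> carrier G \<Longrightarrow> m \<cdot> (g \<otimes> h) = m \<cdot> g \<cdot> h"
  using act_mult[of m "frag_of g" "frag_of h"] frag_of_group_ring by (simp add: group_ring_def)

lemma action_one [simp]: "m \<in> carrier M \<Longrightarrow> m \<cdot> \<one> = m"
  using act_one[of m] by (simp add: group_ring_def)

lemma action_add:
  "m \<in> carrier M \<Longrightarrow> m' \<in> carrier M \<Longrightarrow> g \<in> carrier G
    \<Longrightarrow> (m \<oplus>\<^bsub>M\<^esub> m') \<cdot> g = m \<cdot> g \<oplus>\<^bsub>M\<^esub> m' \<cdot> g"
  by (simp add: act_add_left frag_of_group_ring)

lemma action_zero [simp]: "g \<in> carrier G \<Longrightarrow> \<zero>\<^bsub>M\<^esub> \<cdot> g = \<zero>\<^bsub>M\<^esub>"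
  using action_add[of "\<zero>\<^bsub>M\<^esub>" "\<zero>\<^bsub>M\<^esub>" g] M.add.l_cancel_one[of "\<zero>\<^bsub>M\<^esub> \<cdot> g" "\<zero>\<^bsub>M\<^esub> \<cdot> g"] by simp

lemma action_minus:
  assumes "m \<in> carrier M" "m' \<in> carrier M" "g \<in> carrier G"
  shows "(m \<ominus>\<^bsub>M\<^esub> m') \<cdot> g = m \<cdot> g \<ominus>\<^bsub>M\<^esub> m' \<cdot> g"
proof -
  have "(m \<ominus>\<^bsub>M\<^esub> m') \<cdot> g \<oplus>\<^bsub>M\<^esub> m' \<cdot> g = m \<cdot> g"
    using assms by (simp flip: action_add) (simp add: M.minus_eq M.a_assoc M.l_neg)
  then have "m \<cdot> g \<ominus>\<^bsub>M\<^esub> m' \<cdot> g = (m \<ominus>\<^bsub>M\<^esub> m') \<cdot> g \<oplus>\<^bsub>M\<^esub> m' \<cdot> g \<ominus>\<^bsub>M\<^esub> m' \<cdot> g"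
    by simp
  then show ?thesis
    using assms by (simp add: M.minus_eq M.a_assoc M.r_neg)
qed

lemma act_frag_diff:
  assumes "m \<in> carrier M" "g \<in> carrier G" "h \<in> carrier G"
  shows "act m (frag_of g - frag_of h) = m \<cdot> g \<ominus>\<^bsub>M\<^esub> m \<cdot> h"
proof -
  have "frag_of g - frag_of h \<in> carrier (group_ring G)"
    using assms keys_diff[of "frag_of g" "frag_of h"] by (auto simp: group_ring_def)
  then have "m \<cdot> g = act m (frag_of g - frag_of h) \<oplus>\<^bsub>M\<^esub> m \<cdot> h"
    "act m (frag_of g - frag_of h) \<in> carrier M"
    using act_add_right[of m "frag_of g - frag_of h" "frag_of h"] frag_of_group_ring assms
    by (auto simp: group_ring_def act_closed)
  then show ?thesis
    using assms by (simp add: M.minus_eq M.a_assoc M.r_neg)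
qed

lemma action_center_commute:
  "m \<in> carrier M \<Longrightarrow> z \<in> center G \<Longrightarrow> g \<in> carrier G \<Longrightarrow> m \<cdot> g \<cdot> z = m \<cdot> z \<cdot> g"
  using center_commutes[of z g] by (simp add: center_closed flip: action_mult)

lemma list_prod_Nil [simp]: "list_prod G [] = \<one>"
  and list_prod_Cons [simp]: "list_prod G (g # gs) = g \<otimes> list_prod G gs"
  by (simp_all add: list_prod_def)

lemma list_prod_closed [simp]: "set gs \<subseteq> carrier G \<Longrightarrow> list_prod G gs \<in> carrier G"
  by (induction gs) auto

lemma list_prod_append [simp]:
  "set gs \<subseteq> carrier G \<Longrightarrow> set hs \<subseteq> carrier G
    \<Longrightarrow> list_prod G (gs @ hs) = list_prod G gs \<otimes> list_prod G hs"
  by (induction gs) (auto simp: m_assoc)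

lemma conj_mult:
  assumes "g \<in> carrier G" "g' \<in> carrier G" "h \<in> carrier G"
  shows "conj_by h g \<otimes> conj_by h g' = conj_by h (g \<otimes> g')"
proof -
  have "conj_by h g \<otimes> conj_by h g' = inv h \<otimes> g \<otimes> ((h \<otimes> inv h) \<otimes> (g' \<otimes> h))"
    using assms by (simp only: m_assoc m_closed inv_closed)
  then show ?thesis
    using assms by (simp add: m_assoc)
qed

lemma list_prod_conj:
  "set gs \<subseteq> carrier G \<Longrightarrow> h \<in> carrier G \<Longrightarrow> list_prod G (map (conj_by h) gs) = conj_by h (list_prod G gs)"
  by (induction gs) (auto simp: conj_mult)

text \<open>With \<open>ps = (g\<^sub>1 ^ k\<^sub>1, \<dots>, g\<^sub>n ^ k\<^sub>n)\<close> this is the tuple \<open>(u\<^sub>1 \<cdot> g\<^sub>k\<^sub>,\<^sub>1, \<dots>, u\<^sub>n \<cdot> g\<^sub>k\<^sub>,\<^sub>n)\<close> in the definition of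
\<open>psi\<close>. The recursive form allows proofs by induction on the tuple; \<open>twist_nth\<close> gives the
closed form.\<close>

fun twist :: "'g list \<Rightarrow> 'm list \<Rightarrow> 'm list" where
  "twist (p # ps) (u # us) = u \<cdot> (\<phi> p \<otimes> list_prod G ps) # map (\<lambda>v. v \<cdot> \<phi> p) (twist ps us)"
| "twist _ _ = []"

lemma length_twist [simp]: "length (twist ps us) = min (length ps) (length us)"
  by (induction ps us rule: twist.induct) auto

lemma twist_closed:
  "set ps \<subseteq> carrier G \<Longrightarrow> set us \<subseteq> carrier M \<Longrightarrow> set (twist ps us) \<subseteq> carrier M"
  by (induction ps us rule: twist.induct) auto

lemma twist_in:
  "set ps \<subseteq> carrier G \<Longrightarrow> set us \<subseteq> carrier M \<Longrightarrow> v \<in> set (twist ps us) \<Longrightarrow> v \<in> carrier M"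
  using twist_closed by blast

lemma twist_nth:
  assumes "set ps \<subseteq> carrier G" "set us \<subseteq> carrier M" "j < length ps" "j < length us"
  shows "twist ps us ! j = us ! j \<cdot> (\<phi> (list_prod G (take (Suc j) ps)) \<otimes> list_prod G (drop (Suc j) ps))"
  using assms
proof (induction ps us arbitrary: j rule: twist.induct)
  case (1 p ps u us)
  show ?case
  proof (cases j)
    case (Suc i)
    let ?P = "list_prod G (take (Suc i) ps)" and ?D = "list_prod G (drop (Suc i) ps)"
    have p: "p \<in> carrier G"
      using 1(2) by simp
    have G: "?P \<in> carrier G" "?D \<in> carrier G"
      using 1(2) set_take_subset[of "Suc i" ps] set_drop_subset[of "Suc i" ps]
      by (auto intro!: list_prod_closed)
    have "us ! i \<in> carrier M"
      using 1(3,5) Suc nth_mem[of i us] by auto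
    then have "us ! i \<cdot> (\<phi> ?P \<otimes> ?D) \<cdot> \<phi> p = us ! i \<cdot> (\<phi> p \<otimes> (\<phi> ?P \<otimes> ?D))"
      using G p center_commutes[OF phi_center[OF p], of "\<phi> ?P \<otimes> ?D"] by (simp flip: action_mult)
    then show ?thesis
      using 1 Suc G p by (simp add: m_assoc)
  qed (use 1 in auto)
qed auto

lemma twist_central:
  assumes "set ps \<subseteq> carrier G" "set us \<subseteq> carrier M" "z \<in> center G"
  shows "twist ps (map (\<lambda>v. v \<cdot> z) us) = map (\<lambda>v. v \<cdot> z) (twist ps us)"
  using assms
proof (induction ps us rule: twist.induct)
  case (1 p ps u us)
  have "v \<cdot> z \<cdot> g = v \<cdot> g \<cdot> z" if "v \<in> carrier M" "g \<in> carrier G" for v g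
    using that 1 by (simp add: action_center_commute[symmetric])
  then show ?case
    using 1 by (auto simp: twist_in)
qed auto

text \<open>In \<open>u \<cdot> h \<cdot> (\<phi> p \<otimes> h\<^sup>-\<^sup>1 q h)\<close> the central factor moves past \<open>h\<close>, which then cancels \<open>h\<^sup>-\<^sup>1\<close>.\<close>

lemma twist_conj:
  assumes "set ps \<subseteq> carrier G" "set us \<subseteq> carrier M" "h \<in> carrier G"
  shows "twist (map (conj_by h) ps) (map (\<lambda>v. v \<cdot> h) us) = map (\<lambda>v. v \<cdot> h) (twist ps us)"
  using assms
proof (induction ps us rule: twist.induct)
  case (1 p ps u us)
  have p: "p \<in> carrier G" and L: "list_prod G ps \<in> carrier G"
    using 1 by auto
  have "h \<otimes> (\<phi> p \<otimes> conj_by h (list_prod G ps)) = (h \<otimes> \<phi> p) \<otimes> (inv h \<otimes> (list_prod G ps \<otimes> h))"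
    using 1 p L by (simp add: m_assoc)
  also have "\<dots> = \<phi> p \<otimes> ((h \<otimes> inv h) \<otimes> (list_prod G ps \<otimes> h))"
    using 1 p L center_commutes[OF phi_center[OF p], of h, symmetric]
    by (simp only: m_assoc m_closed inv_closed phi_closed)
  also have "\<dots> = \<phi> p \<otimes> list_prod G ps \<otimes> h"
    using 1 p L by (simp add: m_assoc)
  finally have "u \<cdot> h \<cdot> (\<phi> p \<otimes> conj_by h (list_prod G ps)) = u \<cdot> (\<phi> p \<otimes> list_prod G ps) \<cdot> h"
    using 1 by (simp flip: action_mult)
  moreover have "v \<cdot> h \<cdot> \<phi> p = v \<cdot> \<phi> p \<cdot> h" if "v \<in> carrier M" for v
    using that 1 by (intro action_center_commute) (auto intro: phi_center)
  ultimately show ?case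
    using 1 by (auto simp: list_prod_conj twist_in simp del: phi_mult simp add: phi_conj)
qed auto

text \<open>An entry is moved by the values \<open>\<phi> p\<close> of the group elements up to its position and
by the group elements \<open>p\<close> after it. Hence the first part sees the second only through its
product, and the second sees the first only through \<open>\<phi>\<close> of its product.\<close>

lemma twist_append:
  assumes "set a \<subseteq> carrier G" "set b \<subseteq> carrier G" "set c \<subseteq> carrier M" "set d \<subseteq> carrier M"
    and "length a = length c"
  shows "twist (a @ b) (c @ d)
    = map (\<lambda>v. v \<cdot> list_prod G b) (twist a c) @ map (\<lambda>v. v \<cdot> \<phi> (list_prod G a)) (twist b d)"
proof -
  have one: "map (\<lambda>v. v \<cdot> \<one>) (twist b d) = twist b d"
    using assms by (intro map_idI) (simp add: twist_in[of b d])
  show ?thesis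
    using assms
  proof (induction a c rule: twist.induct)
    case (1 p ps u us)
    have "u \<cdot> (\<phi> p \<otimes> (list_prod G ps \<otimes> list_prod G b))
        = u \<cdot> (\<phi> p \<otimes> list_prod G ps) \<cdot> list_prod G b"
      using 1 by (simp add: m_assoc flip: action_mult)
    moreover have "v \<cdot> list_prod G b \<cdot> \<phi> p = v \<cdot> \<phi> p \<cdot> list_prod G b" if "v \<in> carrier M" for v
      using that 1 by (intro action_center_commute) (auto intro: phi_center)
    moreover have "v \<cdot> \<phi> (list_prod G ps) \<cdot> \<phi> p = v \<cdot> (\<phi> p \<otimes> \<phi> (list_prod G ps))"
      if "v \<in> carrier M" for v
      using that 1 center_commutes[OF phi_center, of p "\<phi> (list_prod G ps)"]
      by (simp add: action_mult[symmetric] del: phi_mult)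
    ultimately show ?case
      using 1 by (auto simp: twist_in)
  qed (auto simp: one)
qed

end

section \<open>Alternating sums over a cube\<close>

text \<open>The sum of \<open>(-1) ^ |k| F (g\<^sub>1 ^ k\<^sub>1, \<dots>, g\<^sub>n ^ k\<^sub>n)\<close> over \<open>k \<in> {0, 1}\<^sup>n\<close>. Splitting off one coordinate
at a time keeps the arguments below free of reindexings of the cube; \<open>altsum_eq_sum_cube\<close>
connects the two forms.\<close>

primrec altsum :: "('g, 'x) monoid_scheme \<Rightarrow> 'g list \<Rightarrow> ('g list \<Rightarrow> 'c::ab_group_add) \<Rightarrow> 'c" where
  "altsum G [] F = F []"
| "altsum G (g # gs) F = altsum G gs (\<lambda>ps. F (\<one>\<^bsub>G\<^esub> # ps)) - altsum G gs (\<lambda>ps. F (g # ps))"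

lemma altsum_additive:
  assumes "\<And>x y. h (x - y) = h x - h y"
  shows "h (altsum G gs F) = altsum G gs (\<lambda>ps. h (F ps))"
  by (induction gs arbitrary: F) (simp_all add: assms)

lemma altsum_diff: "altsum G gs (\<lambda>ps. F ps - F' ps) = altsum G gs F - altsum G gs F'"
  by (induction gs arbitrary: F F') simp_all

lemma altsum_sum: "altsum G gs (\<lambda>ps. \<Sum>i\<in>I. F i ps) = (\<Sum>i\<in>I. altsum G gs (F i))"
  by (induction gs arbitrary: F) (simp_all add: sum_subtractf)

lemma altsum_append: "altsum G (a @ b) F = altsum G a (\<lambda>ps. altsum G b (\<lambda>qs. F (ps @ qs)))"
  by (induction a arbitrary: F) simp_all

text \<open>The hypothesis on \<open>\<one>\<close> is needed because the coordinates with \<open>k\<^sub>i = 0\<close> contribute \<open>\<one>\<close> and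
not the image of an entry.\<close>

lemma altsum_map: "e \<one>\<^bsub>G\<^esub> = \<one>\<^bsub>G\<^esub> \<Longrightarrow> altsum G (map e gs) F = altsum G gs (\<lambda>ps. F (map e ps))"
  by (induction gs arbitrary: F) simp_all

lemma tuples_Cons: "x # xs \<in> tuples S (Suc n) \<longleftrightarrow> x \<in> S \<and> xs \<in> tuples S n"
  by (auto simp: tuples_def)

lemma tuples_Suc: "tuples S (Suc n) = (\<Union>x\<in>S. (#) x ` tuples S n)"
proof -
  have "xs \<in> tuples S (Suc n) \<longleftrightarrow> xs \<in> (\<Union>x\<in>S. (#) x ` tuples S n)" for xs
    by (cases xs) (auto simp: tuples_Cons, auto simp: tuples_def)
  then show ?thesis
    by blast
qed

lemma finite_tuples: "finite S \<Longrightarrow> finite (tuples S n)"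
  using finite_lists_length_eq[of S n] by (simp add: tuples_def conj_commute)

lemma altsum_closed:
  assumes "group G" "set gs \<subseteq> carrier G"
    and "\<And>ps. ps \<in> tuples (carrier G) (length gs) \<Longrightarrow> F ps \<in> K"
    and "\<And>x y. x \<in> K \<Longrightarrow> y \<in> K \<Longrightarrow> x - y \<in> K"
  shows "altsum G gs F \<in> K"
  using assms(2,3)
proof (induction gs arbitrary: F)
  case Nil
  then show ?case by (simp add: tuples_def)
next
  case (Cons g gs)
  interpret group G by fact
  show ?case
    using Cons by (auto simp: tuples_Cons intro!: assms(4) Cons.IH)
qed

lemma altsum_cong:
  assumes "group G" "set gs \<subseteq> carrier G"
    and "\<And>ps. ps \<in> tuples (carrier G) (length gs) \<Longrightarrow> F ps = F' ps"
  shows "altsum G gs F = altsum G gs F'"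
proof -
  have "altsum G gs (\<lambda>ps. F ps - F' ps) \<in> {0}"
    using assms by (intro altsum_closed) auto
  then show ?thesis
    by (simp add: altsum_diff)
qed

lemma altsum_eq_sum_cube:
  assumes "group G" "set gs \<subseteq> carrier G"
  shows "altsum G gs F = (\<Sum>ks \<in> tuples {0, 1} (length gs).
    frag_cmul ((-1) ^ sum_list ks) (F (map2 (\<lambda>g k. g [^]\<^bsub>G\<^esub> (k::nat)) gs ks)))"
  using assms(2)
proof (induction gs arbitrary: F)
  case Nil
  have "tuples {0, 1} 0 = {[] :: nat list}"
    by (auto simp: tuples_def)
  then show ?case by simp
next
  case (Cons g gs)
  interpret group G by fact
  let ?T = "tuples {0, 1} (length gs) :: nat list set"
  let ?t = "\<lambda>ks. frag_cmul ((-1) ^ sum_list ks) (F (map2 (\<lambda>g k. g [^]\<^bsub>G\<^esub> (k::nat)) (g # gs) ks))"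
  have "sum ?t (tuples {0, 1} (length (g # gs))) = sum ?t ((#) 0 ` ?T \<union> (#) 1 ` ?T)"
    by (simp add: tuples_Suc)
  also have "\<dots> = sum ?t ((#) 0 ` ?T) + sum ?t ((#) 1 ` ?T)"
    by (rule sum.union_disjoint) (auto simp: finite_tuples)
  also have "\<dots> = (\<Sum>ks\<in>?T. ?t (0 # ks)) + (\<Sum>ks\<in>?T. ?t (1 # ks))"
    by (simp add: sum.reindex inj_on_def del: zip_Cons_Cons sum_list.Cons list.map)
  also have "(\<Sum>ks\<in>?T. ?t (0 # ks)) = altsum G gs (\<lambda>ps. F (\<one>\<^bsub>G\<^esub> # ps))"
    using Cons by simp
  also have "(\<Sum>ks\<in>?T. ?t (1 # ks)) = - altsum G gs (\<lambda>ps. F (g # ps))"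
    using Cons by (simp add: sum_negf[symmetric])
  finally show ?case
    by simp
qed

section \<open>Consecutive differences\<close>

text \<open>The element \<open>e\<close> stands for the entry after the last one; \<open>e = 0\<close> gives \<open>differences\<close>. A
variable \<open>e\<close> makes the differences of a concatenation the concatenation of differences.\<close>

primrec differences_to :: "('m, 'y) ring_scheme \<Rightarrow> 'm list \<Rightarrow> 'm \<Rightarrow> 'm list" where
  "differences_to M [] e = []"
| "differences_to M (m # ms) e = (m \<ominus>\<^bsub>M\<^esub> hd (ms @ [e])) # differences_to M ms e"

lemma length_differences_to [simp]: "length (differences_to M ms e) = length ms"
  by (induction ms) auto

lemma differences_to_append: "differences_to M (a @ b) e = differences_to M a (hd (b @ [e])) @ differences_to M b e"
proof (induction a)
  case (Cons m a)
  then show ?case by (cases a) auto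
qed simp

context abelian_group
begin

lemma differences_to_closed: "set ms \<subseteq> carrier G \<Longrightarrow> e \<in> carrier G \<Longrightarrow> set (differences_to G ms e) \<subseteq> carrier G"
proof (induction ms)
  case (Cons m ms)
  then show ?case by (cases ms) auto
qed simp

lemma differences_eq_differences_to:
  assumes "set ms \<subseteq> carrier G"
  shows "differences G ms = differences_to G ms \<zero>"
proof -
  have "differences_to G ms \<zero> ! i = (if Suc i < length ms then ms ! i \<ominus> ms ! Suc i else ms ! i)"
    if "i < length ms" for i
    using that assms
  proof (induction ms arbitrary: i)
    case (Cons m ms)
    then show ?case
      by (cases ms; cases i) (auto simp: minus_eq)
  qed simp
  then show ?thesis
    by (intro nth_equalityI) (auto simp: differences_def)
qed

lemma minus_add_minus:
  "a \<in> carrier G \<Longrightarrow> b \<in> carrier G \<Longrightarrow> c \<in> carrier G \<Longrightarrow> (a \<ominus> b) \<oplus> (b \<ominus> c) = a \<ominus> c"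
  by (metis a_minus_def a_assoc l_neg a_inv_closed minus_closed r_zero l_zero)

lemma add_minus_add:
  "a \<in> carrier G \<Longrightarrow> b \<in> carrier G \<Longrightarrow> c \<in> carrier G \<Longrightarrow> (a \<oplus> c) \<ominus> (b \<oplus> c) = a \<ominus> b"
  by (simp add: minus_eq minus_add a_assoc a_lcomm[of c "\<ominus> b"] r_neg)

end

lemma differences_to_map:
  assumes "\<And>a b. a \<in> C \<Longrightarrow> b \<in> C \<Longrightarrow> k a \<ominus>\<^bsub>M\<^esub> k b = k' (a \<ominus>\<^bsub>M\<^esub> b)"
    and "set ms \<subseteq> C" "e \<in> C"
  shows "differences_to M (map k ms) (k e) = map k' (differences_to M ms e)"
  using assms(2)
proof (induction ms)
  case (Cons m ms)
  then show ?case
    using assms(1,3) by (cases ms) auto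
qed simp

context G_Alexander
begin

lemma differences_to_phi:
  assumes "set ms \<subseteq> carrier M" "e \<in> carrier M" "g \<in> carrier G"
  shows "differences_to M (map (\<lambda>m. m \<cdot> g) ms) (e \<cdot> g) = map (\<lambda>m. m \<cdot> g) (differences_to M ms e)"
  using assms by (intro differences_to_map[of "carrier M"]) (auto simp: action_minus)

lemma differences_to_affine:
  assumes "set ms \<subseteq> carrier M" "e \<in> carrier M" "w \<in> carrier M" "g \<in> carrier G"
  shows "differences_to M (map (\<lambda>m. m \<cdot> g \<oplus>\<^bsub>M\<^esub> w) ms) (e \<cdot> g \<oplus>\<^bsub>M\<^esub> w) = map (\<lambda>m. m \<cdot> g) (differences_to M ms e)"
  using assms by (intro differences_to_map[of "carrier M" _ "\<lambda>m. m \<cdot> g \<oplus>\<^bsub>M\<^esub> w"])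
    (auto simp: action_minus M.add_minus_add)

section \<open>Inner faces of twisted tuples\<close>

text \<open>The neighbours at the seam are \<open>y \<cdot> (\<phi> g \<otimes> h \<otimes> B) \<cdot> \<phi> A\<close> and \<open>z \<cdot> (\<phi> h \<otimes> B) \<cdot> \<phi> g \<cdot> \<phi> A\<close>, where \<open>A\<close>, \<open>B\<close> are the
products of \<open>a\<close>, \<open>b\<close>. By centrality their sum is
\<open>(y \<cdot> h \<oplus> z \<cdot> \<phi> h) \<cdot> (\<phi> g \<otimes> B) \<cdot> \<phi> A\<close>. The entries before the seam are moved by \<open>h\<close>, which passes through \<open>a\<close>
and \<open>g\<close> at the cost of conjugating them, and those after the seam by \<open>\<phi> h\<close>. So merging at
\<open>h\<close> is the effect of the biquandle operations by an element with group component \<open>h\<close>; for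
\<open>h = \<one>\<close> it is the effect of deleting it.\<close>

lemma twist_merge:
  assumes "set a \<subseteq> carrier G" "g \<in> carrier G" "h \<in> carrier G" "set b \<subseteq> carrier G"
    and "set c \<subseteq> carrier M" "y \<in> carrier M" "z \<in> carrier M" "set d \<subseteq> carrier M"
    and "length a = length c" "length b = length d"
  obtains C y' z' D where "twist (a @ [g, h] @ b) (c @ [y, z] @ d) = C @ [y', z'] @ D"
    and "length C = length c"
    and "C @ [y' \<oplus>\<^bsub>M\<^esub> z'] @ D = twist (map (conj_by h) (a @ [g]) @ b)
      (map (\<lambda>v. v \<cdot> h) c @ [y \<cdot> h \<oplus>\<^bsub>M\<^esub> z \<cdot> \<phi> h] @ map (\<lambda>v. v \<cdot> \<phi> h) d)"
proof -
  let ?A = "list_prod G a" and ?B = "list_prod G b"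
  let ?y = "y \<cdot> (\<phi> g \<otimes> (h \<otimes> ?B)) \<cdot> \<phi> ?A" and ?z = "z \<cdot> (\<phi> h \<otimes> ?B) \<cdot> \<phi> g \<cdot> \<phi> ?A"
  let ?C = "map (\<lambda>v. v \<cdot> (g \<otimes> (h \<otimes> ?B))) (twist a c)"
  let ?D = "map (\<lambda>v. v \<cdot> \<phi> h \<cdot> \<phi> g \<cdot> \<phi> ?A) (twist b d)"
  have AB: "?A \<in> carrier G" "?B \<in> carrier G"
    using assms by auto
  have eq: "twist (a @ [g, h] @ b) (c @ [y, z] @ d) = ?C @ [?y, ?z] @ ?D"
    using assms by (subst twist_append) (auto simp: o_def)
  have C: "map (\<lambda>v. v \<cdot> (conj_by h g \<otimes> ?B)) (twist (map (conj_by h) a) (map (\<lambda>v. v \<cdot> h) c)) = ?C"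
  proof -
    have "v \<cdot> h \<cdot> (conj_by h g \<otimes> ?B) = v \<cdot> (g \<otimes> (h \<otimes> ?B))" if "v \<in> carrier M" for v
    proof -
      have "h \<otimes> (conj_by h g \<otimes> ?B) = (h \<otimes> inv h) \<otimes> (g \<otimes> (h \<otimes> ?B))"
        using assms AB by (simp only: m_assoc m_closed inv_closed)
      then show ?thesis
        using assms AB that by (simp flip: action_mult)
    qed
    then show ?thesis
      using assms by (simp add: twist_conj twist_in[of a c])
  qed
  have phiA: "\<phi> (conj_by h ?A) = \<phi> ?A" and phig: "\<phi> (conj_by h g) = \<phi> g"
    using assms AB phi_conj by auto
  have "(y \<cdot> h \<oplus>\<^bsub>M\<^esub> z \<cdot> \<phi> h) \<cdot> (\<phi> g \<otimes> ?B) \<cdot> \<phi> ?A = ?y \<oplus>\<^bsub>M\<^esub> ?z"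
  proof -
    have "h \<otimes> (\<phi> g \<otimes> ?B) = \<phi> g \<otimes> (h \<otimes> ?B)"
      using assms AB center_commutes[OF phi_center, of g h, symmetric] by (simp flip: m_assoc)
    then have "y \<cdot> h \<cdot> (\<phi> g \<otimes> ?B) = y \<cdot> (\<phi> g \<otimes> (h \<otimes> ?B))"
      using assms AB by (simp flip: action_mult)
    moreover have "(\<phi> h \<otimes> ?B) \<otimes> \<phi> g = \<phi> h \<otimes> (\<phi> g \<otimes> ?B)"
      using assms AB center_commutes[OF phi_center, of g ?B, symmetric] by (simp add: m_assoc)
    then have "z \<cdot> \<phi> h \<cdot> (\<phi> g \<otimes> ?B) = z \<cdot> (\<phi> h \<otimes> ?B) \<cdot> \<phi> g"
      using assms AB by (simp flip: action_mult)
    ultimately show ?thesis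
      using assms AB by (simp add: action_add)
  qed
  moreover have "v \<cdot> \<phi> g \<cdot> \<phi> h = v \<cdot> \<phi> h \<cdot> \<phi> g" if "v \<in> carrier M" for v
    using assms that by (intro action_center_commute) (auto intro: phi_center)
  moreover have images: "conj_by h ` set a \<subseteq> carrier G" "(\<lambda>v. v \<cdot> h) ` set c \<subseteq> carrier M"
      "(\<lambda>v. v \<cdot> \<phi> h) ` set d \<subseteq> carrier M"
    using assms by auto
  ultimately have merged: "twist (map (conj_by h) (a @ [g]) @ b)
      (map (\<lambda>v. v \<cdot> h) c @ [y \<cdot> h \<oplus>\<^bsub>M\<^esub> z \<cdot> \<phi> h] @ map (\<lambda>v. v \<cdot> \<phi> h) d)
    = ?C @ [?y \<oplus>\<^bsub>M\<^esub> ?z] @ ?D"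
    using assms AB images
    by (simp del: phi_mult add: twist_append C phiA phig list_prod_conj twist_central phi_center twist_in)
  show thesis
    by (rule that[OF eq _ merged[symmetric]]) (use assms in simp)
qed

text \<open>A left factor \<open>g\<close> of the group element at some position moves the entries before it by \<open>g\<close>
and the others by \<open>\<phi> g\<close>. Moving \<open>g\<close> past the twists of the earlier entries conjugates their
group elements.\<close>

lemma twist_absorb:
  assumes "set a \<subseteq> carrier G" "g \<in> carrier G" "p \<in> carrier G" "set b \<subseteq> carrier G"
    and "set c \<subseteq> carrier M" "z \<in> carrier M" "set d \<subseteq> carrier M"
    and "length a = length c"
  shows "twist (map (conj_by g) a @ p # b) (map (\<lambda>v. v \<cdot> g) c @ map (\<lambda>v. v \<cdot> \<phi> g) (z # d))
    = twist (a @ (g \<otimes> p) # b) (c @ z # d)"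
proof -
  let ?A = "list_prod G a" and ?B = "list_prod G b"
  have AB: "?A \<in> carrier G" "?B \<in> carrier G"
    using assms by auto
  have phiA: "\<phi> (conj_by g ?A) = \<phi> ?A"
    using assms AB by (intro phi_conj)
  have "v \<cdot> g \<cdot> (p \<otimes> ?B) = v \<cdot> (g \<otimes> p \<otimes> ?B)" if "v \<in> carrier M" for v
    using assms AB that by (simp add: m_assoc flip: action_mult)
  moreover have "z \<cdot> \<phi> g \<cdot> (\<phi> p \<otimes> ?B) = z \<cdot> (\<phi> (g \<otimes> p) \<otimes> ?B)"
    using assms AB by (simp add: m_assoc flip: action_mult)
  moreover have "v \<cdot> \<phi> g \<cdot> \<phi> p = v \<cdot> \<phi> (g \<otimes> p)" if "v \<in> carrier M" for v
    using assms that by (simp flip: action_mult)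
  moreover have "conj_by g ` set a \<subseteq> carrier G" "(\<lambda>v. v \<cdot> g) ` set c \<subseteq> carrier M"
      "(\<lambda>v. v \<cdot> \<phi> g) ` set d \<subseteq> carrier M"
    using assms by auto
  ultimately show ?thesis
    using assms AB
    by (simp del: phi_mult add: twist_append phiA list_prod_conj twist_conj twist_central phi_center twist_in)
qed

text \<open>The inner faces of the group boundary; \<open>i\<close> counts from 1, as in \<open>gp_boundary_tuple\<close>.\<close>

definition merge_at :: "nat \<Rightarrow> 'm list \<Rightarrow> 'm list" where
  "merge_at i ms = take (i - 1) ms @ [ms ! (i - 1) \<oplus>\<^bsub>M\<^esub> ms ! i] @ drop (i + 1) ms"

lemma twist_merge_at:
  assumes "set s \<subseteq> carrier G" "h \<in> carrier G" "set b \<subseteq> carrier G"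
    and "set c \<subseteq> carrier M" "y \<in> carrier M" "z \<in> carrier M" "set d \<subseteq> carrier M"
    and "length s = Suc (length c)" "length b = length d"
  shows "merge_at (length s) (twist (s @ [h] @ b) (c @ [y, z] @ d))
    = twist (map (conj_by h) s @ b)
      (map (\<lambda>v. v \<cdot> h) c @ [y \<cdot> h \<oplus>\<^bsub>M\<^esub> z \<cdot> \<phi> h] @ map (\<lambda>v. v \<cdot> \<phi> h) d)"
proof -
  obtain a g where s: "s = a @ [g]"
    using assms(8) by (cases s rule: rev_cases) auto
  obtain C y' z' D where "twist (a @ [g, h] @ b) (c @ [y, z] @ d) = C @ [y', z'] @ D"
    and "length C = length c"
    and "C @ [y' \<oplus>\<^bsub>M\<^esub> z'] @ D = twist (map (conj_by h) (a @ [g]) @ b)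
      (map (\<lambda>v. v \<cdot> h) c @ [y \<cdot> h \<oplus>\<^bsub>M\<^esub> z \<cdot> \<phi> h] @ map (\<lambda>v. v \<cdot> \<phi> h) d)"
    by (rule twist_merge[of a g h b c y z d]) (use assms s in auto)
  then show ?thesis
    using assms(8) s by (simp add: merge_at_def nth_append)
qed

end

context G_Alexander
begin

section \<open>Representatives of psi and their faces\<close>

text \<open>A representative of \<open>psi\<close>. The first coordinate of the cube is fixed at \<open>k\<^sub>1 = 0\<close>, whence the
leading \<open>\<one>\<close> and the sum over the tail of \<open>gs\<close>.\<close>

definition psi_chain :: "'g list \<Rightarrow> 'm list \<Rightarrow> ('m list \<Rightarrow>\<^sub>0 int)" where
  "psi_chain gs us = altsum G (tl gs) (\<lambda>ps. frag_of (twist (\<one> # ps) us))"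

definition psi_chain_of :: "('m \<times> 'g) list \<Rightarrow> ('m list \<Rightarrow>\<^sub>0 int)" where
  "psi_chain_of xs = psi_chain (map snd xs) (differences_to M (map fst xs) \<zero>\<^bsub>M\<^esub>)"

lemma keys_gp_boundary_tuple:
  assumes "us \<in> tuples (carrier M) (Suc k)"
  shows "Poly_Mapping.keys (gp_boundary_tuple M us) \<subseteq> tuples (carrier M) k"
proof -
  have us: "length us = Suc k" "set us \<subseteq> carrier M"
    using assms by (auto simp: tuples_def)
  have "take (i - 1) us @ [us ! (i - 1) \<oplus>\<^bsub>M\<^esub> us ! i] @ drop (i + 1) us \<in> tuples (carrier M) k"
    if "i \<in> {1..length us - 1}" for i
  proof -
    have "us ! (i - 1) \<in> carrier M" "us ! i \<in> carrier M"
      using that us nth_mem[of "i - 1" us] nth_mem[of i us] by auto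
    then show ?thesis
      using that us set_take_subset[of "i - 1" us] set_drop_subset[of "i + 1" us]
      by (auto simp: tuples_def)
  qed
  moreover have "tl us \<in> tuples (carrier M) k" "butlast us \<in> tuples (carrier M) k"
    using us by (cases us; auto simp: tuples_def dest: in_set_butlastD)+
  ultimately show ?thesis
    unfolding gp_boundary_tuple_def Let_def
    by (intro keys_add_subset keys_sum_subset keys_cmul_subset) auto
qed

text \<open>The vertices with \<open>k\<^sub>1 = 0\<close> form the cube of the remaining coordinates.\<close>

lemma psi_eq_chain:
  assumes "gs \<in> tuples (carrier G) n" "us \<in> tuples (carrier M) n" "0 < n"
  shows "psi G M act \<phi> n gs us = gp_class G M act n (psi_chain gs us)"
proof -
  obtain g gs' where g: "gs = g # gs'"
    using assms by (cases gs) (auto simp: tuples_def)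
  have G: "g \<in> carrier G" "set gs' \<subseteq> carrier G" "n = Suc (length gs')"
    and us: "set us \<subseteq> carrier M" "length us = n"
    using assms g by (auto simp: tuples_def)
  let ?T = "tuples {0, 1} (length gs') :: nat list set"
  let ?p = "map2 (\<lambda>g k. g [^] (k::nat))"
  have twist: "map (\<lambda>i. us ! (i - 1) \<cdot> psi_elt G \<phi> gs (0 # ks) i) [1..<Suc n] = twist (\<one> # ?p gs' ks) us"
    if "ks \<in> ?T" for ks
  proof (rule nth_equalityI)
    have ks: "length ks = length gs'"
      using that by (simp add: tuples_def)
    have p: "set (\<one> # ?p gs' ks) \<subseteq> carrier G"
      using G by (auto dest: set_zip_leftD)
    show "length (map (\<lambda>i. us ! (i - 1) \<cdot> psi_elt G \<phi> gs (0 # ks) i) [1..<Suc n]) = length (twist (\<one> # ?p gs' ks) us)"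
      using us G ks by (simp del: upt_Suc)
    fix i assume "i < length (map (\<lambda>i. us ! (i - 1) \<cdot> psi_elt G \<phi> gs (0 # ks) i) [1..<Suc n])"
    then have i: "i < n"
      by (simp only: length_map length_upt diff_Suc_1)
    then have "map (\<lambda>i. us ! (i - 1) \<cdot> psi_elt G \<phi> gs (0 # ks) i) [1..<Suc n] ! i
      = us ! i \<cdot> (\<phi> (list_prod G (take (Suc i) (\<one> # ?p gs' ks))) \<otimes> list_prod G (drop (Suc i) (\<one> # ?p gs' ks)))"
      by (simp add: psi_elt_def g Let_def del: upt_Suc)
    also have "\<dots> = twist (\<one> # ?p gs' ks) us ! i"
      using i us G ks by (intro twist_nth[OF p us(1), symmetric]) auto
    finally show "map (\<lambda>i. us ! (i - 1) \<cdot> psi_elt G \<phi> gs (0 # ks) i) [1..<Suc n] ! i = twist (\<one> # ?p gs' ks) us ! i" .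
  qed
  have "{ks \<in> tuples {0, 1} n. hd ks = (0::nat)} = (#) 0 ` ?T"
    by (auto simp: G(3) tuples_Suc)
  then have "(\<Sum>ks \<in> {ks \<in> tuples {0, 1} n. hd ks = 0}. frag_cmul ((-1) ^ sum_list ks)
        (frag_of (map (\<lambda>i. us ! (i - 1) \<cdot> psi_elt G \<phi> gs ks i) [1..<Suc n])))
    = (\<Sum>ks \<in> ?T. frag_cmul ((-1) ^ sum_list ks) (frag_of (map (\<lambda>i. us ! (i - 1) \<cdot> psi_elt G \<phi> gs (0 # ks) i) [1..<Suc n])))"
    by (simp add: sum.reindex del: upt_Suc)
  also have "\<dots> = (\<Sum>ks \<in> ?T. frag_cmul ((-1) ^ sum_list ks) (frag_of (twist (\<one> # ?p gs' ks) us)))"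
    by (rule sum.cong[OF refl]) (simp only: twist)
  also have "\<dots> = psi_chain gs us"
    using altsum_eq_sum_cube[OF is_group G(2), of "\<lambda>ps. frag_of (twist (\<one> # ps) us)"]
    by (simp add: psi_chain_def g)
  finally show ?thesis
    by (simp add: psi_def)
qed

abbreviation under (infixl "\<triangleleft>" 70) where "y \<triangleleft> x \<equiv> mcb_under G M act \<phi> y x"
abbreviation over (infixl "\<triangleright>" 70) where "y \<triangleright> x \<equiv> mcb_over act \<phi> y x"

lemma under_over_simps [simp]:
  "snd (y \<triangleleft> x) = conj_by (snd x) (snd y)"
  "fst (y \<triangleleft> x) = fst y \<cdot> snd x \<oplus>\<^bsub>M\<^esub> act (fst x) (frag_of (\<phi> (snd x)) - frag_of (snd x))"
  "snd (y \<triangleright> x) = snd y"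
  "fst (y \<triangleright> x) = fst y \<cdot> \<phi> (snd x)"
  by (simp_all add: mcb_under_def mcb_over_def split_beta)

lemma psi_chain_act:
  assumes "set gs \<subseteq> carrier G" "set us \<subseteq> carrier M" "z \<in> center G"
  shows "psi_chain gs (map (\<lambda>v. v \<cdot> z) us) - psi_chain gs us
    = altsum G (tl gs) (\<lambda>ps. frag_of (map (\<lambda>v. v \<cdot> z) (twist (\<one> # ps) us)) - frag_of (twist (\<one> # ps) us))"
proof -
  have tl: "set (tl gs) \<subseteq> carrier G"
    using assms(1) by (cases gs) auto
  show ?thesis
    unfolding psi_chain_def altsum_diff[symmetric] using assms
    by (intro altsum_cong[OF is_group tl]) (simp add: twist_central tuples_def)
qed

text \<open>At \<open>m\<close> itself the two operations by \<open>(m, g)\<close> agree in the module component.\<close>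

lemma under_same:
  assumes "m \<in> carrier M" "g \<in> carrier G"
  shows "m \<cdot> g \<oplus>\<^bsub>M\<^esub> act m (frag_of (\<phi> g) - frag_of g) = m \<cdot> \<phi> g"
proof -
  have "m \<cdot> g \<oplus>\<^bsub>M\<^esub> (m \<cdot> \<phi> g \<oplus>\<^bsub>M\<^esub> \<ominus>\<^bsub>M\<^esub> (m \<cdot> g)) = m \<cdot> \<phi> g \<oplus>\<^bsub>M\<^esub> (m \<cdot> g \<oplus>\<^bsub>M\<^esub> \<ominus>\<^bsub>M\<^esub> (m \<cdot> g))"
    using assms by (intro M.a_lcomm) auto
  then show ?thesis
    using assms by (simp add: act_frag_diff M.minus_eq M.r_neg)
qed

lemma differences_to_under:
  assumes "set ms \<subseteq> carrier M" "a \<in> carrier M" "m \<in> carrier M" "g \<in> carrier G"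
  shows "differences_to M (map (\<lambda>q. q \<cdot> g \<oplus>\<^bsub>M\<^esub> act m (frag_of (\<phi> g) - frag_of g)) ms)
      (a \<cdot> g \<oplus>\<^bsub>M\<^esub> act m (frag_of (\<phi> g) - frag_of g))
    = map (\<lambda>q. q \<cdot> g) (differences_to M ms a)"
  using assms by (intro differences_to_affine) (simp_all add: act_frag_diff)

text \<open>The effect of deleting \<open>m\<close>, and of the biquandle operations by \<open>(m, g)\<close>, on the
differences. The translations by \<open>m \<cdot> (\<phi> g - g)\<close> cancel in all differences except the one across the
position of \<open>m\<close>, where they turn \<open>m \<cdot> g\<close> into \<open>m \<cdot> \<phi> g\<close> by \<open>under_same\<close>.\<close>

lemma differences_to_split:
  assumes "set ls \<subseteq> carrier M" "a \<in> carrier M" "m \<in> carrier M" "set rs \<subseteq> carrier M"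
    "g \<in> carrier G"
  defines "e \<equiv> hd (rs @ [\<zero>\<^bsub>M\<^esub>])"
  shows "differences_to M (ls @ [a, m] @ rs) \<zero>\<^bsub>M\<^esub>
      = differences_to M ls a @ [a \<ominus>\<^bsub>M\<^esub> m, m \<ominus>\<^bsub>M\<^esub> e] @ differences_to M rs \<zero>\<^bsub>M\<^esub>"
    and "differences_to M (ls @ [a] @ rs) \<zero>\<^bsub>M\<^esub>
      = differences_to M ls a @ [(a \<ominus>\<^bsub>M\<^esub> m) \<oplus>\<^bsub>M\<^esub> (m \<ominus>\<^bsub>M\<^esub> e)] @ differences_to M rs \<zero>\<^bsub>M\<^esub>"
    and "differences_to M (map (\<lambda>q. q \<cdot> g \<oplus>\<^bsub>M\<^esub> act m (frag_of (\<phi> g) - frag_of g)) (ls @ [a]) @ map (\<lambda>q. q \<cdot> \<phi> g) rs) \<zero>\<^bsub>M\<^esub>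
      = map (\<lambda>q. q \<cdot> g) (differences_to M ls a) @ [(a \<ominus>\<^bsub>M\<^esub> m) \<cdot> g \<oplus>\<^bsub>M\<^esub> (m \<ominus>\<^bsub>M\<^esub> e) \<cdot> \<phi> g]
        @ map (\<lambda>q. q \<cdot> \<phi> g) (differences_to M rs \<zero>\<^bsub>M\<^esub>)"
proof -
  have e: "e \<in> carrier M"
    using assms by (cases rs) auto
  show "differences_to M (ls @ [a, m] @ rs) \<zero>\<^bsub>M\<^esub>
      = differences_to M ls a @ [a \<ominus>\<^bsub>M\<^esub> m, m \<ominus>\<^bsub>M\<^esub> e] @ differences_to M rs \<zero>\<^bsub>M\<^esub>"
    by (simp add: differences_to_append e_def)
  show "differences_to M (ls @ [a] @ rs) \<zero>\<^bsub>M\<^esub>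
      = differences_to M ls a @ [(a \<ominus>\<^bsub>M\<^esub> m) \<oplus>\<^bsub>M\<^esub> (m \<ominus>\<^bsub>M\<^esub> e)] @ differences_to M rs \<zero>\<^bsub>M\<^esub>"
    using assms(2,3) e by (simp add: differences_to_append M.minus_add_minus) (simp add: e_def)
  let ?w = "act m (frag_of (\<phi> g) - frag_of g)"
  have w: "?w \<in> carrier M"
    using assms by (simp add: act_frag_diff)
  have hd: "hd (map (\<lambda>q. q \<cdot> \<phi> g) rs @ [\<zero>\<^bsub>M\<^esub>]) = e \<cdot> \<phi> g"
    using assms by (cases rs) auto
  have "(a \<ominus>\<^bsub>M\<^esub> m) \<cdot> g \<oplus>\<^bsub>M\<^esub> (m \<ominus>\<^bsub>M\<^esub> e) \<cdot> \<phi> g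
      = (a \<cdot> g \<oplus>\<^bsub>M\<^esub> ?w \<ominus>\<^bsub>M\<^esub> m \<cdot> \<phi> g) \<oplus>\<^bsub>M\<^esub> (m \<cdot> \<phi> g \<ominus>\<^bsub>M\<^esub> e \<cdot> \<phi> g)"
    using assms e w M.add_minus_add[of "a \<cdot> g" "m \<cdot> g" ?w] by (simp add: action_minus under_same)
  also have "\<dots> = a \<cdot> g \<oplus>\<^bsub>M\<^esub> ?w \<ominus>\<^bsub>M\<^esub> e \<cdot> \<phi> g"
    using assms e w by (intro M.minus_add_minus) auto
  finally have merged: "(a \<ominus>\<^bsub>M\<^esub> m) \<cdot> g \<oplus>\<^bsub>M\<^esub> (m \<ominus>\<^bsub>M\<^esub> e) \<cdot> \<phi> g = a \<cdot> g \<oplus>\<^bsub>M\<^esub> ?w \<ominus>\<^bsub>M\<^esub> e \<cdot> \<phi> g" .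
  have "differences_to M (map (\<lambda>q. q \<cdot> \<phi> g) rs) \<zero>\<^bsub>M\<^esub> = map (\<lambda>q. q \<cdot> \<phi> g) (differences_to M rs \<zero>\<^bsub>M\<^esub>)"
    using differences_to_phi[of rs "\<zero>\<^bsub>M\<^esub>" "\<phi> g"] assms by simp
  then show "differences_to M (map (\<lambda>q. q \<cdot> g \<oplus>\<^bsub>M\<^esub> ?w) (ls @ [a]) @ map (\<lambda>q. q \<cdot> \<phi> g) rs) \<zero>\<^bsub>M\<^esub>
      = map (\<lambda>q. q \<cdot> g) (differences_to M ls a) @ [(a \<ominus>\<^bsub>M\<^esub> m) \<cdot> g \<oplus>\<^bsub>M\<^esub> (m \<ominus>\<^bsub>M\<^esub> e) \<cdot> \<phi> g]
        @ map (\<lambda>q. q \<cdot> \<phi> g) (differences_to M rs \<zero>\<^bsub>M\<^esub>)"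
    using assms(1-5) by (simp add: differences_to_append hd merged differences_to_under)
qed

text \<open>Splitting the cube at the coordinate of \<open>x\<close> separates the merged tuples into those for
\<open>k = 0\<close>, which belong to the deletion of \<open>x\<close>, and those for \<open>k = 1\<close>, which belong to the action of
\<open>x\<close>. For \<open>l = []\<close> there is no neighbour to merge with; that face is the subject of
\<open>psi_chain_of_first_faces\<close>.\<close>

lemma altsum_merge:
  assumes xs: "set (l @ [x] @ r) \<subseteq> carrier M \<times> carrier G" and l: "l \<noteq> []"
  shows "altsum G (map snd (tl (l @ [x] @ r)))
      (\<lambda>ps. frag_of (merge_at (length l) (twist (\<one> # ps) (differences_to M (map fst (l @ [x] @ r)) \<zero>\<^bsub>M\<^esub>))))
    = psi_chain_of (l @ r) - psi_chain_of (map (\<lambda>y. y \<triangleleft> x) l @ map (\<lambda>y. y \<triangleright> x) r)"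
proof -
  obtain m h where x: "x = (m, h)" by force
  obtain ls a where ls: "map fst l = ls @ [a]"
    using l by (cases l rule: rev_cases) auto
  obtain x1 l' where l': "l = x1 # l'"
    using l by (cases l) auto
  have len: "length l' = length ls"
    using arg_cong[OF ls, of length] l' by simp
  have M: "m \<in> carrier M" "h \<in> carrier G" "set (map fst r) \<subseteq> carrier M" "set (map snd r) \<subseteq> carrier G"
      "set (map snd l') \<subseteq> carrier G"
    using xs x l' by auto
  have "set (map fst l) \<subseteq> carrier M"
    using xs by auto
  then have a: "set ls \<subseteq> carrier M" "a \<in> carrier M"
    unfolding ls by auto
  define e where "e = hd (map fst r @ [\<zero>\<^bsub>M\<^esub>])"
  have e: "e \<in> carrier M"
    using M by (cases r) (auto simp: e_def)
  define c y z d where "c = differences_to M ls a" "y = a \<ominus>\<^bsub>M\<^esub> m" "z = m \<ominus>\<^bsub>M\<^esub> e"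
    "d = differences_to M (map fst r) \<zero>\<^bsub>M\<^esub>"
  note cyzd = this
  have cM: "set c \<subseteq> carrier M" "y \<in> carrier M" "z \<in> carrier M" "set d \<subseteq> carrier M"
    using a M e M.differences_to_closed[of ls a] M.differences_to_closed[of "map fst r" "\<zero>\<^bsub>M\<^esub>"] by (auto simp: cyzd)
  have us: "differences_to M (map fst (l @ [x] @ r)) \<zero>\<^bsub>M\<^esub> = c @ [y, z] @ d"
    using differences_to_split(1)[OF a M(1,3,2)] by (simp add: ls x cyzd e_def)
  have us0: "differences_to M (map fst (l @ r)) \<zero>\<^bsub>M\<^esub> = c @ [y \<oplus>\<^bsub>M\<^esub> z] @ d"
    using differences_to_split(2)[OF a M(1,3,2)] by (simp add: ls cyzd e_def)
  let ?us1 = "map (\<lambda>v. v \<cdot> h) c @ [y \<cdot> h \<oplus>\<^bsub>M\<^esub> z \<cdot> \<phi> h] @ map (\<lambda>v. v \<cdot> \<phi> h) d"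
  have map_under: "map fst (map (\<lambda>y. y \<triangleleft> x) l)
      = map (\<lambda>q. q \<cdot> h \<oplus>\<^bsub>M\<^esub> act m (frag_of (\<phi> h) - frag_of h)) (map fst l)"
    by (simp add: x)
  have us1: "differences_to M (map fst (map (\<lambda>y. y \<triangleleft> x) l @ map (\<lambda>y. y \<triangleright> x) r)) \<zero>\<^bsub>M\<^esub> = ?us1"
    using differences_to_split(3)[OF a M(1,3,2)]
    unfolding map_append map_under ls by (simp add: cyzd e_def x o_def)
  have lenC: "length c = length l'" "length d = length r"
    by (simp_all add: cyzd len)
  let ?T = "\<lambda>ps h qs. merge_at (length l) (twist ((\<one> # ps) @ [h] @ qs) (c @ [y, z] @ d))"
  have T: "?T ps k qs = twist (map (conj_by k) (\<one> # ps) @ qs)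
      (map (\<lambda>v. v \<cdot> k) c @ [y \<cdot> k \<oplus>\<^bsub>M\<^esub> z \<cdot> \<phi> k] @ map (\<lambda>v. v \<cdot> \<phi> k) d)"
    if "k \<in> carrier G" "ps \<in> tuples (carrier G) (length l')" "qs \<in> tuples (carrier G) (length r)"
    for ps k qs
    using twist_merge_at[of "\<one> # ps" k qs c y z d] that cM lenC
    by (simp add: tuples_def l')
  have T0: "?T ps \<one> qs = twist (\<one> # ps @ qs) (c @ [y \<oplus>\<^bsub>M\<^esub> z] @ d)"
    if ps: "ps \<in> tuples (carrier G) (length l')" and qs: "qs \<in> tuples (carrier G) (length r)" for ps qs
  proof -
    have "map (conj_by \<one>) ps = ps" "map (\<lambda>v. v \<cdot> \<one>) c = c" "map (\<lambda>v. v \<cdot> \<phi> \<one>) d = d"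
      using ps cM by (auto simp: tuples_def intro!: map_idI simp: subset_iff)
    then show ?thesis
      using T[OF one_closed ps qs] cM by simp
  qed
  have T1: "?T ps h qs = twist (\<one> # map (conj_by h) ps @ qs) ?us1"
    if "ps \<in> tuples (carrier G) (length l')" "qs \<in> tuples (carrier G) (length r)" for ps qs
    using T[OF M(2) that] M(2) by simp
  have "altsum G (map snd (tl (l @ [x] @ r)))
      (\<lambda>ps. frag_of (merge_at (length l) (twist (\<one> # ps) (c @ [y, z] @ d))))
    = altsum G (map snd l') (\<lambda>ps. altsum G (map snd r) (\<lambda>qs. frag_of (?T ps \<one> qs)))
      - altsum G (map snd l') (\<lambda>ps. altsum G (map snd r) (\<lambda>qs. frag_of (?T ps h qs)))"
    by (simp add: l' x altsum_append altsum_diff)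
  also have "altsum G (map snd l') (\<lambda>ps. altsum G (map snd r) (\<lambda>qs. frag_of (?T ps \<one> qs)))
    = altsum G (map snd l') (\<lambda>ps. altsum G (map snd r)
        (\<lambda>qs. frag_of (twist (\<one> # ps @ qs) (c @ [y \<oplus>\<^bsub>M\<^esub> z] @ d))))"
    using M(4,5) by (intro altsum_cong[OF is_group]) (auto simp only: T0 length_map)
  also have "\<dots> = psi_chain_of (l @ r)"
    unfolding psi_chain_of_def us0 by (simp add: psi_chain_def l' altsum_append)
  also have "altsum G (map snd l') (\<lambda>ps. altsum G (map snd r) (\<lambda>qs. frag_of (?T ps h qs)))
    = altsum G (map snd l') (\<lambda>ps. altsum G (map snd r)
        (\<lambda>qs. frag_of (twist (\<one> # map (conj_by h) ps @ qs) ?us1)))"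
    using M(4,5) by (intro altsum_cong[OF is_group]) (auto simp only: T1 length_map)
  also have "\<dots> = psi_chain_of (map (\<lambda>y. y \<triangleleft> x) l @ map (\<lambda>y. y \<triangleright> x) r)"
  proof -
    have "altsum G (map (conj_by h) (map snd l')) (\<lambda>ps. altsum G (map snd r) (\<lambda>qs. frag_of (twist (\<one> # ps @ qs) ?us1)))
      = altsum G (map snd l') (\<lambda>ps. altsum G (map snd r)
        (\<lambda>qs. frag_of (twist (\<one> # map (conj_by h) ps @ qs) ?us1)))"
      using M(2) by (intro altsum_map) simp
    then show ?thesis
      unfolding psi_chain_of_def us1 by (simp add: psi_chain_def l' x altsum_append o_def)
  qed
  finally show ?thesis
    unfolding us .
qed

end

section \<open>Identities modulo the kernel of a normalized cocycle\<close>

text \<open>In the application \<open>K\<close> is the kernel of \<open>f\<close> on chains. The identities behind the cocycle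
condition use only that it is a subgroup containing the relators of the coinvariants, the
degenerate tuples and the boundaries.\<close>

locale group_relations = G_Alexander G M act \<phi>
  for G :: "('g, 'x) monoid_scheme" (structure) and M :: "('m, 'y) ring_scheme"
    and act :: "'m \<Rightarrow> ('g \<Rightarrow>\<^sub>0 int) \<Rightarrow> 'm" and \<phi> :: "'g \<Rightarrow> 'g" +
  fixes n :: nat and K :: "('m list \<Rightarrow>\<^sub>0 int) set"
  assumes n_ge_2: "2 \<le> n"
    and K_zero: "0 \<in> K"
    and K_diff: "a \<in> K \<Longrightarrow> b \<in> K \<Longrightarrow> a - b \<in> K"
    and K_invariant: "us \<in> tuples (carrier M) n \<Longrightarrow> g \<in> carrier G
      \<Longrightarrow> frag_of (map (\<lambda>u. act u (frag_of g)) us) - frag_of us \<in> K"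
    and K_degenerate: "us \<in> tuples (carrier M) n \<Longrightarrow> i < n - 1 \<Longrightarrow> us ! i = \<zero>\<^bsub>M\<^esub> \<Longrightarrow> frag_of us \<in> K"
    and K_boundary: "us \<in> tuples (carrier M) (Suc n) \<Longrightarrow> gp_boundary_tuple M us \<in> K"
begin

lemma K_uminus: "a \<in> K \<Longrightarrow> - a \<in> K"
  using K_diff[OF K_zero] by simp

lemma K_sign: "a \<in> K \<Longrightarrow> frag_cmul ((-1) ^ i) a \<in> K"
  by (cases "even i") (simp_all add: K_uminus)

lemma K_altsum:
  assumes "set gs \<subseteq> carrier G"
    and "\<And>ps. ps \<in> tuples (carrier G) (length gs) \<Longrightarrow> F ps \<in> K"
  shows "altsum G gs F \<in> K"
  using assms by (intro altsum_closed[OF is_group]) (auto intro: K_diff)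

lemma twist_tuple:
  assumes "set ps \<subseteq> carrier G" "set us \<subseteq> carrier M" "length ps = k" "length us = k"
  shows "twist ps us \<in> tuples (carrier M) k"
  using assms twist_closed[of ps us] by (simp add: tuples_def)

lemma psi_chain_central_act:
  assumes "gs \<in> tuples (carrier G) n" "us \<in> tuples (carrier M) n" "z \<in> center G"
  shows "psi_chain gs (map (\<lambda>v. v \<cdot> z) us) - psi_chain gs us \<in> K"
proof -
  have gs: "set gs \<subseteq> carrier G" "length gs = n" "set us \<subseteq> carrier M" "length us = n"
    using assms by (auto simp: tuples_def)
  show ?thesis
    unfolding psi_chain_act[OF gs(1,3) assms(3)]
  proof (rule K_altsum)
    show "set (tl gs) \<subseteq> carrier G"
      using gs by (cases gs) auto
    fix ps assume "ps \<in> tuples (carrier G) (length (tl gs))"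
    then show "frag_of (map (\<lambda>v. v \<cdot> z) (twist (\<one> # ps) us)) - frag_of (twist (\<one> # ps) us) \<in> K"
      using gs n_ge_2 assms(3)
      by (intro K_invariant twist_tuple) (auto simp: tuples_def center_closed)
  qed
qed

lemma twist_degenerate:
  assumes "set ps \<subseteq> carrier G" "set us \<subseteq> carrier M" "i < length ps" "i < length us" "us ! i = \<zero>\<^bsub>M\<^esub>"
  shows "twist ps us ! i = \<zero>\<^bsub>M\<^esub>"
proof -
  have "set (take (Suc i) ps) \<subseteq> carrier G" "set (drop (Suc i) ps) \<subseteq> carrier G"
    using assms(1) set_take_subset set_drop_subset by fast+
  then show ?thesis
    using assms by (simp add: twist_nth del: take_Suc)
qed

lemma psi_chain_degenerate:
  assumes "gs \<in> tuples (carrier G) n" "us \<in> tuples (carrier M) n" "i < n - 1" "us ! i = \<zero>\<^bsub>M\<^esub>"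
  shows "psi_chain gs us \<in> K"
  unfolding psi_chain_def
proof (rule K_altsum)
  show "set (tl gs) \<subseteq> carrier G"
    using assms(1) by (cases gs) (auto simp: tuples_def)
  fix ps assume "ps \<in> tuples (carrier G) (length (tl gs))"
  then have "set (\<one> # ps) \<subseteq> carrier G" "length (\<one> # ps) = n" "set us \<subseteq> carrier M" "length us = n"
    using assms n_ge_2 by (auto simp: tuples_def)
  then show "frag_of (twist (\<one> # ps) us) \<in> K"
    using assms(3,4) by (intro K_degenerate[of _ i] twist_tuple twist_degenerate) auto
qed

text \<open>The difference of the two equal module components is zero, and twisting preserves zeros.\<close>

lemma psi_chain_of_same_group:
  assumes "xs \<in> tuples (carrier M \<times> carrier G) n" "Suc i < n" "fst (xs ! i) = fst (xs ! Suc i)"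
  shows "psi_chain_of xs \<in> K"
proof -
  have xs: "set (map fst xs) \<subseteq> carrier M" "set (map snd xs) \<subseteq> carrier G" "length xs = n"
    using assms(1) by (auto simp: tuples_def)
  have "differences M (map fst xs) ! i = \<zero>\<^bsub>M\<^esub>"
    using assms(2,3) xs subsetD[OF xs(1) nth_mem[of "Suc i" "map fst xs"]]
    by (simp add: differences_def M.minus_eq M.r_neg)
  then have "differences_to M (map fst xs) \<zero>\<^bsub>M\<^esub> ! i = \<zero>\<^bsub>M\<^esub>"
    using M.differences_eq_differences_to[OF xs(1)] by simp
  then show ?thesis
    unfolding psi_chain_of_def using xs assms(2) M.differences_to_closed[OF xs(1), of "\<zero>\<^bsub>M\<^esub>"]
    by (intro psi_chain_degenerate[of _ _ i]) (auto simp: tuples_def)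
qed

text \<open>Without the first entry, the first coordinate occurs only through the action of
\<open>\<phi> g\<close> on the whole remaining tuple, so the halves of the sum for \<open>\<one>\<close> and \<open>g\<close> agree in the
coinvariants.\<close>

lemma altsum_drop_first:
  assumes gs: "gs \<in> tuples (carrier G) n" and us: "us \<in> tuples (carrier M) (Suc n)"
  shows "altsum G gs (\<lambda>ps. frag_of (tl (twist (\<one> # ps) us))) \<in> K"
proof -
  obtain u us' where us': "us = u # us'" "us' \<in> tuples (carrier M) n" "u \<in> carrier M"
    using us by (cases us) (auto simp: tuples_Cons, auto simp: tuples_def)
  obtain v vs where vs: "us' = v # vs"
    using us'(2) n_ge_2 by (cases us') (auto simp: tuples_def)
  obtain g gs' where g: "gs = g # gs'"
    using gs n_ge_2 by (cases gs) (auto simp: tuples_def)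
  have G: "g \<in> carrier G" "set gs' \<subseteq> carrier G" "Suc (length gs') = n"
    using gs g by (auto simp: tuples_def)
  have V: "v \<in> carrier M" "set vs \<subseteq> carrier M" "Suc (length vs) = n"
    using us'(2) vs by (auto simp: tuples_def)
  have tl: "tl (twist (\<one> # p # ps) us) = map (\<lambda>w. w \<cdot> \<phi> p) (twist (\<one> # ps) us')"
    if "ps \<in> tuples (carrier G) (length gs')" "p \<in> carrier G" for ps p
  proof -
    have L: "list_prod G ps \<in> carrier G"
      using that by (auto simp: tuples_def)
    then have "v \<cdot> (\<phi> p \<otimes> list_prod G ps) = v \<cdot> list_prod G ps \<cdot> \<phi> p"
      using that V center_commutes[OF phi_center[OF that(2)]] by (simp flip: action_mult)
    moreover have "w \<in> carrier M" if "w \<in> set (twist ps vs)" for w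
      using that \<open>ps \<in> _\<close> V by (intro twist_in[of ps vs]) (auto simp: tuples_def)
    moreover have "tl (twist (\<one> # p # ps) us) = twist (p # ps) us'"
      using that V twist_closed[of "p # ps" us'] by (auto simp: us'(1) vs tuples_def)
    ultimately show ?thesis
      using V L by (simp add: vs)
  qed
  have "altsum G gs (\<lambda>ps. frag_of (tl (twist (\<one> # ps) us)))
    = - altsum G gs' (\<lambda>ps. frag_of (map (\<lambda>w. w \<cdot> \<phi> g) (twist (\<one> # ps) us'))
      - frag_of (twist (\<one> # ps) us'))"
  proof -
    have "altsum G gs' (\<lambda>ps. frag_of (tl (twist (\<one> # \<one> # ps) us)))
        = altsum G gs' (\<lambda>ps. frag_of (twist (\<one> # ps) us'))"
    proof (rule altsum_cong[OF is_group G(2)])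
      fix ps assume ps: "ps \<in> tuples (carrier G) (length gs')"
      have "map (\<lambda>w. w \<cdot> \<phi> \<one>) (twist (\<one> # ps) us') = twist (\<one> # ps) us'"
        using twist_in[of "\<one> # ps" us'] ps us'(2) by (intro map_idI) (auto simp: tuples_def simp del: twist.simps)
      then show "frag_of (tl (twist (\<one> # \<one> # ps) us)) = frag_of (twist (\<one> # ps) us')"
        by (simp only: tl[OF ps one_closed])
    qed
    moreover have "altsum G gs' (\<lambda>ps. frag_of (tl (twist (\<one> # g # ps) us)))
        = altsum G gs' (\<lambda>ps. frag_of (map (\<lambda>w. w \<cdot> \<phi> g) (twist (\<one> # ps) us')))"
      by (rule altsum_cong[OF is_group G(2)]) (simp only: tl[OF _ G(1)])
    ultimately show ?thesis
      by (simp add: g altsum_diff del: twist.simps)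
  qed
  also have "\<dots> \<in> K"
    using G V us'(2)
    by (intro K_uminus K_altsum K_invariant twist_tuple) (auto simp: tuples_def)
  finally show ?thesis .
qed

text \<open>After the last entry is dropped, the last coordinate acts on the whole remaining tuple, so
that again the two halves of the sum agree in the coinvariants.\<close>

lemma altsum_drop_last:
  assumes gs: "gs \<in> tuples (carrier G) n" and us: "us \<in> tuples (carrier M) (Suc n)"
  shows "altsum G gs (\<lambda>ps. frag_of (butlast (twist (\<one> # ps) us))) \<in> K"
proof -
  obtain gs' g where g: "gs = gs' @ [g]"
    using gs n_ge_2 by (cases gs rule: rev_cases) (auto simp: tuples_def)
  obtain us' u where u: "us = us' @ [u]"
    using us by (cases us rule: rev_cases) (auto simp: tuples_def)
  have G: "g \<in> carrier G" "set gs' \<subseteq> carrier G" "Suc (length gs') = n"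
    using gs g by (auto simp: tuples_def)
  have U: "u \<in> carrier M" "set us' \<subseteq> carrier M" "length us' = n"
    using us u by (auto simp: tuples_def)
  have butlast: "butlast (twist (\<one> # ps @ [p]) us) = map (\<lambda>w. w \<cdot> p) (twist (\<one> # ps) us')"
    if "ps \<in> tuples (carrier G) (length gs')" "p \<in> carrier G" for ps p
    using that U G twist_append[of "\<one> # ps" "[p]" us' "[u]"] by (simp add: u tuples_def butlast_append)
  have "altsum G gs (\<lambda>ps. frag_of (butlast (twist (\<one> # ps) us)))
    = - altsum G gs' (\<lambda>ps. frag_of (map (\<lambda>w. w \<cdot> g) (twist (\<one> # ps) us'))
      - frag_of (twist (\<one> # ps) us'))"
  proof -
    have "altsum G gs' (\<lambda>ps. frag_of (butlast (twist (\<one> # ps @ [\<one>]) us)))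
        = altsum G gs' (\<lambda>ps. frag_of (twist (\<one> # ps) us'))"
    proof (rule altsum_cong[OF is_group G(2)])
      fix ps assume ps: "ps \<in> tuples (carrier G) (length gs')"
      have "map (\<lambda>w. w \<cdot> \<one>) (twist (\<one> # ps) us') = twist (\<one> # ps) us'"
        using twist_in[of "\<one> # ps" us'] ps U by (intro map_idI) (auto simp: tuples_def simp del: twist.simps)
      then show "frag_of (butlast (twist (\<one> # ps @ [\<one>]) us)) = frag_of (twist (\<one> # ps) us')"
        by (simp only: butlast[OF ps one_closed])
    qed
    moreover have "altsum G gs' (\<lambda>ps. frag_of (butlast (twist (\<one> # ps @ [g]) us)))
        = altsum G gs' (\<lambda>ps. frag_of (map (\<lambda>w. w \<cdot> g) (twist (\<one> # ps) us')))"
      by (rule altsum_cong[OF is_group G(2)]) (simp only: butlast[OF _ G(1)])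
    ultimately show ?thesis
      by (simp add: g altsum_diff altsum_append del: twist.simps)
  qed
  also have "\<dots> \<in> K"
    using G U
    by (intro K_uminus K_altsum K_invariant twist_tuple) (auto simp: tuples_def)
  finally show ?thesis .
qed

text \<open>The boundaries of the twisted tuples lie in \<open>K\<close>, and so do the alternating sums of their
two outer faces by \<open>altsum_drop_first\<close> and \<open>altsum_drop_last\<close>. The inner faces remain.\<close>

lemma altsum_inner_faces:
  assumes gs: "gs \<in> tuples (carrier G) n" and us: "us \<in> tuples (carrier M) (Suc n)"
  shows "(\<Sum>i = 1..n. frag_cmul ((-1) ^ i) (altsum G gs (\<lambda>ps. frag_of (merge_at i (twist (\<one> # ps) us))))) \<in> K"
proof -
  let ?T = "\<lambda>ps. twist (\<one> # ps) us"
  have cmul_diff: "frag_cmul k (a - b) = frag_cmul k a - frag_cmul k b" for k and a b :: "'m list \<Rightarrow>\<^sub>0 int"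
    by (rule poly_mapping_eqI) (simp add: algebra_simps lookup_minus)
  have bd: "altsum G gs (\<lambda>ps. gp_boundary_tuple M (?T ps)) \<in> K"
    using gs us by (intro K_altsum K_boundary twist_tuple) (auto simp: tuples_def)
  have "altsum G gs (\<lambda>ps. gp_boundary_tuple M (?T ps))
    = altsum G gs (\<lambda>ps. frag_of (tl (?T ps)) - (- (\<Sum>i = 1..n. frag_cmul ((-1) ^ i) (frag_of (merge_at i (?T ps)))))
        - (- frag_cmul ((-1) ^ Suc n) (frag_of (butlast (?T ps)))))"
    using gs us by (intro altsum_cong[OF is_group])
      (auto simp: tuples_def gp_boundary_tuple_def merge_at_def Let_def simp del: twist.simps)
  also have "\<dots> = altsum G gs (\<lambda>ps. frag_of (tl (?T ps)))
      + (\<Sum>i = 1..n. frag_cmul ((-1) ^ i) (altsum G gs (\<lambda>ps. frag_of (merge_at i (?T ps)))))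
      + frag_cmul ((-1) ^ Suc n) (altsum G gs (\<lambda>ps. frag_of (butlast (?T ps))))"
  proof -
    have neg: "altsum G gs (\<lambda>ps. - F ps) = - altsum G gs F" for F :: "'g list \<Rightarrow> 'm list \<Rightarrow>\<^sub>0 int"
      by (rule altsum_additive[symmetric]) simp
    have cmul: "altsum G gs (\<lambda>ps. frag_cmul k (F ps)) = frag_cmul k (altsum G gs F)" for k and F :: "'g list \<Rightarrow> 'm list \<Rightarrow>\<^sub>0 int"
      by (rule altsum_additive[symmetric]) (rule cmul_diff)
    show ?thesis
      unfolding altsum_diff neg altsum_sum cmul by simp
  qed
  finally have "(\<Sum>i = 1..n. frag_cmul ((-1) ^ i) (altsum G gs (\<lambda>ps. frag_of (merge_at i (?T ps)))))
    = altsum G gs (\<lambda>ps. gp_boundary_tuple M (?T ps)) - altsum G gs (\<lambda>ps. frag_of (tl (?T ps)))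
      - frag_cmul ((-1) ^ Suc n) (altsum G gs (\<lambda>ps. frag_of (butlast (?T ps))))"
    by simp
  then show ?thesis
    using bd altsum_drop_first[OF gs us] altsum_drop_last[OF gs us] by (auto simp only: intro!: K_diff K_sign)
qed

text \<open>Positions count from 0, so the face has the sign \<open>(-1) ^ i\<close>. It corresponds to \<open>merge_at i\<close>,
which counts from 1 and merges the entry with its left neighbour.\<close>

definition face :: "nat \<Rightarrow> ('m \<times> 'g) list \<Rightarrow> ('m \<times> 'g) list" where
  "face i xs = map (\<lambda>y. y \<triangleleft> xs ! i) (take i xs) @ map (\<lambda>y. y \<triangleright> xs ! i) (drop (Suc i) xs)"

definition remove_nth :: "nat \<Rightarrow> 'a list \<Rightarrow> 'a list" where
  "remove_nth i xs = take i xs @ drop (Suc i) xs"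

lemma differences_to_tuple:
  assumes "xs \<in> tuples (carrier M \<times> carrier G) k"
  shows "differences_to M (map fst xs) \<zero>\<^bsub>M\<^esub> \<in> tuples (carrier M) k"
proof -
  have "set (map fst xs) \<subseteq> carrier M" "length xs = k"
    using assms by (auto simp: tuples_def)
  then show ?thesis
    using M.differences_to_closed[of "map fst xs" "\<zero>\<^bsub>M\<^esub>"] by (simp add: tuples_def)
qed

lemma psi_chain_of_faces:
  assumes xs: "xs \<in> tuples (carrier M \<times> carrier G) (Suc n)"
  shows "(\<Sum>i = 1..n. frag_cmul ((-1) ^ i) (psi_chain_of (face i xs) - psi_chain_of (remove_nth i xs))) \<in> K"
proof -
  obtain x xs' where x: "xs = x # xs'"
    using xs by (cases xs) (auto simp: tuples_def)
  let ?us = "differences_to M (map fst xs) \<zero>\<^bsub>M\<^esub>"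
  have "map snd xs' \<in> tuples (carrier G) n"
    using xs x by (auto simp: tuples_def)
  from altsum_inner_faces[OF this differences_to_tuple[OF xs]]
  have "- (\<Sum>i = 1..n. frag_cmul ((-1) ^ i) (altsum G (map snd xs') (\<lambda>ps. frag_of (merge_at i (twist (\<one> # ps) ?us))))) \<in> K"
    by (rule K_uminus)
  also have "- (\<Sum>i = 1..n. frag_cmul ((-1) ^ i) (altsum G (map snd xs') (\<lambda>ps. frag_of (merge_at i (twist (\<one> # ps) ?us)))))
    = (\<Sum>i = 1..n. frag_cmul ((-1) ^ i) (psi_chain_of (face i xs) - psi_chain_of (remove_nth i xs)))"
    unfolding sum_negf[symmetric]
  proof (rule sum.cong[OF refl])
    fix i assume i: "i \<in> {1..n}"
    then have len: "i < length xs"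
      using xs by (auto simp: tuples_def)
    then have split: "take i xs @ [xs ! i] @ drop (Suc i) xs = xs"
      by (simp add: id_take_nth_drop[symmetric])
    have "altsum G (map snd xs') (\<lambda>ps. frag_of (merge_at i (twist (\<one> # ps) ?us)))
      = psi_chain_of (remove_nth i xs) - psi_chain_of (face i xs)"
      using altsum_merge[of "take i xs" "xs ! i" "drop (Suc i) xs"] i len xs
      unfolding split by (auto simp: x face_def remove_nth_def tuples_def min_def)
    moreover have "- frag_cmul k (a - b) = frag_cmul k (b - a)" for k and a b :: "'m list \<Rightarrow>\<^sub>0 int"
      by (rule poly_mapping_eqI) (simp add: algebra_simps lookup_minus)
    ultimately show "- frag_cmul ((-1) ^ i) (altsum G (map snd xs') (\<lambda>ps. frag_of (merge_at i (twist (\<one> # ps) ?us))))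
        = frag_cmul ((-1) ^ i) (psi_chain_of (face i xs) - psi_chain_of (remove_nth i xs))"
      by simp
  qed
  finally show ?thesis .
qed

lemma psi_chain_of_over:
  assumes xs: "xs \<in> tuples (carrier M \<times> carrier G) n" and z: "g \<in> carrier G"
    and ys: "map snd ys = map snd xs" "map fst ys = map (\<lambda>m. m \<cdot> \<phi> g) (map fst xs)"
  shows "psi_chain_of ys - psi_chain_of xs \<in> K"
proof -
  have "set (map fst xs) \<subseteq> carrier M"
    using xs by (auto simp: tuples_def)
  then have "differences_to M (map fst ys) \<zero>\<^bsub>M\<^esub> = map (\<lambda>v. v \<cdot> \<phi> g) (differences_to M (map fst xs) \<zero>\<^bsub>M\<^esub>)"
    using differences_to_phi[of "map fst xs" "\<zero>\<^bsub>M\<^esub>" "\<phi> g"] z unfolding ys(2) by simp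
  moreover have "map snd xs \<in> tuples (carrier G) n"
    using xs by (auto simp: tuples_def)
  ultimately show ?thesis
    unfolding psi_chain_of_def ys(1) using differences_to_tuple[OF xs] phi_center[OF z] by (simp add: psi_chain_central_act)
qed

lemma psi_chain_of_first_faces:
  assumes xs: "xs \<in> tuples (carrier M \<times> carrier G) (Suc n)"
  shows "psi_chain_of (face 0 xs) - psi_chain_of (remove_nth 0 xs) \<in> K"
proof -
  obtain x xs' where x: "xs = x # xs'"
    using xs by (cases xs) (auto simp: tuples_def)
  show ?thesis
    using xs unfolding x
    by (intro psi_chain_of_over[of _ "snd x"]) (auto simp: face_def remove_nth_def tuples_def)
qed

text \<open>Write \<open>S k\<close> for the alternating sum over the other coordinates with \<open>k\<close> at the position of the
block. The three chains are \<open>S g - S (g g\<^sup>-\<^sup>1 h)\<close> by \<open>twist_absorb\<close>, \<open>S \<one> - S h\<close> and \<open>S \<one> - S g\<close>.\<close>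

lemma psi_chain_of_block:
  assumes xs: "set l \<subseteq> carrier M \<times> carrier G" "set r \<subseteq> carrier M \<times> carrier G"
    and m: "m \<in> carrier M" "g \<in> carrier G" "h \<in> carrier G" and l: "l \<noteq> []"
  shows "psi_chain_of (map (\<lambda>y. y \<triangleleft> (m, g)) l @ (m \<cdot> \<phi> g, inv g \<otimes> h) # map (\<lambda>y. y \<triangleright> (m, g)) r)
    = psi_chain_of (l @ (m, h) # r) - psi_chain_of (l @ (m, g) # r)"
proof -
  obtain x1 l' where l': "l = x1 # l'"
    using l by (cases l) auto
  have M: "set (map fst l) \<subseteq> carrier M" "set (map snd l) \<subseteq> carrier G"
     "set (map fst r) \<subseteq> carrier M" "set (map snd r) \<subseteq> carrier G" "set (map snd l') \<subseteq> carrier G"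
    using xs l' by auto
  define e where "e = hd (map fst r @ [\<zero>\<^bsub>M\<^esub>])"
  have e: "e \<in> carrier M"
    using M by (cases r) (auto simp: e_def)
  define c z d where "c = differences_to M (map fst l) m" "z = m \<ominus>\<^bsub>M\<^esub> e" "d = differences_to M (map fst r) \<zero>\<^bsub>M\<^esub>"
  note czd = this
  have cM: "set c \<subseteq> carrier M" "z \<in> carrier M" "set d \<subseteq> carrier M"
    using m M e M.differences_to_closed[of "map fst l" m] M.differences_to_closed[of "map fst r" "\<zero>\<^bsub>M\<^esub>"] by (auto simp: czd)
  have us: "differences_to M (map fst (l @ (m, k) # r)) \<zero>\<^bsub>M\<^esub> = c @ z # d" for k :: 'g
    by (simp add: czd e_def differences_to_append)
  let ?xs = "map (\<lambda>y. y \<triangleleft> (m, g)) l @ (m \<cdot> \<phi> g, inv g \<otimes> h) # map (\<lambda>y. y \<triangleright> (m, g)) r"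
  have us1: "differences_to M (map fst ?xs) \<zero>\<^bsub>M\<^esub> = map (\<lambda>v. v \<cdot> g) c @ map (\<lambda>v. v \<cdot> \<phi> g) (z # d)"
  proof -
    have "differences_to M (map (\<lambda>q. q \<cdot> g \<oplus>\<^bsub>M\<^esub> act m (frag_of (\<phi> g) - frag_of g)) (map fst l)) (m \<cdot> \<phi> g)
      = map (\<lambda>v. v \<cdot> g) c"
      using differences_to_under[OF M(1) m(1) m(1,2)] m by (simp add: under_same czd)
    moreover have "differences_to M (map (\<lambda>q. q \<cdot> \<phi> g) (m # map fst r)) \<zero>\<^bsub>M\<^esub> = map (\<lambda>v. v \<cdot> \<phi> g) (z # d)"
      using differences_to_phi[of "m # map fst r" "\<zero>\<^bsub>M\<^esub>" "\<phi> g"] m M by (simp add: czd e_def)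
    ultimately show ?thesis
      by (simp add: differences_to_append o_def)
  qed
  have T: "twist (\<one> # map (conj_by g) ps @ p # qs) (map (\<lambda>v. v \<cdot> g) c @ map (\<lambda>v. v \<cdot> \<phi> g) (z # d))
      = twist (\<one> # ps @ (g \<otimes> p) # qs) (c @ z # d)"
    if "ps \<in> tuples (carrier G) (length l')" "qs \<in> tuples (carrier G) (length r)" "p \<in> carrier G" for ps p qs
    using twist_absorb[of "\<one> # ps" g p qs c z d] that m cM
    by (simp add: tuples_def l' czd(1))
  let ?S = "\<lambda>k. altsum G (map snd l') (\<lambda>ps. altsum G (map snd r) (\<lambda>qs. frag_of (twist (\<one> # ps @ k # qs) (c @ z # d))))"
  have psi_chain: "psi_chain_of (l @ (m, k) # r) = ?S \<one> - ?S k" for k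
    unfolding psi_chain_of_def us by (simp add: psi_chain_def l' altsum_append altsum_diff)
  have S: "altsum G (map (conj_by g) (map snd l')) (\<lambda>ps. altsum G (map snd r) (\<lambda>qs. frag_of (twist (\<one> # ps @ p # qs)
       (map (\<lambda>v. v \<cdot> g) c @ map (\<lambda>v. v \<cdot> \<phi> g) (z # d))))) = ?S (g \<otimes> p)" if "p \<in> carrier G" for p
  proof -
    have "altsum G (map (conj_by g) (map snd l')) (\<lambda>ps. altsum G (map snd r) (\<lambda>qs. frag_of (twist (\<one> # ps @ p # qs)
        (map (\<lambda>v. v \<cdot> g) c @ map (\<lambda>v. v \<cdot> \<phi> g) (z # d)))))
      = altsum G (map snd l') (\<lambda>ps. altsum G (map snd r) (\<lambda>qs. frag_of (twist (\<one> # map (conj_by g) ps @ p # qs)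
        (map (\<lambda>v. v \<cdot> g) c @ map (\<lambda>v. v \<cdot> \<phi> g) (z # d)))))"
      using m by (intro altsum_map) simp
    also have "\<dots> = ?S (g \<otimes> p)"
      using M(4,5) that by (intro altsum_cong[OF is_group]) (auto simp only: T length_map)
    finally show ?thesis .
  qed
  have "map (conj_by g) (map snd l') = map (\<lambda>y. inv g \<otimes> snd y \<otimes> g) l'"
    by simp
  then have "psi_chain_of ?xs = ?S (g \<otimes> \<one>) - ?S (g \<otimes> (inv g \<otimes> h))"
    using S[of \<one>] S[of "inv g \<otimes> h"] m(2,3)
    unfolding psi_chain_of_def us1
    by (simp add: psi_chain_def l' altsum_append altsum_diff o_def del: twist.simps r_one)
  also have "\<dots> = ?S g - ?S h"
    using m by (simp flip: m_assoc)
  finally show ?thesis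
    using psi_chain[of h] psi_chain[of g] by simp
qed

text \<open>The first coordinate of the cube is fixed at 0.\<close>

lemma psi_chain_of_change_first: "psi_chain_of ((m, g) # r) = psi_chain_of ((m, h) # r)"
  by (simp add: psi_chain_of_def psi_chain_def)

end

section \<open>Symbols with short blocks\<close>

lemma length_le_total: "\<forall>xs\<in>set w. xs \<noteq> [] \<Longrightarrow> length w \<le> (\<Sum>xs\<leftarrow>w. length xs)"
proof (induction w)
  case (Cons xs w)
  then show ?case by (cases xs) auto
qed simp

lemma total_minimal:
  "\<forall>xs\<in>set w. xs \<noteq> [] \<Longrightarrow> (\<Sum>xs\<leftarrow>w. length xs) = length w \<Longrightarrow> map (\<lambda>x. [x]) (map hd w) = w"
proof (induction w)
  case (Cons xs w)
  have le: "length w \<le> (\<Sum>xs\<leftarrow>w. length xs)"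
    using Cons(2) by (intro length_le_total) simp
  obtain x xs' where xs: "xs = x # xs'"
    using Cons(2) by (cases xs) auto
  have "length xs' = 0" "(\<Sum>xs\<leftarrow>w. length xs) = length w"
    using Cons(3) le unfolding xs list.map sum_list.Cons list.size by linarith+
  then show ?case
    using Cons(1,2) by (simp add: xs del: map_map)
qed simp

lemma total_almost_minimal:
  "\<forall>xs\<in>set w. xs \<noteq> [] \<Longrightarrow> (\<Sum>xs\<leftarrow>w. length xs) = Suc (length w)
    \<Longrightarrow> \<exists>l x y r. w = map (\<lambda>x. [x]) l @ [[x, y]] @ map (\<lambda>x. [x]) r"
proof (induction w)
  case (Cons xs w)
  have le: "length w \<le> (\<Sum>xs\<leftarrow>w. length xs)"
    using Cons(2) by (intro length_le_total) simp
  obtain x xs' where xs: "xs = x # xs'"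
    using Cons(2) by (cases xs) auto
  show ?case
  proof (cases xs')
    case Nil
    then obtain l y z r where "w = map (\<lambda>x. [x]) l @ [[y, z]] @ map (\<lambda>x. [x]) r"
      using Cons xs by auto
    then have "xs # w = map (\<lambda>x. [x]) (x # l) @ [[y, z]] @ map (\<lambda>x. [x]) r"
      using xs Nil by simp
    then show ?thesis by blast
  next
    case (Cons y ys)
    then have "length ys = 0" "(\<Sum>xs\<leftarrow>w. length xs) = length w"
      using Cons.prems(2) le unfolding xs Cons list.map sum_list.Cons list.size by linarith+
    moreover from this have "map (\<lambda>x. [x]) (map hd w) = w"
      using Cons.prems by (intro total_minimal) auto
    ultimately have "xs # w = map (\<lambda>x. [x]) [] @ [[x, y]] @ map (\<lambda>x. [x]) (map hd w)"
      using xs Cons by (simp del: map_map)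
    then show ?thesis by blast
  qed
qed simp

lemma drop_empty_append [simp]: "drop_empty (u @ v) = drop_empty u @ drop_empty v"
  by (simp add: drop_empty_def)

lemma drop_empty_Cons [simp]: "drop_empty (xs # w) = (if xs = [] then drop_empty w else xs # drop_empty w)"
  by (simp add: drop_empty_def)

lemma drop_empty_Nil [simp]: "drop_empty [] = []"
  by (simp add: drop_empty_def)

lemma length_drop_empty: "length (drop_empty w) \<le> length w"
  by (simp add: drop_empty_def)

lemma total_drop_empty: "(\<Sum>xs\<leftarrow>drop_empty w. length xs) = (\<Sum>xs\<leftarrow>w. length xs)"
  by (induction w) auto

lemma drop_empty_symbol:
  "\<forall>xs\<in>set w. in_one_group G M xs \<Longrightarrow> (\<Sum>xs\<leftarrow>w. length xs) = n \<Longrightarrow> drop_empty w \<in> mcb_symbols G M n"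
  by (auto simp: mcb_symbols_def total_drop_empty) (auto simp: drop_empty_def)

lemma in_one_group_mono: "in_one_group G M xs \<Longrightarrow> set ys \<subseteq> set xs \<Longrightarrow> in_one_group G M ys"
  unfolding in_one_group_def by blast

lemma nth_Cons_in: "x \<in> S \<Longrightarrow> set xs \<subseteq> S \<Longrightarrow> i \<le> length xs \<Longrightarrow> (x # xs) ! i \<in> S"
  by (cases i) auto

section \<open>Shuffles\<close>

text \<open>The second bound keeps the index into \<open>bs\<close> within range: \<open>\<mu>\<close> maps the \<open>l\<close> with \<open>\<mu> l > j\<close>
injectively to \<open>{j<..s + t}\<close>, so there are at most \<open>s + t - j\<close> of them.\<close>

lemma shuffle_index_bounds:
  fixes \<mu> :: "nat \<Rightarrow> nat"
  assumes range: "\<mu> \<in> {1..s} \<rightarrow>\<^sub>E {1..s + t}" and mono: "strict_mono_on {1..s} \<mu>" and j: "j \<le> s + t"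
  shows "card {l \<in> {1..s}. \<mu> l \<le> j} \<le> s" "j - card {l \<in> {1..s}. \<mu> l \<le> j} \<le> t"
proof -
  define L U where "L = {l \<in> {1..s}. \<mu> l \<le> j}" and "U = {l \<in> {1..s}. \<not> \<mu> l \<le> j}"
  have LU: "L \<union> U = {1..s}" "L \<inter> U = {}" "finite L" "finite U"
    by (auto simp: L_def U_def)
  have sum: "card L + card U = s"
    using card_Un_disjoint[OF LU(3,4,2)] unfolding LU(1) by simp
  have U: "U \<subseteq> {1..s}"
    by (auto simp: U_def)
  have "inj_on \<mu> U"
    using inj_on_subset[OF strict_mono_on_imp_inj_on[OF mono] U] .
  then have "card U = card (\<mu> ` U)"
    by (simp add: card_image)
  also have "\<dots> \<le> card {j<..s + t}"
  proof (rule card_mono)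
    show "\<mu> ` U \<subseteq> {j<..s + t}"
    proof (rule image_subsetI)
      fix l assume l: "l \<in> U"
      then have "\<mu> l \<in> {1..s + t}"
        using U by (intro PiE_mem[OF range]) blast
      then show "\<mu> l \<in> {j<..s + t}"
        using l by (simp add: U_def)
    qed
  qed simp
  finally have "card U \<le> s + t - j"
    by simp
  then have bounds: "card L \<le> s" "j - card L \<le> t"
    using sum j by linarith+
  show "card {l \<in> {1..s}. \<mu> l \<le> j} \<le> s" "j - card {l \<in> {1..s}. \<mu> l \<le> j} \<le> t"
    using bounds by (simp_all only: L_def)
qed

lemma shuffle_keys:
  assumes "group G" "as \<noteq> []" "bs \<noteq> []" "in_one_group G M (as @ bs)" "cs \<in> Poly_Mapping.keys (mcb_shuffle G as bs)"
  shows "length cs = length as + length bs" "in_one_group G M cs"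
proof -
  interpret group G by fact
  let ?s = "length as" and ?t = "length bs" and ?e = "mcb_one G (fst (hd as))"
  let ?c = "\<lambda>\<mu>. map (\<lambda>j. let r = card {l \<in> {1..?s}. \<mu> l \<le> j}
      in mcb_mult G ((?e # as) ! r) ((?e # bs) ! (j - r))) [1..<Suc (?s + ?t)]"
  have "Poly_Mapping.keys (mcb_shuffle G as bs) \<subseteq>
      {?c \<mu> | \<mu>. \<mu> \<in> {1..?s} \<rightarrow>\<^sub>E {1..?s + ?t} \<and> strict_mono_on {1..?s} \<mu>}"
    unfolding mcb_shuffle_def Let_def
    by (intro keys_sum_subset keys_cmul_subset) (simp only: keys_frag_of, blast)
  then obtain \<mu> where \<mu>: "\<mu> \<in> {1..?s} \<rightarrow>\<^sub>E {1..?s + ?t}" "strict_mono_on {1..?s} \<mu>" and cs: "cs = ?c \<mu>"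
    using assms(5) by blast
  show "length cs = ?s + ?t"
    unfolding cs by (simp only: length_map length_upt diff_Suc_1)
  obtain m where m: "m \<in> carrier M" "set as \<subseteq> {m} \<times> carrier G" "set bs \<subseteq> {m} \<times> carrier G"
    using assms(4) by (auto simp: in_one_group_def)
  then have e: "?e \<in> {m} \<times> carrier G"
    using assms(2) by (cases as) (auto simp: mcb_one_def)
  have step: "mcb_mult G ((?e # as) ! r) ((?e # bs) ! q) \<in> {m} \<times> carrier G" if "r \<le> ?s" "q \<le> ?t" for r q
    using nth_Cons_in[OF e m(2) that(1)] nth_Cons_in[OF e m(3) that(2)] by (auto simp: mcb_mult_def)
  have "set cs \<subseteq> {m} \<times> carrier G"
    unfolding cs Let_def set_map
  proof (rule image_subsetI)
    fix j assume "j \<in> set [1..<Suc (?s + ?t)]"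
    then have "j \<le> ?s + ?t"
      by (simp only: set_upt atLeastLessThan_iff less_Suc_eq_le)
    from step[OF shuffle_index_bounds[OF \<mu> this]]
    show "mcb_mult G ((?e # as) ! card {l \<in> {1..?s}. \<mu> l \<le> j})
        ((?e # bs) ! (j - card {l \<in> {1..?s}. \<mu> l \<le> j})) \<in> {m} \<times> carrier G" .
  qed
  then show "in_one_group G M cs"
    using m(1) by (auto simp: in_one_group_def)
qed

section \<open>The boundary of a symbol, block by block\<close>

text \<open>The contribution of the block \<open>xs\<close> between \<open>l\<close> and \<open>r\<close> to the boundary, up to the sign given by
the degree of \<open>l\<close>.\<close>

definition boundary_block ::
  "('g, 'x) monoid_scheme \<Rightarrow> ('m, 'y) ring_scheme \<Rightarrow> ('m \<Rightarrow> ('g \<Rightarrow>\<^sub>0 int) \<Rightarrow> 'm) \<Rightarrow> ('g \<Rightarrow> 'g)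
    \<Rightarrow> ('m \<times> 'g) list list \<Rightarrow> ('m \<times> 'g) list \<Rightarrow> ('m \<times> 'g) list list
    \<Rightarrow> (('m \<times> 'g) list list \<Rightarrow>\<^sub>0 int)" where
  "boundary_block G M act \<phi> l xs r =
     frag_of (drop_empty (map (map (\<lambda>y. mcb_under G M act \<phi> y (hd xs))) l
        @ [map (\<lambda>y. mcb_over act \<phi> (mcb_mult G (mcb_inv G (hd xs)) y) (hd xs)) (tl xs)]
        @ map (map (\<lambda>y. mcb_over act \<phi> y (hd xs))) r))
     + (\<Sum>j = 1..length xs. frag_cmul ((-1) ^ j) (frag_of (drop_empty (l @ [take (j - 1) xs @ drop j xs] @ r))))"

lemma mcb_boundary_symbol_eq:
  "mcb_boundary_symbol G M act \<phi> w = (\<Sum>i < length w.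
    frag_cmul ((-1) ^ (\<Sum>xs\<leftarrow>take i w. length xs))
      (boundary_block G M act \<phi> (take i w) (w ! i) (drop (Suc i) w)))"
  by (simp add: mcb_boundary_symbol_def boundary_block_def Let_def upd_conv_take_nth_drop)

lemma mcb_proj_of: "mcb_proj n (frag_of w) = (if length w = n then frag_of (map hd w) else 0)"
  by (simp add: mcb_proj_def)

lemma mcb_proj_boundary_block:
  "mcb_proj n (boundary_block G M act \<phi> l xs r) =
     mcb_proj n (frag_of (drop_empty (map (map (\<lambda>y. mcb_under G M act \<phi> y (hd xs))) l
        @ [map (\<lambda>y. mcb_over act \<phi> (mcb_mult G (mcb_inv G (hd xs)) y) (hd xs)) (tl xs)]
        @ map (map (\<lambda>y. mcb_over act \<phi> y (hd xs))) r)))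
     + (\<Sum>j = 1..length xs. frag_cmul ((-1) ^ j)
          (mcb_proj n (frag_of (drop_empty (l @ [take (j - 1) xs @ drop j xs] @ r)))))"
  by (simp add: boundary_block_def mcb_proj_def frag_extend_add frag_extend_sum frag_extend_cmul o_def)

lemma mcb_proj_short: "length (drop_empty w) < n \<Longrightarrow> mcb_proj n (frag_of (drop_empty w)) = 0"
  by (simp add: mcb_proj_of)

lemma proj_boundary_block_few:
  assumes "length l + length r + 1 < n"
  shows "mcb_proj n (boundary_block G M act \<phi> l xs r) = 0"
proof -
  have zero: "mcb_proj n (frag_of (drop_empty (u @ [v] @ w))) = 0"
    if "length u = length l" "length w = length r" for u v w
    using that assms length_drop_empty[of "u @ [v] @ w"] by (intro mcb_proj_short) simp
  show ?thesis
    unfolding mcb_proj_boundary_block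
    by (simp only: zero length_map frag_cmul_zero2 sum.neutral_const add_0)
qed

text \<open>Every term loses the block, so that too few blocks are left to survive the projection.\<close>

lemma proj_boundary_block_singleton:
  assumes "length l + length r < n"
  shows "mcb_proj n (boundary_block G M act \<phi> l [x] r) = 0"
proof -
  have "mcb_proj n (frag_of (drop_empty u @ drop_empty v)) = 0"
    if "length u = length l" "length v = length r" for u v
    using that assms length_drop_empty[of u] length_drop_empty[of v] by (simp add: mcb_proj_of)
  from this[of l r] this[of "map (map (\<lambda>y. mcb_under G M act \<phi> y x)) l" "map (map (\<lambda>y. mcb_over act \<phi> y x)) r"]
  show ?thesis
    unfolding mcb_proj_boundary_block by simp
qed

abbreviation singles :: "'a list \<Rightarrow> 'a list list" where
  "singles xs \<equiv> map (\<lambda>x. [x]) xs"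

lemma drop_empty_singles [simp]: "drop_empty (singles xs) = singles xs"
  "drop_empty (map (map h) (singles xs)) = singles (map h xs)"
  by (induction xs) simp_all

lemma map_hd_singles [simp]: "map hd (singles xs) = xs"
  by (simp add: o_def)

lemma proj_boundary_block_singles:
  assumes "length l + length r = n"
  shows "mcb_proj n (boundary_block G M act \<phi> (singles l) [x] (singles r))
    = frag_of (map (\<lambda>y. mcb_under G M act \<phi> y x) l @ map (\<lambda>y. mcb_over act \<phi> y x) r) - frag_of (l @ r)"
  using assms unfolding mcb_proj_boundary_block by (simp add: mcb_proj_of o_def del: map_map)

lemma proj_boundary_block_double:
  assumes "length l + length r + 1 = n"
  shows "mcb_proj n (boundary_block G M act \<phi> (singles l) [x, y] (singles r))
    = frag_of (map (\<lambda>y. mcb_under G M act \<phi> y x) l @ mcb_over act \<phi> (mcb_mult G (mcb_inv G x) y) x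
        # map (\<lambda>y. mcb_over act \<phi> y x) r)
      - frag_of (l @ y # r) + frag_of (l @ x # r)"
proof -
  have "{1..length [x, y]} = {1, 2}"
    by auto
  then show ?thesis
    using assms unfolding mcb_proj_boundary_block by (simp add: mcb_proj_of del: map_map)
qed

context G_Alexander
begin

lemma in_one_group_under:
  assumes "in_one_group G M xs" "x \<in> carrier M \<times> carrier G"
  shows "in_one_group G M (map (\<lambda>y. y \<triangleleft> x) xs)"
proof -
  obtain m where m: "m \<in> carrier M" "set xs \<subseteq> {m} \<times> carrier G"
    using assms(1) by (auto simp: in_one_group_def)
  have "fst ((m, \<one>) \<triangleleft> x) \<in> carrier M"
    using m assms(2) by (auto simp: act_frag_diff)
  moreover have "set (map (\<lambda>y. y \<triangleleft> x) xs) \<subseteq> {fst ((m, \<one>) \<triangleleft> x)} \<times> carrier G"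
    using m assms(2) by (auto simp: mcb_under_def)
  ultimately show ?thesis
    by (auto simp: in_one_group_def)
qed

lemma in_one_group_over:
  assumes "in_one_group G M xs" "x \<in> carrier M \<times> carrier G"
  shows "in_one_group G M (map (\<lambda>y. y \<triangleright> x) xs)"
proof -
  obtain m where m: "m \<in> carrier M" "set xs \<subseteq> {m} \<times> carrier G"
    using assms(1) by (auto simp: in_one_group_def)
  have "m \<cdot> \<phi> (snd x) \<in> carrier M" "set (map (\<lambda>y. y \<triangleright> x) xs) \<subseteq> {m \<cdot> \<phi> (snd x)} \<times> carrier G"
    using m assms(2) by (auto simp: mcb_over_def)
  then show ?thesis
    by (auto simp: in_one_group_def)
qed

lemma in_one_group_quotients:
  assumes "in_one_group G M xs" "xs \<noteq> []"
  shows "in_one_group G M (map (\<lambda>y. mcb_mult G (mcb_inv G (hd xs)) y) (tl xs))"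
proof -
  obtain m where m: "m \<in> carrier M" "set xs \<subseteq> {m} \<times> carrier G"
    using assms(1) by (auto simp: in_one_group_def)
  then have "set (map (\<lambda>y. mcb_mult G (mcb_inv G (hd xs)) y) (tl xs)) \<subseteq> {m} \<times> carrier G"
    using assms(2) by (cases xs) (auto simp: mcb_mult_def mcb_inv_def)
  then show ?thesis
    using m by (auto simp: in_one_group_def)
qed

lemma keys_boundary_block:
  assumes "l @ [xs] @ r \<in> mcb_symbols G M (Suc k)"
  shows "Poly_Mapping.keys (boundary_block G M act \<phi> l xs r) \<subseteq> mcb_symbols G M k"
proof -
  have w: "\<forall>ys\<in>set l. in_one_group G M ys" "\<forall>ys\<in>set r. in_one_group G M ys" "in_one_group G M xs" "xs \<noteq> []"
      "(\<Sum>ys\<leftarrow>l. length ys) + (length xs - 1) + (\<Sum>ys\<leftarrow>r. length ys) = k"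
    using assms by (cases xs; auto simp: mcb_symbols_def)+
  have hd: "hd xs \<in> carrier M \<times> carrier G"
    using w(3,4) by (cases xs) (auto simp: in_one_group_def)
  have len: "(\<Sum>ys\<leftarrow>map (map h) v. length ys) = (\<Sum>ys\<leftarrow>v. length ys)" for h :: "'m \<times> 'g \<Rightarrow> 'm \<times> 'g" and v
    by (simp add: o_def)
  have "drop_empty (map (map (\<lambda>y. y \<triangleleft> hd xs)) l
        @ [map (\<lambda>y. mcb_mult G (mcb_inv G (hd xs)) y \<triangleright> hd xs) (tl xs)]
        @ map (map (\<lambda>y. y \<triangleright> hd xs)) r) \<in> mcb_symbols G M k"
  proof (rule drop_empty_symbol)
    have "in_one_group G M (map (\<lambda>y. mcb_mult G (mcb_inv G (hd xs)) y \<triangleright> hd xs) (tl xs))"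
      using in_one_group_over[OF in_one_group_quotients[OF w(3,4)] hd] by (simp add: o_def)
    then show "\<forall>ys\<in>set (map (map (\<lambda>y. y \<triangleleft> hd xs)) l
        @ [map (\<lambda>y. mcb_mult G (mcb_inv G (hd xs)) y \<triangleright> hd xs) (tl xs)]
        @ map (map (\<lambda>y. y \<triangleright> hd xs)) r). in_one_group G M ys"
      using w in_one_group_under[OF _ hd] in_one_group_over[OF _ hd] by auto
  qed (use w(5) in \<open>simp add: len o_def\<close>)
  moreover have "drop_empty (l @ [take (j - 1) xs @ drop j xs] @ r) \<in> mcb_symbols G M k"
    if "j \<in> {1..length xs}" for j
  proof (rule drop_empty_symbol)
    have "in_one_group G M (take (j - 1) xs @ drop j xs)"
      using w(3) by (rule in_one_group_mono) (use set_take_subset set_drop_subset in fastforce)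
    then show "\<forall>ys\<in>set (l @ [take (j - 1) xs @ drop j xs] @ r). in_one_group G M ys"
      using w by auto
    have "length (take (j - 1) xs @ drop j xs) = length xs - 1"
      using that by auto
    then show "(\<Sum>ys\<leftarrow>l @ [take (j - 1) xs @ drop j xs] @ r. length ys) = k"
      using w(5) by (simp only: map_append sum_list_append list.map sum_list.Cons sum_list.Nil)
  qed
  ultimately show ?thesis
    unfolding boundary_block_def
    by (intro keys_add_subset keys_sum_subset keys_cmul_subset) (auto simp del: drop_empty_append)
qed

lemma keys_mcb_boundary_symbol:
  assumes "w \<in> mcb_symbols G M (Suc k)"
  shows "Poly_Mapping.keys (mcb_boundary_symbol G M act \<phi> w) \<subseteq> mcb_symbols G M k"
  unfolding mcb_boundary_symbol_eq
proof (intro keys_sum_subset keys_cmul_subset keys_boundary_block)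
  fix i assume "i \<in> {..<length w}"
  then show "take i w @ [w ! i] @ drop (Suc i) w \<in> mcb_symbols G M (Suc k)"
    using assms by (simp add: id_take_nth_drop[symmetric])
qed

end

section \<open>The cochain of a cocycle and a homomorphism\<close>

locale cocycle_pairing = G_Alexander G M act \<phi> + A: comm_group A
  for G :: "('g, 'x) monoid_scheme" (structure) and M :: "('m, 'y) ring_scheme"
    and act :: "'m \<Rightarrow> ('g \<Rightarrow>\<^sub>0 int) \<Rightarrow> 'm" and \<phi> :: "'g \<Rightarrow> 'g"
    and A :: "('a, 'z) monoid_scheme" +
  fixes lam :: "'g \<Rightarrow> 'a" and n :: nat and f :: "('m list \<Rightarrow>\<^sub>0 int) set \<Rightarrow> 'a"
  assumes lam_hom: "lam \<in> hom G A" and n: "2 \<le> n"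
    and cocycle: "normalized_group_cocycle G M act n A f"
begin

sublocale gp: presented_group "tuples (carrier M) n"
  "{frag_of (map (\<lambda>m. act m (frag_of g)) ms) - frag_of ms | ms g.
      ms \<in> tuples (carrier M) n \<and> g \<in> carrier G}"
proof
  fix r assume "r \<in> {frag_of (map (\<lambda>m. act m (frag_of g)) ms) - frag_of ms | ms g.
      ms \<in> tuples (carrier M) n \<and> g \<in> carrier G}"
  then obtain ms g where r: "r = frag_of (map (\<lambda>m. act m (frag_of g)) ms) - frag_of ms"
    "ms \<in> tuples (carrier M) n" "g \<in> carrier G"
    by blast
  then have "map (\<lambda>m. act m (frag_of g)) ms \<in> tuples (carrier M) n"
    by (auto simp: tuples_def)
  then show "Poly_Mapping.keys r \<subseteq> tuples (carrier M) n"
    using r keys_diff[of "frag_of (map (\<lambda>m. act m (frag_of g)) ms)" "frag_of ms"] by auto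
qed

lemma gp_rel_eq: "gp_rel G M act n = gp.N"
  by (simp add: gp_rel_def)

lemma gp_C_eq: "gp_C G M act n = gp.F Mod gp.N"
  by (simp add: gp_C_def gp_rel_eq)

lemma gp_class_eq: "gp_class G M act n c = gp.N #>\<^bsub>gp.F\<^esub> c"
  by (simp add: gp_class_def gp_rel_eq)

lemma comm_group_gp_C: "comm_group (gp_C G M act n)"
  unfolding gp_C_eq by (rule gp.comm_group_quotient)

lemma f_hom: "f \<in> hom (gp_C G M act n) A"
  using cocycle by (simp add: normalized_group_cocycle_def)

definition f_value :: "('m list \<Rightarrow>\<^sub>0 int) \<Rightarrow> 'a" where
  "f_value c = f (gp_class G M act n c)"

lemma gp_class_hom: "gp_class G M act n \<in> hom gp.F (gp_C G M act n)"
  using gp.coset_hom unfolding gp_C_eq gp_class_eq[abs_def] .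

lemma f_value_hom: "f_value \<in> hom gp.F A"
  using Group.hom_compose[OF gp_class_hom f_hom] by (simp add: f_value_def[abs_def] o_def)

sublocale f_value: group_hom gp.F A f_value
  using f_value_hom by unfold_locales

abbreviation "relations \<equiv> {c. Poly_Mapping.keys c \<subseteq> tuples (carrier M) n \<and> f_value c = \<one>\<^bsub>A\<^esub>}"

sublocale rel: group_relations G M act \<phi> n relations
proof
  show "2 \<le> n" by (rule n)
  show "0 \<in> relations"
    using f_value.hom_one by simp
  show "a - b \<in> relations" if "a \<in> relations" "b \<in> relations" for a b
  proof -
    have "Poly_Mapping.keys (a - b) \<subseteq> tuples (carrier M) n"
      using that keys_diff[of a b] by blast
    then show ?thesis
      using that by (simp add: hom_free_diff[OF A.is_group f_value_hom])
  qed
  show "frag_of (map (\<lambda>u. act u (frag_of g)) us) - frag_of us \<in> relations"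
    if "us \<in> tuples (carrier M) n" "g \<in> carrier G" for us g
  proof -
    let ?r = "frag_of (map (\<lambda>u. act u (frag_of g)) us) - frag_of us"
    have r: "?r \<in> {frag_of (map (\<lambda>m. act m (frag_of g)) ms) - frag_of ms | ms g.
      ms \<in> tuples (carrier M) n \<and> g \<in> carrier G}"
      using that by blast
    have "gp_class G M act n ?r = \<one>\<^bsub>gp_C G M act n\<^esub>"
      unfolding gp_class_eq gp_C_eq by (rule gp.coset_relator[OF r])
    then show ?thesis
      using gp.relators[OF r] hom_one[OF f_hom comm_group.axioms(2)[OF comm_group_gp_C] A.is_group]
      by (simp add: f_value_def)
  qed
  show "frag_of us \<in> relations" if "us \<in> tuples (carrier M) n" "i < n - 1" "us ! i = \<zero>\<^bsub>M\<^esub>" for us i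
  proof -
    have "Suc i \<in> {1..n - 1}" "us ! (Suc i - 1) = \<zero>\<^bsub>M\<^esub>"
      using that by auto
    then have "gp_class G M act n (frag_of us) \<in> gp_D G M act n"
      unfolding gp_D_def using that(1) by (intro generate.incl) blast
    then show ?thesis
      using cocycle that(1) by (simp add: normalized_group_cocycle_def f_value_def)
  qed
  show "gp_boundary_tuple M us \<in> relations" if "us \<in> tuples (carrier M) (Suc n)" for us
  proof -
    have "f (gp_class G M act n (gp_boundary M (frag_of us))) = \<one>\<^bsub>A\<^esub>"
      using cocycle that by (simp add: normalized_group_cocycle_def)
    then show ?thesis
      using keys_gp_boundary_tuple[OF that] by (simp add: f_value_def gp_boundary_def)
  qed
qed

sublocale pairing: tensor_of_homs "gp_C G M act n" A A A f id
proof -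
  interpret C: comm_group "gp_C G M act n"
    by (rule comm_group_gp_C)
  show "tensor_of_homs (gp_C G M act n) A A A f id"
    using f_hom by unfold_locales (auto simp: hom_def)
qed

abbreviation "elements \<equiv> carrier M \<times> carrier G"

text \<open>\<open>Phi_chain\<close> without the projection: a cochain on \<open>n\<close>-tuples of elements of the biquandle.\<close>

definition BR_cochain :: "(('m \<times> 'g) list \<Rightarrow>\<^sub>0 int) \<Rightarrow> ('a \<times> 'a \<Rightarrow>\<^sub>0 int) set" where
  "BR_cochain = tensor_map A A f id \<circ> psi_lam G M act \<phi> A lam n \<circ> gamma M"

lemma lam_closed [simp]: "g \<in> carrier G \<Longrightarrow> lam g \<in> carrier A"
  using lam_hom by (auto simp: hom_def)

lemma lam_mult: "g \<in> carrier G \<Longrightarrow> h \<in> carrier G \<Longrightarrow> lam (g \<otimes> h) = lam g \<otimes>\<^bsub>A\<^esub> lam h"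
  using lam_hom by (auto simp: hom_def)

lemma lam_conj:
  assumes "g \<in> carrier G" "h \<in> carrier G"
  shows "lam (conj_by h g) = lam g"
proof -
  have "lam h \<otimes>\<^bsub>A\<^esub> lam (conj_by h g) = lam (h \<otimes> conj_by h g)"
    using assms by (simp add: lam_mult)
  also have "h \<otimes> conj_by h g = g \<otimes> h"
    using assms by (simp flip: m_assoc)
  also have "lam (g \<otimes> h) = lam h \<otimes>\<^bsub>A\<^esub> lam g"
    using assms by (simp add: lam_mult A.m_comm)
  finally show ?thesis
    using assms by simp
qed

text \<open>Every \<open>T\<^sub>k\<close> has length \<open>n\<close>, and chains supported on such tuples form a subgroup.\<close>

lemma keys_psi_chain:
  assumes "gs \<in> tuples (carrier G) n" "us \<in> tuples (carrier M) n"
  shows "Poly_Mapping.keys (psi_chain gs us) \<subseteq> tuples (carrier M) n"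
proof -
  have "altsum G (tl gs) (\<lambda>ps. frag_of (twist (\<one> # ps) us)) \<in> {c. Poly_Mapping.keys c \<subseteq> tuples (carrier M) n}"
  proof (rule altsum_closed[OF is_group])
    show "set (tl gs) \<subseteq> carrier G"
      using assms(1) by (cases gs) (auto simp: tuples_def)
    show "frag_of (twist (\<one> # ps) us) \<in> {c. Poly_Mapping.keys c \<subseteq> tuples (carrier M) n}"
      if "ps \<in> tuples (carrier G) (length (tl gs))" for ps
      using that assms n rel.twist_tuple[of "\<one> # ps" us n] by (auto simp: tuples_def)
    show "x - y \<in> {c. Poly_Mapping.keys c \<subseteq> tuples (carrier M) n}"
      if "x \<in> {c. Poly_Mapping.keys c \<subseteq> tuples (carrier M) n}"
        "y \<in> {c. Poly_Mapping.keys c \<subseteq> tuples (carrier M) n}" for x y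
      using that keys_diff[of x y] by blast
  qed
  then show ?thesis
    by (simp add: psi_chain_def)
qed

lemma map_snd_tuple: "xs \<in> tuples elements k \<Longrightarrow> map snd xs \<in> tuples (carrier G) k"
  by (auto simp: tuples_def)

lemma keys_psi_chain_of: "xs \<in> tuples elements n \<Longrightarrow> Poly_Mapping.keys (psi_chain_of xs) \<subseteq> tuples (carrier M) n"
  unfolding psi_chain_of_def by (intro keys_psi_chain map_snd_tuple rel.differences_to_tuple)

lemma differences_tuple:
  assumes "xs \<in> tuples elements n"
  shows "differences M (map fst xs) = differences_to M (map fst xs) \<zero>\<^bsub>M\<^esub>"
  using assms by (intro M.differences_eq_differences_to) (auto simp: tuples_def)

abbreviation "psi_value \<equiv> \<lambda>(gs, us). pure_tensor (gp_C G M act n) A (psi G M act \<phi> n gs us) (lam (hd gs))"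

lemma psi_closed:
  assumes "gs \<in> tuples (carrier G) n" "us \<in> tuples (carrier M) n"
  shows "psi G M act \<phi> n gs us \<in> carrier (gp_C G M act n)"
proof -
  have "psi G M act \<phi> n gs us = gp_class G M act n (psi_chain gs us)"
    using assms n by (intro psi_eq_chain) auto
  then show ?thesis
    using keys_psi_chain[OF assms] hom_in_carrier[OF gp_class_hom] by simp
qed

lemma lam_hd_closed: "gs \<in> tuples (carrier G) n \<Longrightarrow> lam (hd gs) \<in> carrier A"
  using n by (cases gs) (auto simp: tuples_def)

lemma psi_value_closed: "psi_value \<in> tuples (carrier G) n \<times> tuples (carrier M) n \<rightarrow> carrier (tensor (gp_C G M act n) A)"
  by (auto intro!: pairing.source.pure_tensor_closed psi_closed lam_hd_closed)

lemma gamma_hom: "gamma M \<in> hom (free_Abelian_group (tuples elements n)) (free_Abelian_group (tuples (carrier G) n \<times> tuples (carrier M) n))"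
  unfolding gamma_def
proof (rule frag_extend_hom)
  fix xs assume "xs \<in> tuples elements n"
  then show "Poly_Mapping.keys (frag_of (map snd xs, differences M (map fst xs))) \<subseteq> tuples (carrier G) n \<times> tuples (carrier M) n"
    using map_snd_tuple rel.differences_to_tuple differences_tuple by simp
qed

lemma BR_cochain_hom: "BR_cochain \<in> hom (free_Abelian_group (tuples elements n)) (tensor A A)"
  unfolding BR_cochain_def psi_lam_def comp_assoc
  by (rule Group.hom_compose[OF Group.hom_compose[OF gamma_hom free_lift_hom[OF pairing.source.comm_group_tensor psi_value_closed]]
        pairing.tensor_map_hom, unfolded comp_assoc])

lemma BR_cochain_of:
  assumes "xs \<in> tuples elements n"
  shows "BR_cochain (frag_of xs) = pure_tensor A A (f_value (psi_chain_of xs)) (lam (snd (hd xs)))"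
proof -
  let ?gs = "map snd xs" and ?us = "differences_to M (map fst xs) \<zero>\<^bsub>M\<^esub>"
  have t: "?gs \<in> tuples (carrier G) n" "?us \<in> tuples (carrier M) n"
    using assms map_snd_tuple rel.differences_to_tuple by auto
  have "xs \<noteq> []"
    using assms n by (auto simp: tuples_def)
  then have hd: "hd ?gs = snd (hd xs)"
    by (simp add: hd_map)
  have "psi_lam G M act \<phi> A lam n (gamma M (frag_of xs)) = psi_value (?gs, ?us)"
    unfolding psi_lam_def gamma_def frag_extend_of differences_tuple[OF assms]
    using psi_value_closed t by (intro free_lift_frag_of[OF pairing.source.comm_group_tensor]) blast
  then have "BR_cochain (frag_of xs) = pure_tensor A A (f (psi G M act \<phi> n ?gs ?us)) (id (lam (snd (hd xs))))"
    unfolding BR_cochain_def comp_def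
    using psi_closed[OF t] lam_hd_closed[OF t(1)] by (simp add: pairing.tensor_map_pure hd)
  then show ?thesis
    using psi_eq_chain[OF t] n by (simp add: f_value_def psi_chain_of_def)
qed

lemma Phi_chain_eq: "Phi_chain G M act \<phi> A lam n f c = BR_cochain (mcb_proj n c)"
  by (simp add: Phi_chain_def BR_cochain_def)

lemma pure_tensor_closed: "x \<in> carrier A \<Longrightarrow> y \<in> carrier A \<Longrightarrow> pure_tensor A A x y \<in> carrier (tensor A A)"
  by (rule pairing.target.pure_tensor_closed)

lemma f_value_closed: "xs \<in> tuples elements n \<Longrightarrow> f_value (psi_chain_of xs) \<in> carrier A"
  using f_value.hom_closed keys_psi_chain_of by simp

text \<open>If all tuples in \<open>c\<close> have the same label \<open>lam g\<^sub>1\<close>, it can be pulled out of the sum, and the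
value on \<open>c\<close> is governed by the chain \<open>frag_extend psi_chain_of c\<close> alone. This reduces the tensor-valued
identities to relations between chains.\<close>

lemma BR_cochain_common_label:
  assumes a: "a \<in> carrier A"
    and keys: "Poly_Mapping.keys c \<subseteq> {xs \<in> tuples elements n. lam (snd (hd xs)) = a}"
  shows "BR_cochain c = pure_tensor A A (f_value (frag_extend psi_chain_of c)) a"
proof -
  let ?S = "{xs \<in> tuples elements n. lam (snd (hd xs)) = a}"
  have "frag_extend psi_chain_of \<in> hom (free_Abelian_group ?S) gp.F"
    using keys_psi_chain_of by (intro frag_extend_hom) auto
  from Group.hom_compose[OF Group.hom_compose[OF this f_value_hom] pairing.target.pure_tensor_hom_left[OF a]]
  have rhs: "(\<lambda>c. pure_tensor A A (f_value (frag_extend psi_chain_of c)) a) \<in> hom (free_Abelian_group ?S) (tensor A A)"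
    by (simp add: o_def)
  have lhs: "BR_cochain \<in> hom (free_Abelian_group ?S) (tensor A A)"
    by (rule hom_free_mono[OF BR_cochain_hom]) blast
  show ?thesis
  proof (rule hom_free_eqI[OF pairing.target.tensor.is_group lhs rhs _ keys])
    fix xs assume "xs \<in> ?S"
    then show "BR_cochain (frag_of xs) = pure_tensor A A (f_value (frag_extend psi_chain_of (frag_of xs))) a"
      using BR_cochain_of[of xs] by simp
  qed
qed

lemma BR_cochain_relation:
  assumes "a \<in> carrier A" "Poly_Mapping.keys c \<subseteq> {xs \<in> tuples elements n. lam (snd (hd xs)) = a}"
    and "frag_extend psi_chain_of c \<in> relations"
  shows "BR_cochain c = \<one>\<^bsub>tensor A A\<^esub>"
  using assms BR_cochain_common_label[OF assms(1,2)] pairing.target.pure_tensor_one_left by simp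

lemma BR_cochain_add:
  "Poly_Mapping.keys c \<subseteq> tuples elements n \<Longrightarrow> Poly_Mapping.keys d \<subseteq> tuples elements n
    \<Longrightarrow> BR_cochain (c + d) = BR_cochain c \<otimes>\<^bsub>tensor A A\<^esub> BR_cochain d"
  using hom_mult[OF BR_cochain_hom, of c d] by simp

section \<open>Descent to the quotient\<close>

lemma symbol_heads:
  assumes "w \<in> mcb_symbols G M k"
  shows "map hd w \<in> tuples elements (length w)"
proof -
  have "hd xs \<in> elements" if xs: "xs \<in> set w" for xs
  proof -
    obtain m where "m \<in> carrier M" "set xs \<subseteq> {m} \<times> carrier G" "xs \<noteq> []"
      using xs assms by (auto simp: mcb_symbols_def in_one_group_def)
    then show ?thesis
      using subsetD[OF _ hd_in_set[of xs], of "{m} \<times> carrier G"] by (auto simp: mem_Times_iff)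
  qed
  then show ?thesis
    by (simp add: tuples_def image_subset_iff)
qed

lemma Phi_chain_hom: "Phi_chain G M act \<phi> A lam n f \<in> hom (mcb_P G M k) (tensor A A)"
proof -
  have "mcb_proj n \<in> hom (mcb_P G M k) (free_Abelian_group (tuples elements n))"
    unfolding mcb_proj_def mcb_P_def
  proof (rule frag_extend_hom)
    fix w assume "w \<in> mcb_symbols G M k"
    then show "Poly_Mapping.keys (if length w = n then frag_of (map hd w) else 0) \<subseteq> tuples elements n"
      using symbol_heads[of w k] by auto
  qed
  from Group.hom_compose[OF this BR_cochain_hom] show ?thesis
    by (simp add: o_def Phi_chain_eq[abs_def])
qed

lemma BR_cochain_0: "BR_cochain 0 = \<one>\<^bsub>tensor A A\<^esub>"
  using hom_one[OF BR_cochain_hom _ pairing.target.tensor.is_group] by simp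

abbreviation "shuffle_relators \<equiv> {frag_of (u @ [as, bs] @ v)
       - frag_extend (\<lambda>cs. frag_of (u @ [cs] @ v)) (mcb_shuffle G as bs) | u as bs v.
     u @ [as, bs] @ v \<in> mcb_symbols G M n \<and> in_one_group G M (as @ bs)}"

lemma keys_shuffle_relator:
  assumes "u @ [as, bs] @ v \<in> mcb_symbols G M n" "in_one_group G M (as @ bs)"
  shows "Poly_Mapping.keys (frag_of (u @ [as, bs] @ v)
    - frag_extend (\<lambda>cs. frag_of (u @ [cs] @ v)) (mcb_shuffle G as bs)) \<subseteq> mcb_symbols G M n"
proof -
  have ne: "as \<noteq> []" "bs \<noteq> []"
    using assms(1) by (auto simp: mcb_symbols_def)
  have "u @ [cs] @ v \<in> mcb_symbols G M n" if "cs \<in> Poly_Mapping.keys (mcb_shuffle G as bs)" for cs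
    using shuffle_keys[OF is_group ne assms(2) that] assms(1) ne
    by (auto simp: mcb_symbols_def)
  then have "Poly_Mapping.keys (frag_extend (\<lambda>cs. frag_of (u @ [cs] @ v)) (mcb_shuffle G as bs)) \<subseteq> mcb_symbols G M n"
    by (intro order_trans[OF keys_frag_extend]) auto
  then show ?thesis
    using keys_diff[of "frag_of (u @ [as, bs] @ v)" "frag_extend (\<lambda>cs. frag_of (u @ [cs] @ v)) (mcb_shuffle G as bs)"] assms(1)
    by auto
qed

sublocale mcb: presented_group "mcb_symbols G M n" shuffle_relators
  using keys_shuffle_relator by unfold_locales blast

lemma mcb_P_eq: "mcb_P G M n = mcb.F"
  by (simp add: mcb_P_def)

lemma mcb_D_eq: "mcb_D G M n = mcb.N"
  by (simp add: mcb_D_def mcb_P_eq)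

lemma mcb_C_eq: "mcb_C G M n = mcb.F Mod mcb.N"
  by (simp add: mcb_C_def mcb_P_eq mcb_D_eq)

lemma Phi_chain_shuffle:
  assumes "r \<in> shuffle_relators"
  shows "Phi_chain G M act \<phi> A lam n f r = \<one>\<^bsub>tensor A A\<^esub>"
proof -
  obtain u as bs v where r: "r = frag_of (u @ [as, bs] @ v)
       - frag_extend (\<lambda>cs. frag_of (u @ [cs] @ v)) (mcb_shuffle G as bs)"
    and w: "u @ [as, bs] @ v \<in> mcb_symbols G M n" and m: "in_one_group G M (as @ bs)"
    using assms by blast
  have ne: "as \<noteq> []" "bs \<noteq> []"
    using w by (auto simp: mcb_symbols_def)
  have len: "length (u @ [as, bs] @ v) \<le> n"
    using w length_le_total[of "u @ [as, bs] @ v"] unfolding mcb_symbols_def by simp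
  have compose: "(\<lambda>cs. frag_of (u @ [cs] @ v)) = frag_of \<circ> (\<lambda>cs. u @ [cs] @ v)"
    by (simp add: o_def)
  have "mcb_proj n (frag_extend (\<lambda>cs. frag_of (u @ [cs] @ v)) c) = 0" for c
    unfolding mcb_proj_def compose frag_extend_compose using len by (intro frag_extend_eq_0) simp
  then have proj: "mcb_proj n r = mcb_proj n (frag_of (u @ [as, bs] @ v))"
    unfolding r mcb_proj_def frag_extend_diff by simp
  show ?thesis
  proof (cases "length (u @ [as, bs] @ v) = n")
    case False
    then show ?thesis
      unfolding Phi_chain_eq proj mcb_proj_of using BR_cochain_0 by simp
  next
    case True
    let ?xs = "map hd (u @ [as, bs] @ v)"
    have xs: "?xs \<in> tuples elements n"
      using symbol_heads[OF w] True by simp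
    have "fst (hd as) = fst (hd bs)"
      using m ne by (cases as; cases bs) (auto simp: in_one_group_def)
    then have "psi_chain_of ?xs \<in> relations"
      using xs True by (intro rel.psi_chain_of_same_group[of _ "length u"]) (auto simp: nth_append)
    then have "BR_cochain (frag_of ?xs) = \<one>\<^bsub>tensor A A\<^esub>"
      using xs n by (intro BR_cochain_relation[of "lam (snd (hd ?xs))"]) (cases u; auto simp: tuples_def)+
    then show ?thesis
      unfolding Phi_chain_eq proj mcb_proj_of using True by simp
  qed
qed

section \<open>Vanishing on boundaries\<close>

lemma under_closed [simp]: "y \<in> elements \<Longrightarrow> x \<in> elements \<Longrightarrow> y \<triangleleft> x \<in> elements"
  by (auto simp: mcb_under_def act_frag_diff)

lemma over_closed [simp]: "y \<in> elements \<Longrightarrow> x \<in> elements \<Longrightarrow> y \<triangleright> x \<in> elements"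
  by (auto simp: mcb_over_def)

lemma under_subset:
  assumes "set ys \<subseteq> elements" "x \<in> elements"
  shows "(\<lambda>y. y \<triangleleft> x) ` set ys \<subseteq> elements"
  by (rule image_subsetI) (rule under_closed[OF subsetD[OF assms(1)] assms(2)])

lemma over_subset:
  assumes "set ys \<subseteq> elements" "x \<in> elements"
  shows "(\<lambda>y. y \<triangleright> x) ` set ys \<subseteq> elements"
  by (rule image_subsetI) (rule over_closed[OF subsetD[OF assms(1)] assms(2)])

lemma face_tuple:
  assumes "xs \<in> tuples elements (Suc n)" "i \<le> n"
  shows "rel.face i xs \<in> tuples elements n" "rel.remove_nth i xs \<in> tuples elements n"
proof -
  have len: "length xs = Suc n" and xs: "set xs \<subseteq> elements"
    using assms(1) by (auto simp: tuples_def)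
  have x: "xs ! i \<in> elements"
    using subsetD[OF xs nth_mem[of i xs]] assms(2) len by simp
  have l: "set (take i xs) \<subseteq> elements" and r: "set (drop (Suc i) xs) \<subseteq> elements"
    using order_trans[OF set_take_subset xs] order_trans[OF set_drop_subset xs] by blast+
  show "rel.face i xs \<in> tuples elements n"
    using assms(2) len under_subset[OF l x] over_subset[OF r x] by (simp add: rel.face_def tuples_def)
  show "rel.remove_nth i xs \<in> tuples elements n"
    using assms(2) len l r by (simp add: rel.remove_nth_def tuples_def)
qed

text \<open>The first position has to be treated apart, since its faces lose \<open>g\<^sub>1\<close> and so carry the
label \<open>lam g\<^sub>2\<close>. All other faces carry \<open>lam g\<^sub>1\<close>, up to conjugation.\<close>

lemma BR_cochain_boundary_singles:
  assumes xs: "xs \<in> tuples elements (Suc n)"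
  shows "BR_cochain (\<Sum>i<Suc n. frag_cmul ((-1) ^ i) (frag_of (rel.face i xs) - frag_of (rel.remove_nth i xs))) = \<one>\<^bsub>tensor A A\<^esub>"
proof -
  let ?t = "\<lambda>i. frag_cmul ((-1) ^ i) (frag_of (rel.face i xs) - frag_of (rel.remove_nth i xs))"
  obtain x y r where x: "xs = x # y # r"
    using xs n by (cases xs; cases "tl xs") (auto simp: tuples_def)
  have elements: "x \<in> elements" "y \<in> elements"
    using xs x by (auto simp: tuples_def)
  have keys: "Poly_Mapping.keys (?t i) \<subseteq> {rel.face i xs, rel.remove_nth i xs}" for i
    using keys_diff[of "frag_of (rel.face i xs)" "frag_of (rel.remove_nth i xs)"] by (intro keys_cmul_subset) auto
  have first: "BR_cochain (?t 0) = \<one>\<^bsub>tensor A A\<^esub>"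
  proof (rule BR_cochain_relation)
    show "lam (snd y) \<in> carrier A"
      using elements by auto
    show "Poly_Mapping.keys (?t 0) \<subseteq> {xs \<in> tuples elements n. lam (snd (hd xs)) = lam (snd y)}"
      using keys[of 0] face_tuple[OF xs, of 0] by (auto simp: x rel.face_def rel.remove_nth_def)
    show "frag_extend psi_chain_of (?t 0) \<in> relations"
      using rel.psi_chain_of_first_faces[OF xs] by (simp add: frag_extend_diff)
  qed
  have keys_rest: "Poly_Mapping.keys (\<Sum>i = 1..n. ?t i) \<subseteq> {xs \<in> tuples elements n. lam (snd (hd xs)) = lam (snd x)}"
  proof (rule keys_sum_subset)
    fix i assume i: "i \<in> {1..n}"
    have "length xs = Suc n" "xs ! i \<in> elements"
      using xs i nth_mem[of i xs] by (auto simp: tuples_def simp del: mem_Sigma_iff)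
    then have "snd (hd (rel.face i xs)) = conj_by (snd (xs ! i)) (snd x)" "hd (rel.remove_nth i xs) = x"
        "snd (xs ! i) \<in> carrier G"
      using i by (auto simp: x rel.face_def rel.remove_nth_def take_Cons')
    then show "Poly_Mapping.keys (?t i) \<subseteq> {xs \<in> tuples elements n. lam (snd (hd xs)) = lam (snd x)}"
      using keys[of i] face_tuple[OF xs, of i] i elements lam_conj[of "snd x" "snd (xs ! i)"] by auto
  qed
  have rest: "BR_cochain (\<Sum>i = 1..n. ?t i) = \<one>\<^bsub>tensor A A\<^esub>"
  proof (rule BR_cochain_relation[OF _ keys_rest])
    show "lam (snd x) \<in> carrier A"
      using elements by auto
    have "frag_extend psi_chain_of (\<Sum>i = 1..n. ?t i)
      = (\<Sum>i = 1..n. frag_cmul ((-1) ^ i) (psi_chain_of (rel.face i xs) - psi_chain_of (rel.remove_nth i xs)))"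
      by (simp add: frag_extend_sum frag_extend_cmul frag_extend_diff o_def)
    then show "frag_extend psi_chain_of (\<Sum>i = 1..n. ?t i) \<in> relations"
      using rel.psi_chain_of_faces[OF xs] by simp
  qed
  have "(\<Sum>i<Suc n. ?t i) = ?t 0 + (\<Sum>i = 1..n. ?t i)"
    by (simp add: sum.lessThan_Suc_shift sum.atLeast1_atMost_eq del: sum.lessThan_Suc)
  moreover have "BR_cochain (?t 0 + (\<Sum>i = 1..n. ?t i)) = BR_cochain (?t 0) \<otimes>\<^bsub>tensor A A\<^esub> BR_cochain (\<Sum>i = 1..n. ?t i)"
    using keys[of 0] face_tuple[OF xs, of 0] keys_rest by (intro BR_cochain_add) auto
  ultimately show ?thesis
    by (simp only: first rest pairing.target.tensor.one_closed pairing.target.tensor.l_one)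
qed

text \<open>The three tuples have different labels, but \<open>f\<close> takes one value on their chains: these do
not involve the first group component, and the first chain differs from the others by the action
of \<open>\<phi> g\<close>. So the additivity of \<open>lam\<close> decides.\<close>

lemma BR_cochain_boundary_double_first:
  assumes r: "r \<in> tuples elements (n - 1)" and m: "m \<in> carrier M" "g \<in> carrier G" "h \<in> carrier G"
  shows "BR_cochain (frag_of ((m \<cdot> \<phi> g, inv g \<otimes> h) # map (\<lambda>y. y \<triangleright> (m, g)) r)
    - frag_of ((m, h) # r) + frag_of ((m, g) # r)) = \<one>\<^bsub>tensor A A\<^esub>"
proof -
  let ?T = "tensor A A"
  let ?x = "(m \<cdot> \<phi> g, inv g \<otimes> h) # map (\<lambda>y. y \<triangleright> (m, g)) r"
  have ts: "(m, k) # r \<in> tuples elements n" if "k \<in> carrier G" for k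
    using r m n that by (auto simp: tuples_def)
  have tx: "?x \<in> tuples elements n"
  proof -
    have "set r \<subseteq> elements" "length r = n - 1"
      using r by (auto simp: tuples_def)
    moreover from this have "(\<lambda>y. y \<triangleright> (m, g)) ` set r \<subseteq> elements"
      using m by (intro over_subset) auto
    ultimately show ?thesis
      using m n by (simp add: tuples_def)
  qed
  let ?c = "f_value (psi_chain_of ((m, g) # r))"
  have c: "?c \<in> carrier A"
    using f_value_closed[OF ts[OF m(2)]] .
  have "psi_chain_of ?x - psi_chain_of ((m, inv g \<otimes> h) # r) \<in> relations"
    using m by (intro rel.psi_chain_of_over[OF ts, of _ g]) auto
  then have "f_value (psi_chain_of ?x) = f_value (psi_chain_of ((m, inv g \<otimes> h) # r))"
    using hom_free_diff[OF A.is_group f_value_hom keys_psi_chain_of[OF tx] keys_psi_chain_of[OF ts, of "inv g \<otimes> h"]]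
      f_value_closed[OF tx] f_value_closed[OF ts, of "inv g \<otimes> h"] m by (simp add: A.inv_solve_right')
  also have "\<dots> = ?c"
    by (rule arg_cong[OF rel.psi_chain_of_change_first])
  finally have x: "BR_cochain (frag_of ?x) = pure_tensor A A ?c (lam (inv g \<otimes> h))"
    using BR_cochain_of[OF tx] by simp
  have y: "BR_cochain (frag_of ((m, k) # r)) = pure_tensor A A ?c (lam k)" if "k \<in> carrier G" for k
    using BR_cochain_of[OF ts[OF that]] rel.psi_chain_of_change_first[of m k r g] by (simp only: list.sel snd_conv)
  let ?p = "pure_tensor A A ?c (lam (inv g \<otimes> h))" and ?q = "pure_tensor A A ?c (lam g)"
  have pq: "?p \<in> carrier ?T" "?q \<in> carrier ?T"
    using c m by (auto intro!: pure_tensor_closed)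
  have "lam h = lam (inv g \<otimes> h) \<otimes>\<^bsub>A\<^esub> lam g"
  proof -
    have "lam (g \<otimes> (inv g \<otimes> h)) = lam (inv g \<otimes> h) \<otimes>\<^bsub>A\<^esub> lam g"
      using m by (intro trans[OF lam_mult A.m_comm]) auto
    then show ?thesis
      using m by (simp flip: m_assoc)
  qed
  then have h: "pure_tensor A A ?c (lam h) = ?p \<otimes>\<^bsub>?T\<^esub> ?q"
    using c m by (simp add: pairing.target.pure_tensor_mult_right)
  have k1: "Poly_Mapping.keys (frag_of ?x - frag_of ((m, h) # r)) \<subseteq> tuples elements n"
    using keys_diff[of "frag_of ?x" "frag_of ((m, h) # r)"] tx ts[OF m(3)] by auto
  have "BR_cochain (frag_of ?x - frag_of ((m, h) # r) + frag_of ((m, g) # r))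
      = ?p \<otimes>\<^bsub>?T\<^esub> inv\<^bsub>?T\<^esub> (?p \<otimes>\<^bsub>?T\<^esub> ?q) \<otimes>\<^bsub>?T\<^esub> ?q"
    using tx ts m k1 hom_free_diff[OF pairing.target.tensor.is_group BR_cochain_hom, of "frag_of ?x" "frag_of ((m, h) # r)"]
    by (simp add: BR_cochain_add x y h)
  also have "\<dots> = \<one>\<^bsub>?T\<^esub>"
  proof -
    have "?p \<otimes>\<^bsub>?T\<^esub> inv\<^bsub>?T\<^esub> (?p \<otimes>\<^bsub>?T\<^esub> ?q) \<otimes>\<^bsub>?T\<^esub> ?q = ?p \<otimes>\<^bsub>?T\<^esub> ?q \<otimes>\<^bsub>?T\<^esub> inv\<^bsub>?T\<^esub> (?p \<otimes>\<^bsub>?T\<^esub> ?q)"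
      using pq by (simp only: pairing.target.tensor.m_assoc pairing.target.tensor.m_closed pairing.target.tensor.inv_closed
         pairing.target.tensor.m_comm[of "inv\<^bsub>?T\<^esub> (?p \<otimes>\<^bsub>?T\<^esub> ?q)" ?q])
    then show ?thesis
      using pq by simp
  qed
  finally show ?thesis .
qed

lemma BR_cochain_boundary_double:
  assumes l: "set l \<subseteq> elements" and r: "set r \<subseteq> elements" and len: "length l + length r + 1 = n"
    and m: "m \<in> carrier M" "g \<in> carrier G" "h \<in> carrier G"
  shows "BR_cochain (frag_cmul ((-1) ^ length l) (frag_of (map (\<lambda>y. y \<triangleleft> (m, g)) l @ (m \<cdot> \<phi> g, inv g \<otimes> h) # map (\<lambda>y. y \<triangleright> (m, g)) r)
    - frag_of (l @ (m, h) # r) + frag_of (l @ (m, g) # r))) = \<one>\<^bsub>tensor A A\<^esub>"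
proof (cases l)
  case Nil
  then show ?thesis
    using BR_cochain_boundary_double_first[of r m g h] r len m by (auto simp: tuples_def)
next
  case (Cons x l')
  let ?x = "map (\<lambda>y. y \<triangleleft> (m, g)) l @ (m \<cdot> \<phi> g, inv g \<otimes> h) # map (\<lambda>y. y \<triangleright> (m, g)) r"
  let ?c = "frag_of ?x - frag_of (l @ (m, h) # r) + frag_of (l @ (m, g) # r)"
  have x: "x \<in> elements"
    using l Cons by simp
  have xg: "(m, g) \<in> elements" "(m \<cdot> \<phi> g, inv g \<otimes> h) \<in> elements"
    using m by auto
  have tx: "?x \<in> tuples elements n"
    using len xg under_subset[OF l xg(1)] over_subset[OF r xg(1)] by (simp add: tuples_def)
  have ts: "l @ (m, k) # r \<in> tuples elements n" if "k \<in> carrier G" for k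
    using l r len m that by (auto simp: tuples_def)
  have "Poly_Mapping.keys ?c \<subseteq> {?x, l @ (m, h) # r, l @ (m, g) # r}"
    using keys_diff[of "frag_of ?x" "frag_of (l @ (m, h) # r)"] by (intro keys_add_subset) auto
  moreover have "lam (snd (hd ?x)) = lam (snd x)"
    using x m lam_conj[of "snd x" g] by (auto simp: Cons)
  moreover have "hd (l @ (m, k) # r) = x" for k
    by (simp add: Cons)
  ultimately have keys: "Poly_Mapping.keys (frag_cmul ((-1) ^ length l) ?c) \<subseteq> {xs \<in> tuples elements n. lam (snd (hd xs)) = lam (snd x)}"
    using tx ts m by (intro keys_cmul_subset) auto
  show ?thesis
  proof (rule BR_cochain_relation[OF _ keys])
    show "lam (snd x) \<in> carrier A"
      using x by auto
    have "frag_extend psi_chain_of ?c = 0"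
      using rel.psi_chain_of_block[OF l r m] Cons by (simp add: frag_extend_diff frag_extend_add del: map_append list.map)
    then show "frag_extend psi_chain_of (frag_cmul ((-1) ^ length l) ?c) \<in> relations"
      using rel.K_zero by (simp only: frag_extend_cmul frag_cmul_zero2)
  qed
qed

lemma mcb_proj_boundary_symbol:
  "mcb_proj n (mcb_boundary_symbol G M act \<phi> w) = (\<Sum>i < length w.
    frag_cmul ((-1) ^ (\<Sum>xs\<leftarrow>take i w. length xs))
      (mcb_proj n (boundary_block G M act \<phi> (take i w) (w ! i) (drop (Suc i) w))))"
  unfolding mcb_boundary_symbol_eq mcb_proj_def by (simp add: frag_extend_sum frag_extend_cmul o_def)

text \<open>A surviving term has \<open>n\<close> blocks of length one. Each term of the boundary has at most as many
blocks as \<open>w\<close>, and \<open>w\<close> has at most \<open>n + 1\<close>, so \<open>w\<close> has \<open>n\<close> or \<open>n + 1\<close> blocks of total length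
\<open>n + 1\<close>.\<close>

lemma Phi_chain_boundary:
  assumes w: "w \<in> mcb_symbols G M (Suc n)"
  shows "Phi_chain G M act \<phi> A lam n f (mcb_boundary_symbol G M act \<phi> w) = \<one>\<^bsub>tensor A A\<^esub>"
proof -
  have ne: "\<forall>xs\<in>set w. xs \<noteq> []" and total: "(\<Sum>xs\<leftarrow>w. length xs) = Suc n"
    and groups: "\<forall>xs\<in>set w. in_one_group G M xs"
    using w by (auto simp: mcb_symbols_def)
  have "length w \<le> Suc n"
    using length_le_total[OF ne] total by simp
  then consider (few) "length w < n" | (double) "length w = n" | (singles) "length w = Suc n"
    by linarith
  then show ?thesis
  proof cases
    case few
    then have "mcb_proj n (boundary_block G M act \<phi> (take i w) (w ! i) (drop (Suc i) w)) = 0" if "i < length w" for i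
      using that by (intro proj_boundary_block_few) simp
    then have "mcb_proj n (mcb_boundary_symbol G M act \<phi> w) = 0"
      unfolding mcb_proj_boundary_symbol by (intro sum.neutral) simp
    then show ?thesis
      by (simp add: Phi_chain_eq BR_cochain_0)
  next
    case double
    then obtain l x y r where lr: "w = singles l @ [[x, y]] @ singles r"
      using total_almost_minimal[OF ne] total by auto
    obtain m g h where xy: "x = (m, g)" "y = (m, h)" "m \<in> carrier M" "g \<in> carrier G" "h \<in> carrier G"
      using groups lr by (auto simp: in_one_group_def)
    have elements: "set l \<subseteq> elements" "set r \<subseteq> elements"
      using symbol_heads[OF w] by (simp_all add: lr tuples_def o_def)
    have len: "length l + length r + 1 = n"
      using double lr by simp
    let ?b = "\<lambda>i. frag_cmul ((-1) ^ (\<Sum>xs\<leftarrow>take i w. length xs))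
      (mcb_proj n (boundary_block G M act \<phi> (take i w) (w ! i) (drop (Suc i) w)))"
    \<comment> \<open>Only the block of length two contributes; its index is \<open>length l\<close>.\<close>
    have "?b i = 0" if "i \<in> {..<length w} - {length l}" for i
    proof -
      have "w ! i = [if i < length l then l ! i else r ! (i - length l - 1)]"
        using that by (auto simp: lr nth_append nth_Cons')
      moreover have "length (take i w) + length (drop (Suc i) w) < n"
        using that double by auto
      ultimately show ?thesis
        by (simp add: proj_boundary_block_singleton)
    qed
    then have "(\<Sum>i < length w. ?b i) = ?b (length l)"
      using sum.remove[of "{..<length w}" "length l" ?b] by (simp add: lr)
    also have "\<dots> = frag_cmul ((-1) ^ length l) (mcb_proj n (boundary_block G M act \<phi> (singles l) [x, y] (singles r)))"
      by (simp add: lr o_def sum_list_triv nth_append)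
    finally show ?thesis
      using BR_cochain_boundary_double[OF elements len xy(3-5)]
      unfolding Phi_chain_eq mcb_proj_boundary_symbol proj_boundary_block_double[OF len]
      by (simp add: xy mcb_over_def mcb_mult_def mcb_inv_def)
  next
    case singles
    define xs where "xs = map hd w"
    have w': "w = singles xs"
      using total_minimal[OF ne] total singles by (simp add: xs_def)
    have xs: "xs \<in> tuples elements (Suc n)"
      using symbol_heads[OF w] singles by (simp add: xs_def)
    then have len: "length xs = Suc n"
      by (simp add: tuples_def)
    have "mcb_proj n (mcb_boundary_symbol G M act \<phi> w)
      = (\<Sum>i<Suc n. frag_cmul ((-1) ^ i) (frag_of (rel.face i xs) - frag_of (rel.remove_nth i xs)))"
      unfolding mcb_proj_boundary_symbol singles
    proof (rule sum.cong[OF refl])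
      fix i assume "i \<in> {..<Suc n}"
      then have i: "i < length xs"
        by (simp add: len)
      have "mcb_proj n (boundary_block G M act \<phi> (singles (take i xs)) [xs ! i] (singles (drop (Suc i) xs)))
        = frag_of (rel.face i xs) - frag_of (rel.remove_nth i xs)"
        using i len unfolding rel.face_def rel.remove_nth_def by (intro proj_boundary_block_singles) simp
      then show "frag_cmul ((-1) ^ (\<Sum>xs\<leftarrow>take i w. length xs))
          (mcb_proj n (boundary_block G M act \<phi> (take i w) (w ! i) (drop (Suc i) w)))
        = frag_cmul ((-1) ^ i) (frag_of (rel.face i xs) - frag_of (rel.remove_nth i xs))"
        using i by (simp add: w' take_map drop_map o_def sum_list_triv)
    qed
    then show ?thesis
      using BR_cochain_boundary_singles[OF xs] by (simp add: Phi_chain_eq)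
  qed
qed

lemma keys_mcb_boundary:
  assumes "Poly_Mapping.keys c \<subseteq> mcb_symbols G M (Suc k)"
  shows "Poly_Mapping.keys (mcb_boundary G M act \<phi> c) \<subseteq> mcb_symbols G M k"
  unfolding mcb_boundary_def
  using assms keys_mcb_boundary_symbol by (intro order_trans[OF keys_frag_extend]) blast

lemma Phi_chain_mcb_boundary:
  assumes "Poly_Mapping.keys c \<subseteq> mcb_symbols G M (Suc n)"
  shows "Phi_chain G M act \<phi> A lam n f (mcb_boundary G M act \<phi> c) = \<one>\<^bsub>tensor A A\<^esub>"
proof -
  let ?S = "mcb_symbols G M (Suc n)"
  have "mcb_boundary G M act \<phi> \<in> hom (free_Abelian_group ?S) (mcb_P G M n)"
    unfolding mcb_boundary_def mcb_P_def by (intro frag_extend_hom keys_mcb_boundary_symbol)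
  from Group.hom_compose[OF this Phi_chain_hom]
  have "(\<lambda>c. Phi_chain G M act \<phi> A lam n f (mcb_boundary G M act \<phi> c)) \<in> hom (free_Abelian_group ?S) (tensor A A)"
    by (simp add: o_def)
  moreover have "(\<lambda>c. \<one>\<^bsub>tensor A A\<^esub>) \<in> hom (free_Abelian_group ?S) (tensor A A)"
    by (rule homI) simp_all
  ultimately show ?thesis
    by (rule hom_free_eqI[OF pairing.target.tensor.is_group _ _ _ assms])
      (simp add: mcb_boundary_def Phi_chain_boundary)
qed

lemma Phi_chain_hom_F: "Phi_chain G M act \<phi> A lam n f \<in> hom mcb.F (tensor A A)"
  using Phi_chain_hom[of n] unfolding mcb_P_eq .

lemma Phi_on_coset:
  assumes "K \<in> carrier (mcb_C G M n)" "c \<in> K"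
  shows "Phi G M act \<phi> A lam n f K = Phi_chain G M act \<phi> A lam n f c"
  unfolding Phi_def
  by (rule mcb.induced_on_coset[OF pairing.target.tensor.is_group Phi_chain_hom_F Phi_chain_shuffle
        assms[unfolded mcb_C_eq]])

lemma Phi_coset:
  assumes "Poly_Mapping.keys c \<subseteq> mcb_symbols G M n"
  shows "Phi G M act \<phi> A lam n f (mcb_D G M n #>\<^bsub>mcb_P G M n\<^esub> c) = Phi_chain G M act \<phi> A lam n f c"
  unfolding Phi_def mcb_D_eq mcb_P_eq
  by (rule mcb.induced_coset[OF pairing.target.tensor.is_group Phi_chain_hom_F Phi_chain_shuffle assms])

lemma Phi_hom: "Phi G M act \<phi> A lam n f \<in> hom (mcb_C G M n) (tensor A A)"
  unfolding Phi_def mcb_C_eq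
  by (rule mcb.induced_hom[OF pairing.target.tensor.is_group Phi_chain_hom_F Phi_chain_shuffle])

end

theorem theorem5p7:
  fixes G :: "('g, 'x) monoid_scheme"
    and M :: "('m, 'y) ring_scheme"
    and act :: "'m \<Rightarrow> ('g \<Rightarrow>\<^sub>0 int) \<Rightarrow> 'm"
    and \<phi> :: "'g \<Rightarrow> 'g"
    and A :: "('a, 'z) monoid_scheme"
    and lam :: "'g \<Rightarrow> 'a"
    and f :: "('m list \<Rightarrow>\<^sub>0 int) set \<Rightarrow> 'a"
    and n :: nat
  assumes "group G"
    and "right_module (group_ring G) M act"
    and "\<phi> \<in> hom G (G\<lparr>carrier := center G\<rparr>)"
    and "comm_group A"
    and "lam \<in> hom G A"
    and "n \<ge> 2"
    and "normalized_group_cocycle G M act n A f"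
  shows "(\<forall>K \<in> carrier (mcb_C G M n). \<forall>c \<in> K.
            Phi G M act \<phi> A lam n f K = Phi_chain G M act \<phi> A lam n f c)
         \<and> mcb_cocycle G M act \<phi> n (tensor A A) (Phi G M act \<phi> A lam n f)"
proof -
  interpret cocycle_pairing G M act \<phi> A lam n f
    by (intro cocycle_pairing.intro G_Alexander.intro G_Alexander_axioms.intro
        cocycle_pairing_axioms.intro assms)
  have "Phi G M act \<phi> A lam n f (mcb_D G M n #>\<^bsub>mcb_P G M n\<^esub> mcb_boundary G M act \<phi> c)
      = \<one>\<^bsub>tensor A A\<^esub>" if "c \<in> carrier (mcb_P G M (n + 1))" for c
    using that Phi_coset[OF keys_mcb_boundary, of c] Phi_chain_mcb_boundary[of c]
    by (simp add: mcb_P_def)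
  then show ?thesis
    using Phi_hom Phi_on_coset by (simp add: mcb_cocycle_def)
qed

end
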